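(* Let $M$ be a closed (compact, without boundary) oriented smooth $m$-dimensional submanifold of $\mathbb{R}^k$, with $m=2r$ even and codimension $n=k-m\geq 1$, equipped with the metric induced from $\mathbb{R}^k$. Let $K_M$ be the generalized Gaussian curvature of $M$, $dV_M$ the Riemannian volume form of $M$, $\omega_d$ the volume of the $d$-dimensional unit sphere ($\omega_0=2$), and $\mathrm{Pff}(-\Omega/2\pi)$ the Pfaffian of the matrix $\Omega$ of curvature $2$-forms of $M$ scaled by the factor $-1/2\pi$. Then, as differential $m$-forms on $M$, \[ \frac{\omega_{n-1}}{\omega_{k-1}}\,K_M\,dV_M=\mathrm{Pff}\left(-\frac{\Omega}{2\pi}\right). \]
   Context: Let $\langle\cdot,\cdot\rangle$ be the Euclidean inner product on $\mathbb{R}^k$ and $D$ the standard flat connection of $\mathbb{R}^k$. The first fundamental form $\mathrm{I}_M$ is the restriction of $\langle\cdot,\cdot\rangle$ to the tangent spaces of $M$. The second fundamental form is $\mathrm{II}_M(X,Y)=(D_XY)^{\perp}$, the component of $D_XY$ normal to $M$, for $X,Y$ tangent to $M$. For $p\in M$ and a unit vector $\nu\in\mathbb{R}^k$ normal to $M$ at $p$, define the symmetric bilinear form $\mathrm{II}_M^\nu(\cdot,\cdot)=\langle \mathrm{II}_M(\cdot,\cdot),\nu\rangle$ on $T_pM$, and \[ K_M^\nu=\frac{\det(\mathrm{II}_M^\nu)}{\det(\mathrm{I}_M)}, \] where both determinants are computed with respect to the same basis of $T_pM$ (the quotient does not depend on the basis). Let $NS_p\subset S^{k-1}$ be the $(n-1)$-dimensional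 unit sphere of unit vectors normal to $M$ at $p$, with its standard volume measure $dV_{NS_p}$ (counting measure on the two unit normals when $n=1$). The generalized Gaussian curvature of $M$ at $p$ is \[ K_M(p)=\frac{1}{\omega_{n-1}}\int_{NS_p}K_M^\nu\,dV_{NS_p}, \] where $\omega_d$ is the volume of the unit sphere $S^d$, with the convention $\omega_0=2$. Curvature conventions: let $\nabla$ be the Levi-Civita connection of $M$ and $R(X,Y,Z,W)=\langle [\nabla_X,\nabla_Y]Z-\nabla_{[X,Y]}Z,\,W\rangle$. At a point $p$, choose a positively oriented orthonormal basis $(\epsilon_i)$ of $T_pM$ with dual basis $(\epsilon^i)$, and put $R_{ijab}=R(\epsilon_i,\epsilon_j,\epsilon_a,\epsilon_b)$. The curvature $2$-forms are $\Omega^{b}_{a}=\frac12\sum_{i,j}R_{ijab}\,\epsilon^i\wedge\epsilon^j$. With $m=2r$, the Pfaffian form at $p$ is \[ \mathrm{Pff}(-\Omega/2\pi)=\frac{(-1)^r}{2^m\pi^r r!}\sum_{\tau\in S_m}(-1)^{\tau}\,\Omega^{\tau(2)}_{\tau(1)}\wedge\cdots\wedge\Omega^{\tau(m)}_{\tau(m-1)}, \] where $S_m$ is the symmetric group on $\{1,\dots,m\}$ and $(-1)^\tau$ is the sign of $\tau$; this does not depend on the choice of positively oriented orthonormal basis. *)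

theory Defs
  imports "HOL-Analysis.Analysis" "Jordan_Normal_Form.Determinant"
begin

text \<open>The ambient space $\mathbb{R}^k$ is a Euclidean space type with \<open>k = DIM('a)\<close>. Families indexed
  by \<open>1, \<dots>, m\<close> in the mathematical text (frames, permutations, arguments of forms) are
  indexed by \<open>0, \<dots>, m - 1\<close> here.\<close>

section \<open>Smooth maps and submanifolds\<close>

primrec C_n_on ::
  "nat \<Rightarrow> 'a::real_normed_vector set \<Rightarrow> ('a \<Rightarrow> 'b::real_normed_vector) \<Rightarrow> bool" where
  "C_n_on 0 U f \<longleftrightarrow> continuous_on U f"
| "C_n_on (Suc n) U f \<longleftrightarrow> (\<forall>x\<in>U. f differentiable (at x)) \<and>
     (\<forall>v. C_n_on n U (\<lambda>x. frechet_derivative f (at x) v))"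

text \<open>Meaningful for open \<open>U\<close> in finite dimension, where it is the usual notion.\<close>

definition smooth_on ::
  "'a::real_normed_vector set \<Rightarrow> ('a \<Rightarrow> 'b::real_normed_vector) \<Rightarrow> bool" where
  "smooth_on U f \<longleftrightarrow> (\<forall>n. C_n_on n U f)"

definition diffeomorphism ::
  "'a::real_normed_vector set \<Rightarrow> 'b::real_normed_vector set \<Rightarrow> ('a \<Rightarrow> 'b) \<Rightarrow> ('b \<Rightarrow> 'a) \<Rightarrow> bool" where
  "diffeomorphism U V \<Phi> \<Psi> \<longleftrightarrow>
     open U \<and> open V \<and> homeomorphism U V \<Phi> \<Psi> \<and> smooth_on U \<Phi> \<and> smooth_on V \<Psi>"

text \<open>Embedded submanifold (without boundary), by slice charts; the model space is an arbitrary
  \<open>m\<close>-dimensional linear subspace \<open>E\<close>.\<close>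

definition submanifold :: "nat \<Rightarrow> 'a::euclidean_space set \<Rightarrow> bool" where
  "submanifold m M \<longleftrightarrow> (\<forall>p\<in>M. \<exists>U V \<Phi> \<Psi> E :: 'a set.
     p \<in> U \<and> diffeomorphism U V \<Phi> \<Psi> \<and> subspace E \<and> dim E = m \<and> \<Phi> ` (U \<inter> M) = V \<inter> E)"

definition tangent_space :: "'a::euclidean_space set \<Rightarrow> 'a \<Rightarrow> 'a set" where
  "tangent_space M p = {v. \<exists>(\<gamma> :: real \<Rightarrow> 'a) \<epsilon>. 0 < \<epsilon> \<and> smooth_on {-\<epsilon><..<\<epsilon>} \<gamma> \<and>
     \<gamma> ` {-\<epsilon><..<\<epsilon>} \<subseteq> M \<and> \<gamma> 0 = p \<and> (\<gamma> has_vector_derivative v) (at 0)}"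

definition normal_space :: "'a::euclidean_space set \<Rightarrow> 'a \<Rightarrow> 'a set" where
  "normal_space M p = orthogonal_comp (tangent_space M p)"

definition normal_part :: "'a::euclidean_space set \<Rightarrow> 'a \<Rightarrow> 'a \<Rightarrow> 'a" where
  "normal_part M p w = (THE z. z \<in> normal_space M p \<and> w - z \<in> tangent_space M p)"

text \<open>Functions on \<open>M\<close> and vector fields on \<open>M\<close> are represented by functions on the ambient space
  whose values off \<open>M\<close> are irrelevant.\<close>

definition smooth_fun ::
  "'a::euclidean_space set \<Rightarrow> ('a \<Rightarrow> 'b::real_normed_vector) \<Rightarrow> bool" where
  "smooth_fun M f \<longleftrightarrow> (\<forall>p\<in>M. \<exists>U F. open U \<and> p \<in> U \<and> smooth_on U F \<and> (\<forall>q\<in>M \<inter> U. F q = f q))"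

definition vector_field :: "'a::euclidean_space set \<Rightarrow> ('a \<Rightarrow> 'a) \<Rightarrow> bool" where
  "vector_field M X \<longleftrightarrow> smooth_fun M X \<and> (\<forall>p\<in>M. X p \<in> tangent_space M p)"

text \<open>The derivative at \<open>p\<close> of a function on \<open>M\<close> in the direction \<open>v\<close>. A derivative at \<open>p\<close>
  within \<open>M\<close> need not be unique, but its values on tangent vectors \<open>v\<close> are.\<close>

definition dir_deriv ::
  "'a::euclidean_space set \<Rightarrow> 'a \<Rightarrow> ('a \<Rightarrow> 'b::real_normed_vector) \<Rightarrow> 'a \<Rightarrow> 'b" where
  "dir_deriv M v f p = frechet_derivative f (at p within M) v"

text \<open>\<open>D\<^sub>X Y\<close>, for the flat connection \<open>D\<close> of the ambient space.\<close>

definition flat_connection :: "'a::euclidean_space set \<Rightarrow> ('a \<Rightarrow> 'a) \<Rightarrow> ('a \<Rightarrow> 'a) \<Rightarrow> 'a \<Rightarrow> 'a" where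
  "flat_connection M X Y = (\<lambda>p. dir_deriv M (X p) Y p)"

definition lie_bracket :: "'a::euclidean_space set \<Rightarrow> ('a \<Rightarrow> 'a) \<Rightarrow> ('a \<Rightarrow> 'a) \<Rightarrow> 'a \<Rightarrow> 'a" where
  "lie_bracket M X Y = (\<lambda>p. flat_connection M X Y p - flat_connection M Y X p)"

text \<open>A vector field with a prescribed value at \<open>p\<close>. It is only used in expressions that are
  tensorial, so that the choice does not matter.\<close>

definition extension :: "'a::euclidean_space set \<Rightarrow> 'a \<Rightarrow> 'a \<Rightarrow> 'a \<Rightarrow> 'a" where
  "extension M p v = (SOME X. vector_field M X \<and> X p = v)"


section \<open>Frames, orientations, and the volume form\<close>

text \<open>Only the values of a frame at indices below \<open>m\<close> matter.\<close>

definition basis_of :: "nat \<Rightarrow> 'a::euclidean_space set \<Rightarrow> (nat \<Rightarrow> 'a) \<Rightarrow> bool" where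
  "basis_of m S b \<longleftrightarrow> inj_on b {..<m} \<and> independent (b ` {..<m}) \<and> span (b ` {..<m}) = S"

definition orthonormal_basis_of :: "nat \<Rightarrow> 'a::euclidean_space set \<Rightarrow> (nat \<Rightarrow> 'a) \<Rightarrow> bool" where
  "orthonormal_basis_of m S e \<longleftrightarrow> basis_of m S e \<and>
     (\<forall>i<m. \<forall>j<m. inner (e i) (e j) = (if i = j then 1 else 0))"

definition det_of :: "nat \<Rightarrow> (nat \<Rightarrow> nat \<Rightarrow> real) \<Rightarrow> real" where
  "det_of m A = Determinant.det (Matrix.mat m m (\<lambda>(i, j). A i j))"

definition same_orientation ::
  "nat \<Rightarrow> (nat \<Rightarrow> 'a::euclidean_space) \<Rightarrow> (nat \<Rightarrow> 'a) \<Rightarrow> bool" where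
  "same_orientation m b c \<longleftrightarrow>
     (\<exists>A. 0 < det_of m A \<and> (\<forall>j<m. c j = (\<Sum>i<m. A i j *\<^sub>R b i)))"

text \<open>An orientation \<open>\<O>\<close> assigns to each point of \<open>M\<close> the set of positively oriented bases of
  the tangent space: one class under \<open>same_orientation\<close>, with continuous local representatives.\<close>

definition orientation ::
  "nat \<Rightarrow> 'a::euclidean_space set \<Rightarrow> ('a \<Rightarrow> (nat \<Rightarrow> 'a) set) \<Rightarrow> bool" where
  "orientation m M \<O> \<longleftrightarrow>
     (\<forall>p\<in>M. \<exists>b. basis_of m (tangent_space M p) b \<and> \<O> p = {c. same_orientation m b c}) \<and>
     (\<forall>p\<in>M. \<exists>U (E :: nat \<Rightarrow> 'a \<Rightarrow> 'a). open U \<and> p \<in> U \<and>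
        (\<forall>i<m. continuous_on (M \<inter> U) (E i)) \<and> (\<forall>q\<in>M \<inter> U. (\<lambda>i. E i q) \<in> \<O> q))"

definition positive_onb ::
  "nat \<Rightarrow> 'a::euclidean_space set \<Rightarrow> ('a \<Rightarrow> (nat \<Rightarrow> 'a) set) \<Rightarrow> 'a \<Rightarrow> (nat \<Rightarrow> 'a) \<Rightarrow> bool" where
  "positive_onb m M \<O> p e \<longleftrightarrow> orthonormal_basis_of m (tangent_space M p) e \<and> e \<in> \<O> p"

text \<open>A \<open>d\<close>-form at a point is a function of \<open>v\<close> that uses the tangent vectors
  \<open>v 0, \<dots>, v (d - 1)\<close>.\<close>

definition volume_form ::
  "nat \<Rightarrow> 'a::euclidean_space set \<Rightarrow> ('a \<Rightarrow> (nat \<Rightarrow> 'a) set) \<Rightarrow> 'a \<Rightarrow> (nat \<Rightarrow> 'a) \<Rightarrow> real" where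
  "volume_form m M \<O> p v =
     (let e = SOME e. positive_onb m M \<O> p e in det_of m (\<lambda>i j. inner (e i) (v j)))"

text \<open>The product of a \<open>c\<close>-form and a \<open>d\<close>-form, normalized such that
  \<open>\<epsilon>\<^sup>1 \<and> \<dots> \<and> \<epsilon>\<^sup>m\<close> is the volume form for the dual basis \<open>\<epsilon>\<close> of a positive orthonormal basis.\<close>

definition wedge ::
  "nat \<Rightarrow> nat \<Rightarrow> ((nat \<Rightarrow> 'a) \<Rightarrow> real) \<Rightarrow> ((nat \<Rightarrow> 'a) \<Rightarrow> real) \<Rightarrow> (nat \<Rightarrow> 'a) \<Rightarrow> real" where
  "wedge c d \<alpha> \<beta> = (\<lambda>v. (\<Sum>\<sigma> | \<sigma> permutes {..<c + d}.
     of_int (sign \<sigma>) * \<alpha> (\<lambda>i. v (\<sigma> i)) * \<beta> (\<lambda>i. v (\<sigma> (c + i)))) / (fact c * fact d))"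

text \<open>\<open>\<alpha>\<^sub>0 \<and> \<dots> \<and> \<alpha>\<^sub>s\<^sub>-\<^sub>1\<close> for 2-forms \<open>\<alpha>\<^sub>i\<close>.\<close>

primrec wedge_2forms ::
  "nat \<Rightarrow> (nat \<Rightarrow> (nat \<Rightarrow> 'a) \<Rightarrow> real) \<Rightarrow> (nat \<Rightarrow> 'a) \<Rightarrow> real" where
  "wedge_2forms 0 \<alpha> = (\<lambda>v. 1)"
| "wedge_2forms (Suc s) \<alpha> = wedge (2 * s) 2 (wedge_2forms s \<alpha>) (\<alpha> s)"


section \<open>The volume measure of unit spheres\<close>

text \<open>Lebesgue measure of a linear subspace, as a measure on the ambient space.\<close>

definition subspace_lborel :: "'a::euclidean_space set \<Rightarrow> 'a measure" where
  "subspace_lborel N = (let n = dim N; b = SOME b. orthonormal_basis_of n N b in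
     distr (Pi\<^sub>M {..<n} (\<lambda>_. lborel)) borel (\<lambda>c. \<Sum>i<n. c i *\<^sub>R b i))"

text \<open>Surface measure of the unit sphere of an \<open>n\<close>-dimensional linear subspace \<open>N\<close>, as in
  integration in polar coordinates: \<open>n\<close> times the Lebesgue measure of the cone
  \<open>{t *\<^sub>R x | 0 < t \<le> 1, x \<in> A}\<close> is the volume of \<open>A\<close>. Recall \<open>sgn x = x /\<^sub>R norm x\<close>.
  For \<open>n = 1\<close> this is the counting measure on the two unit vectors.\<close>

definition sphere_measure :: "'a::euclidean_space set \<Rightarrow> 'a measure" where
  "sphere_measure N = distr
     (density (subspace_lborel N) (\<lambda>x. ennreal (real (dim N)) * indicator (cball 0 1) x)) borel sgn"

text \<open>The volume \<open>\<omega>\<^sub>d\<close> of the \<open>d\<close>-dimensional unit sphere; see \<open>measure_sphere_measure\<close> below.\<close>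

definition sphere_vol :: "nat \<Rightarrow> real" where
  "sphere_vol d = real (Suc d) * unit_ball_vol (real (Suc d))"

lemma sphere_vol_0: "sphere_vol 0 = 2"
  by (simp add: sphere_vol_def)

lemma orthonormal_basis_of_exists:
  assumes "subspace (N :: 'a::euclidean_space set)"
  shows "\<exists>b. orthonormal_basis_of (dim N) N b"
proof -
  obtain B where B: "B \<subseteq> N" "pairwise real_inner_class.orthogonal B" "\<And>x. x \<in> B \<Longrightarrow> norm x = 1"
    "independent B" "card B = dim N" "span B = N"
    using orthonormal_basis_subspace[OF assms] by blast
  have "finite B" using B(4) by (simp add: independent_imp_finite)
  then obtain b where b: "bij_betw b {..<dim N} B"
    using ex_bij_betw_nat_finite[of B] B(5) by (auto simp: atLeast0LessThan)
  have "inner (b i) (b j) = (if i = j then 1 else 0)" if ij: "i < dim N" "j < dim N" for i j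
  proof (cases "i = j")
    case True
    have "b j \<in> B" using b ij by (auto simp: bij_betw_def)
    then show ?thesis using B(3) True by (simp add: norm_eq_1)
  next
    case False
    have "b i \<in> B" "b j \<in> B" "b i \<noteq> b j"
      using b ij False by (auto simp: bij_betw_def inj_on_def)
    then show ?thesis using B(2) False by (auto simp: pairwise_def real_inner_class.orthogonal_def)
  qed
  then have "orthonormal_basis_of (dim N) N b"
    using b B by (auto simp: orthonormal_basis_of_def basis_of_def bij_betw_def)
  then show ?thesis by blast
qed

lemma norm_orthonormal_sum:
  assumes "orthonormal_basis_of n N b"
  shows "norm (\<Sum>i<n. c i *\<^sub>R b i) = sqrt (\<Sum>i<n. (c i)\<^sup>2)"
proof -
  have o: "inner (b i) (b j) = (if i = j then 1 else 0)" if "i < n" "j < n" for i j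
    using assms that by (auto simp: orthonormal_basis_of_def)
  have "inner (\<Sum>i<n. c i *\<^sub>R b i) (\<Sum>i<n. c i *\<^sub>R b i)
      = (\<Sum>i<n. \<Sum>j<n. c i * (c j * inner (b i) (b j)))"
    by (simp add: inner_sum_left inner_sum_right inner_commute mult.left_commute)
  also have "\<dots> = (\<Sum>i<n. \<Sum>j<n. if i = j then c i * c i else 0)"
    by (intro sum.cong refl) (auto simp: o)
  also have "\<dots> = (\<Sum>i<n. (c i)\<^sup>2)"
    by (simp add: power2_eq_square)
  finally show ?thesis by (simp add: norm_eq_sqrt_inner)
qed

theorem measure_sphere_measure:
  assumes "subspace (N :: 'a::euclidean_space set)" "0 < dim N"
  shows "measure (sphere_measure N) UNIV = sphere_vol (dim N - 1)"
proof -
  define n where "n = dim N"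
  define b where "b = (SOME b. orthonormal_basis_of n N b)"
  define P where "P = Pi\<^sub>M {..<n} (\<lambda>_. lborel :: real measure)"
  define g where "g = (\<lambda>c. \<Sum>i<n. c i *\<^sub>R b i)"
  have b: "orthonormal_basis_of n N b"
    unfolding b_def n_def by (rule someI_ex[OF orthonormal_basis_of_exists[OF assms(1)]])
  have g: "g \<in> P \<rightarrow>\<^sub>M borel"
    unfolding g_def P_def by measurable
  have L: "subspace_lborel N = distr P borel g"
    by (simp add: subspace_lborel_def Let_def P_def g_def b_def n_def)
  have sgn: "(sgn :: 'a \<Rightarrow> 'a) \<in> borel_measurable borel"
    unfolding sgn_div_norm by measurable
  have ind: "(\<lambda>x. ennreal (real n) * indicator (cball 0 1) x) \<in> borel_measurable (distr P borel g)"
    unfolding measurable_distr_eq1 by (intro borel_measurable_times_ennreal borel_measurable_indicator) auto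
  have "emeasure (sphere_measure N) UNIV =
      (\<integral>\<^sup>+x. ennreal (real n) * indicator (cball 0 1) x \<partial>subspace_lborel N)"
    unfolding sphere_measure_def n_def[symmetric]
    by (subst emeasure_distr) (simp_all add: sgn L emeasure_density[OF ind])
  also have "\<dots> = ennreal (real n) * emeasure (subspace_lborel N) (cball 0 1)"
    by (simp add: nn_integral_cmult_indicator L)
  also have "emeasure (subspace_lborel N) (cball 0 1) = emeasure P (g -` cball 0 1 \<inter> space P)"
    unfolding L using g by (subst emeasure_distr) auto
  also have "g -` cball 0 1 \<inter> space P = {f. sqrt (\<Sum>i\<in>{..<n}. (f i)\<^sup>2) \<le> 1} \<inter> space P"
    using norm_orthonormal_sum[OF b] by (auto simp: g_def)
  also have "emeasure P \<dots> = ennreal (unit_ball_vol (real n))"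
    using emeasure_cball_aux[of "{..<n}" 1] by (simp add: P_def)
  also have "ennreal (real n) * \<dots> = ennreal (real n * unit_ball_vol (real n))"
    by (simp add: ennreal_mult)
  finally show ?thesis
    using assms(2) by (simp add: measure_def sphere_vol_def n_def)
qed


section \<open>Extrinsic curvature\<close>

definition second_fundamental_form :: "'a::euclidean_space set \<Rightarrow> 'a \<Rightarrow> 'a \<Rightarrow> 'a \<Rightarrow> 'a" where
  "second_fundamental_form M p x y =
     normal_part M p (flat_connection M (extension M p x) (extension M p y) p)"

definition K_normal :: "nat \<Rightarrow> 'a::euclidean_space set \<Rightarrow> 'a \<Rightarrow> 'a \<Rightarrow> real" where
  "K_normal m M p \<nu> = (let b = SOME b. basis_of m (tangent_space M p) b in
     det_of m (\<lambda>i j. inner (second_fundamental_form M p (b i) (b j)) \<nu>) /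
     det_of m (\<lambda>i j. inner (b i) (b j)))"

definition generalized_gauss_curvature :: "nat \<Rightarrow> 'a::euclidean_space set \<Rightarrow> 'a \<Rightarrow> real" where
  "generalized_gauss_curvature m M p = 1 / sphere_vol (DIM('a) - m - 1) *
     (\<integral>\<nu>. K_normal m M p \<nu> \<partial>sphere_measure (normal_space M p))"


section \<open>Intrinsic curvature\<close>

definition affine_connection ::
  "'a::euclidean_space set \<Rightarrow> (('a \<Rightarrow> 'a) \<Rightarrow> ('a \<Rightarrow> 'a) \<Rightarrow> 'a \<Rightarrow> 'a) \<Rightarrow> bool" where
  "affine_connection M conn \<longleftrightarrow>
     (\<forall>X Y. vector_field M X \<and> vector_field M Y \<longrightarrow> vector_field M (conn X Y)) \<and>
     (\<forall>X X' Y. vector_field M X \<and> vector_field M X' \<and> vector_field M Y \<longrightarrow>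
        (\<forall>p\<in>M. conn (\<lambda>q. X q + X' q) Y p = conn X Y p + conn X' Y p)) \<and>
     (\<forall>f X Y. smooth_fun M f \<and> vector_field M X \<and> vector_field M Y \<longrightarrow>
        (\<forall>p\<in>M. conn (\<lambda>q. f q *\<^sub>R X q) Y p = f p *\<^sub>R conn X Y p)) \<and>
     (\<forall>X Y Y'. vector_field M X \<and> vector_field M Y \<and> vector_field M Y' \<longrightarrow>
        (\<forall>p\<in>M. conn X (\<lambda>q. Y q + Y' q) p = conn X Y p + conn X Y' p)) \<and>
     (\<forall>f X Y. smooth_fun M f \<and> vector_field M X \<and> vector_field M Y \<longrightarrow>
        (\<forall>p\<in>M. conn X (\<lambda>q. f q *\<^sub>R Y q) p = dir_deriv M (X p) f p *\<^sub>R Y p + f p *\<^sub>R conn X Y p))"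

definition levi_civita_connection ::
  "'a::euclidean_space set \<Rightarrow> (('a \<Rightarrow> 'a) \<Rightarrow> ('a \<Rightarrow> 'a) \<Rightarrow> 'a \<Rightarrow> 'a) \<Rightarrow> bool" where
  "levi_civita_connection M conn \<longleftrightarrow> affine_connection M conn \<and>
     (\<forall>X Y. vector_field M X \<and> vector_field M Y \<longrightarrow>
        (\<forall>p\<in>M. conn X Y p - conn Y X p = lie_bracket M X Y p)) \<and>
     (\<forall>X Y Z. vector_field M X \<and> vector_field M Y \<and> vector_field M Z \<longrightarrow>
        (\<forall>p\<in>M. dir_deriv M (X p) (\<lambda>q. inner (Y q) (Z q)) p =
           inner (conn X Y p) (Z p) + inner (Y p) (conn X Z p)))"

text \<open>\<open>R(x, y, z, w)\<close> for tangent vectors \<open>x, y, z, w\<close> at \<open>p\<close>.\<close>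

definition riemann_tensor ::
  "'a::euclidean_space set \<Rightarrow> (('a \<Rightarrow> 'a) \<Rightarrow> ('a \<Rightarrow> 'a) \<Rightarrow> 'a \<Rightarrow> 'a) \<Rightarrow> 'a \<Rightarrow>
     'a \<Rightarrow> 'a \<Rightarrow> 'a \<Rightarrow> 'a \<Rightarrow> real" where
  "riemann_tensor M conn p x y z w =
     (let X = extension M p x; Y = extension M p y; Z = extension M p z
      in inner (conn X (conn Y Z) p - conn Y (conn X Z) p - conn (lie_bracket M X Y) Z p) w)"

text \<open>The covectors \<open>\<epsilon>\<^sup>i\<close> dual to an orthonormal basis \<open>e\<close>, as 1-forms.\<close>

definition dual_covector :: "(nat \<Rightarrow> 'a::euclidean_space) \<Rightarrow> nat \<Rightarrow> (nat \<Rightarrow> 'a) \<Rightarrow> real" where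
  "dual_covector e i = (\<lambda>v. inner (e i) (v 0))"

text \<open>\<open>curvature_form m M conn p e a b\<close> is \<open>\<Omega>\<^sub>a\<^sup>b\<close> at \<open>p\<close> in the orthonormal basis \<open>e\<close>.\<close>

definition curvature_form ::
  "nat \<Rightarrow> 'a::euclidean_space set \<Rightarrow> (('a \<Rightarrow> 'a) \<Rightarrow> ('a \<Rightarrow> 'a) \<Rightarrow> 'a \<Rightarrow> 'a) \<Rightarrow> 'a \<Rightarrow>
     (nat \<Rightarrow> 'a) \<Rightarrow> nat \<Rightarrow> nat \<Rightarrow> (nat \<Rightarrow> 'a) \<Rightarrow> real" where
  "curvature_form m M conn p e a b = (\<lambda>v. 1 / 2 * (\<Sum>i<m. \<Sum>j<m.
     riemann_tensor M conn p (e i) (e j) (e a) (e b) *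
     wedge 1 1 (dual_covector e i) (dual_covector e j) v))"

text \<open>\<open>Pff(-\<Omega>/2\<pi>)\<close> at \<open>p\<close>, computed in the positive orthonormal basis \<open>e\<close>, for \<open>m = 2r\<close>.\<close>

definition pfaffian_form ::
  "nat \<Rightarrow> 'a::euclidean_space set \<Rightarrow> (('a \<Rightarrow> 'a) \<Rightarrow> ('a \<Rightarrow> 'a) \<Rightarrow> 'a \<Rightarrow> 'a) \<Rightarrow> 'a \<Rightarrow>
     (nat \<Rightarrow> 'a) \<Rightarrow> (nat \<Rightarrow> 'a) \<Rightarrow> real" where
  "pfaffian_form r M conn p e = (\<lambda>v. (-1) ^ r / (2 ^ (2 * r) * pi ^ r * fact r) *
     (\<Sum>\<tau> | \<tau> permutes {..<2 * r}. of_int (sign \<tau>) *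
        wedge_2forms r (\<lambda>s. curvature_form (2 * r) M conn p e (\<tau> (2 * s)) (\<tau> (2 * s + 1))) v))"

end

(* The second fundamental form II is a symmetric bilinear form with values in the normal space. In an
   orthonormal tangent basis with h_ij = II(e_i, e_j), the determinant of <h_ij, nu> is a homogeneous
   polynomial of degree m = 2r in the normal vector nu, and its integral over the unit normal sphere is
   given by Wick's formula: up to a constant, the integral of a product of 2r linear forms <A_i, nu> is the
   sum over all pairings of the products of the inner products <A_i, A_j>. On the other side, the Gauss
   equation R(x, y, z, w) = <II(y, z), II(x, w)> - <II(x, z), II(y, w)> turns the Pfaffian into the
   alternating sum of exactly these pairings.

   Wick's formula is reduced by polarization to the powers <A, nu>^(2r), whose integrals follow from
   Gaussian moments in polar coordinates. The surviving constant is the volume of the unit sphere of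
   dimension n + 2r - 1 = k - 1. *)

theory Submission
  imports Defs "HOL-Probability.Distributions"
begin

section \<open>Determinants and the Pfaffian\<close>

text \<open>The sphere measure is by definition a radial image of Lebesgue measure on the unit ball,
  so a sphere integral is a ball integral of a function of the direction. Polar coordinates then
  reduce to the scaling of Lebesgue measure: level-set formulas in the radius relate the ball
  integral of the direction part, the ball integral of the polynomial itself, and its Gaussian
  integral.

  Extensions of tangent vectors are arbitrary choices, so their existence must be secured first:
  constant fields are projected to the tangent spaces, and the projection is smooth because it is a
  Gram-Schmidt process on gradients of chart components. The connection is known only by its axioms;
  Koszul's argument identifies it with the tangential part of the flat one.

  Both sides meet in a sum over two independent permutations. On the integral side they are the
  pairing of Wick's formula and its composite with the Leibniz permutation; on the other side, the
  permutation of the Pfaffian and that of the form indices. Wick's constant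
  \<open>1 / ((2 * pi) ^ r * 2 ^ r * fact r)\<close> is exactly the Pfaffian's
  \<open>1 / (4 ^ r * pi ^ r * fact r)\<close>.\<close>

lemma det_of_sum:
  "det_of m A = (\<Sum>\<sigma> | \<sigma> permutes {..<m}. of_int (sign \<sigma>) * (\<Prod>i<m. A i (\<sigma> i)))"
proof -
  have "(\<Prod>i<m. Matrix.mat m m (\<lambda>(i, j). A i j) $$ (i, \<sigma> i)) = (\<Prod>i<m. A i (\<sigma> i))"
    if "\<sigma> permutes {..<m}" for \<sigma>
    using permutes_in_image[OF that] by (intro prod.cong refl) auto
  then show ?thesis
    unfolding det_of_def by (subst det_def'[of _ m]) (simp_all add: atLeast0LessThan)
qed

lemma det_of_cong:
  assumes "\<And>i j. i < m \<Longrightarrow> j < m \<Longrightarrow> A i j = B i j"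
  shows "det_of m A = det_of m B"
  unfolding det_of_def by (rule arg_cong[of _ _ Determinant.det]) (auto simp: assms)

lemma det_of_mult: "det_of m (\<lambda>i j. \<Sum>k<m. A i k * B k j) = det_of m A * det_of m B"
proof -
  have "Matrix.mat m m (\<lambda>(i, j). \<Sum>k<m. A i k * B k j)
      = Matrix.mat m m (\<lambda>(i, j). A i j) * Matrix.mat m m (\<lambda>(i, j). B i j)"
    by (rule eq_matI) (simp_all add: scalar_prod_def atLeast0LessThan)
  then show ?thesis unfolding det_of_def by (simp add: det_mult[of _ m])
qed

lemma det_of_transpose: "det_of m (\<lambda>i j. A j i) = det_of m A"
proof -
  have "Matrix.mat m m (\<lambda>(i, j). A j i) = transpose_mat (Matrix.mat m m (\<lambda>(i, j). A i j))"
    by (rule eq_matI) auto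
  then show ?thesis unfolding det_of_def by (simp add: Determinant.det_transpose[of _ m])
qed

lemma det_of_id: "det_of m (\<lambda>i j. if i = j then 1 else 0) = 1"
proof -
  have "Matrix.mat m m (\<lambda>(i, j). if i = j then 1 else 0) = (1\<^sub>m m :: real mat)"
    by (rule eq_matI) auto
  then show ?thesis by (simp add: det_of_def)
qed

lemma det_of_permute_rows:
  assumes "\<sigma> permutes {..<m}"
  shows "det_of m (\<lambda>i j. A (\<sigma> i) j) = of_int (sign \<sigma>) * det_of m A"
proof -
  have "Matrix.mat m m (\<lambda>(i, j). A (\<sigma> i) j)
      = Matrix.mat m m (\<lambda>(i, j). Matrix.mat m m (\<lambda>(i, j). A i j) $$ (\<sigma> i, j))"
    using permutes_in_image[OF assms] by (intro eq_matI) auto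
  then show ?thesis
    unfolding det_of_def using det_permute_rows[of "Matrix.mat m m (\<lambda>(i, j). A i j)" m \<sigma>] assms
    by (simp add: atLeast0LessThan)
qed

lemma det_of_identical_rows:
  assumes "i < m" "j < m" "i \<noteq> j" "\<And>k. k < m \<Longrightarrow> A i k = A j k"
  shows "det_of m A = 0"
  unfolding det_of_def
  by (rule det_identical_rows[of _ m i j]) (use assms in \<open>auto intro!: eq_vecI\<close>)

section \<open>Alternating sums over index functions and permutations\<close>

text \<open>Extensional functions are \<open>undefined\<close> off \<open>S\<close>, permutations
  are the identity there; restricting and refilling translate between the two conventions.\<close>

lemma sum_bij_PiE_permutes:
  fixes g :: "('b \<Rightarrow> 'b) \<Rightarrow> 'c::comm_monoid_add"
  assumes "finite S"
  shows "(\<Sum>f | f \<in> S \<rightarrow>\<^sub>E S \<and> bij_betw f S S. g f) = (\<Sum>\<sigma> | \<sigma> permutes S. g (restrict \<sigma> S))"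
proof (rule sum.reindex_bij_witness[of _ "\<lambda>\<sigma>. restrict \<sigma> S" "\<lambda>f x. if x \<in> S then f x else x"])
  fix f assume f: "f \<in> {f. f \<in> S \<rightarrow>\<^sub>E S \<and> bij_betw f S S}"
  have "bij_betw (\<lambda>x. if x \<in> S then f x else x) S S \<longleftrightarrow> bij_betw f S S"
    by (rule bij_betw_cong) simp
  then have "(\<lambda>x. if x \<in> S then f x else x) permutes S"
    using f by (intro bij_imp_permutes) simp_all
  then show "(\<lambda>x. if x \<in> S then f x else x) \<in> {\<sigma>. \<sigma> permutes S}" by simp
  show "restrict (\<lambda>x. if x \<in> S then f x else x) S = f"
  proof
    fix x show "restrict (\<lambda>x. if x \<in> S then f x else x) S x = f x"
      using f PiE_arb[of f S "\<lambda>_. S" x] by (cases "x \<in> S") simp_all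
  qed
  then show "g (restrict (\<lambda>x. if x \<in> S then f x else x) S) = g f" by simp
next
  fix \<sigma> assume \<sigma>: "\<sigma> \<in> {\<sigma>. \<sigma> permutes S}"
  then show "(\<lambda>x. if x \<in> S then restrict \<sigma> S x else x) = \<sigma>"
    by (simp add: fun_eq_iff permutes_def)
  show "restrict \<sigma> S \<in> {f. f \<in> S \<rightarrow>\<^sub>E S \<and> bij_betw f S S}"
    using \<sigma> permutes_imp_bij[of \<sigma> S] permutes_in_image[of \<sigma> S]
    by (simp add: PiE_iff)
qed

text \<open>Summing over \<open>\<rho>\<close> first yields the determinant whose rows are selected
  by \<open>f\<close>; a repeated row kills it, and a permutation contributes its sign. This
  separates the arguments of a form from its coefficients. The assumption on \<open>G\<close>
  bridges the different values of extensional functions and permutations outside the index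
  range.\<close>

lemma alternating_expansion:
  fixes A :: "nat \<Rightarrow> nat \<Rightarrow> real"
  assumes G: "\<And>f g. (\<And>i. i < m \<Longrightarrow> f i = g i) \<Longrightarrow> G f = G g"
  shows "(\<Sum>\<rho> | \<rho> permutes {..<m}. of_int (sign \<rho>) *
      (\<Sum>f\<in>{..<m} \<rightarrow>\<^sub>E {..<m}. G f * (\<Prod>i<m. A (f i) (\<rho> i))))
    = det_of m A * (\<Sum>\<sigma> | \<sigma> permutes {..<m}. of_int (sign \<sigma>) * G \<sigma>)"
proof -
  have "(\<Sum>\<rho> | \<rho> permutes {..<m}. of_int (sign \<rho>) *
      (\<Sum>f\<in>{..<m} \<rightarrow>\<^sub>E {..<m}. G f * (\<Prod>i<m. A (f i) (\<rho> i))))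
    = (\<Sum>f\<in>{..<m} \<rightarrow>\<^sub>E {..<m}. G f * det_of m (\<lambda>i j. A (f i) j))"
    unfolding det_of_sum sum_distrib_left by (subst sum.swap) (simp add: mult.left_commute)
  also have "\<dots> = (\<Sum>f | f \<in> {..<m} \<rightarrow>\<^sub>E {..<m} \<and> bij_betw f {..<m} {..<m}. G f * det_of m (\<lambda>i j. A (f i) j))"
  proof (rule sum.mono_neutral_right)
    show "\<forall>f\<in>({..<m} \<rightarrow>\<^sub>E {..<m}) - {f. f \<in> {..<m} \<rightarrow>\<^sub>E {..<m} \<and> bij_betw f {..<m} {..<m}}.
        G f * det_of m (\<lambda>i j. A (f i) j) = 0"
    proof
      fix f assume f: "f \<in> ({..<m} \<rightarrow>\<^sub>E {..<m}) - {f. f \<in> {..<m} \<rightarrow>\<^sub>E {..<m} \<and> bij_betw f {..<m} {..<m}}"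
      have "\<not> inj_on f {..<m}"
        using f endo_inj_surj[of "{..<m}" f] by (auto simp: bij_betw_def PiE_iff)
      then obtain i j where "i < m" "j < m" "i \<noteq> j" "f i = f j" by (auto simp: inj_on_def)
      then show "G f * det_of m (\<lambda>i j. A (f i) j) = 0"
        using det_of_identical_rows[of i m j "\<lambda>i j. A (f i) j"] by simp
    qed
  qed (auto intro: finite_PiE)
  also have "\<dots> = (\<Sum>\<sigma> | \<sigma> permutes {..<m}. G (restrict \<sigma> {..<m}) * det_of m (\<lambda>i j. A (restrict \<sigma> {..<m} i) j))"
    by (rule sum_bij_PiE_permutes) simp
  also have "\<dots> = (\<Sum>\<sigma> | \<sigma> permutes {..<m}. det_of m A * (of_int (sign \<sigma>) * G \<sigma>))"
  proof (rule sum.cong[OF refl])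
    fix \<sigma> assume "\<sigma> \<in> {\<sigma>. \<sigma> permutes {..<m}}"
    then have "det_of m (\<lambda>i j. A (restrict \<sigma> {..<m} i) j) = of_int (sign \<sigma>) * det_of m A"
      using det_of_permute_rows[of \<sigma> m A] by (simp cong: det_of_cong)
    moreover have "G (restrict \<sigma> {..<m}) = G \<sigma>" by (rule G) simp
    ultimately show "G (restrict \<sigma> {..<m}) * det_of m (\<lambda>i j. A (restrict \<sigma> {..<m} i) j)
      = det_of m A * (of_int (sign \<sigma>) * G \<sigma>)" by simp
  qed
  finally show ?thesis by (simp add: sum_distrib_left)
qed

text \<open>Distributivity with two indices per factor: positions \<open>2 * s\<close> and
  \<open>2 * s + 1\<close> of a single index function belong to factor \<open>s\<close>. It serves
  both products of curvature forms and powers of a squared norm.\<close>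

lemma prod_sum_pairs:
  fixes g :: "nat \<Rightarrow> 'b \<Rightarrow> 'b \<Rightarrow> 'c::comm_semiring_1"
  assumes "finite T"
  shows "(\<Prod>s<r. \<Sum>i\<in>T. \<Sum>j\<in>T. g s i j)
    = (\<Sum>f\<in>{..<2 * r} \<rightarrow>\<^sub>E T. \<Prod>s<r. g s (f (2 * s)) (f (2 * s + 1)))"
proof (induction r)
  case (Suc r)
  have ins: "(\<Sum>f\<in>insert x S \<rightarrow>\<^sub>E T. h f) = (\<Sum>y\<in>T. \<Sum>f\<in>S \<rightarrow>\<^sub>E T. h (f(x := y)))"
    if "x \<notin> S" for S and x :: nat and h :: "(nat \<Rightarrow> 'b) \<Rightarrow> 'c"
    unfolding PiE_insert_eq sum.cartesian_product
    by (subst sum.reindex[OF inj_combinator[OF that]]) (simp add: comp_def case_prod_unfold)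
  have "{..<2 * Suc r} = insert (2 * r) (insert (2 * r + 1) {..<2 * r})" by auto
  then have "(\<Sum>f\<in>{..<2 * Suc r} \<rightarrow>\<^sub>E T. \<Prod>s<Suc r. g s (f (2 * s)) (f (2 * s + 1)))
    = (\<Sum>i\<in>T. \<Sum>j\<in>T. \<Sum>f\<in>{..<2 * r} \<rightarrow>\<^sub>E T.
        \<Prod>s<Suc r. g s ((f(2 * r + 1 := j, 2 * r := i)) (2 * s)) ((f(2 * r + 1 := j, 2 * r := i)) (2 * s + 1)))"
    by (simp add: ins)
  also have "\<dots> = (\<Sum>i\<in>T. \<Sum>j\<in>T. \<Sum>f\<in>{..<2 * r} \<rightarrow>\<^sub>E T.
        (\<Prod>s<r. g s (f (2 * s)) (f (2 * s + 1))) * g r i j)"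
  proof (intro sum.cong refl)
    fix i j f
    have "(\<Prod>s<r. g s ((f(2 * r + 1 := j, 2 * r := i)) (2 * s)) ((f(2 * r + 1 := j, 2 * r := i)) (2 * s + 1)))
      = (\<Prod>s<r. g s (f (2 * s)) (f (2 * s + 1)))"
    proof (rule prod.cong[OF refl])
      fix s assume "s \<in> {..<r}"
      then have "2 * s \<noteq> 2 * r" "2 * s \<noteq> 2 * r + 1" "2 * s + 1 \<noteq> 2 * r" "2 * s + 1 \<noteq> 2 * r + 1"
        by auto
      then show "g s ((f(2 * r + 1 := j, 2 * r := i)) (2 * s)) ((f(2 * r + 1 := j, 2 * r := i)) (2 * s + 1))
        = g s (f (2 * s)) (f (2 * s + 1))" by simp
    qed
    then show "(\<Prod>s<Suc r. g s ((f(2 * r + 1 := j, 2 * r := i)) (2 * s)) ((f(2 * r + 1 := j, 2 * r := i)) (2 * s + 1)))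
      = (\<Prod>s<r. g s (f (2 * s)) (f (2 * s + 1))) * g r i j" by simp
  qed
  also have "\<dots> = (\<Prod>s<Suc r. \<Sum>i\<in>T. \<Sum>j\<in>T. g s i j)"
    by (simp add: Suc.IH sum_distrib_left sum_distrib_right)
  finally show ?case by simp
qed simp

section \<open>Products of curvature forms\<close>

text \<open>By induction the left factor is an alternating sum over permutations
  \<open>\<rho>\<close> of the first \<open>2 * r\<close> slots. Each \<open>\<rho>\<close> is
  absorbed into the outer permutation, giving \<open>fact (2 * r)\<close> equal copies that cancel
  the normalization of \<open>wedge\<close>; one \<open>fact 2\<close> per form survives.\<close>

lemma wedge_2forms_eq:
  fixes v :: "nat \<Rightarrow> 'a"
  assumes "\<And>s v. \<alpha> s v = B s (v 0) (v 1)"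
  shows "wedge_2forms r \<alpha> v = (\<Sum>\<rho> | \<rho> permutes {..<2 * r}.
      of_int (sign \<rho>) * (\<Prod>s<r. B s (v (\<rho> (2 * s))) (v (\<rho> (2 * s + 1))))) / 2 ^ r"
proof (induction r arbitrary: v)
  case (Suc r)
  let ?P = "{\<sigma>. \<sigma> permutes {..<2 * r + 2}}" and ?Q = "{\<rho>. \<rho> permutes {..<2 * r}}"
  let ?b = "\<lambda>\<sigma> s. B s (v (\<sigma> (2 * s))) (v (\<sigma> (2 * s + 1)))"
  have Q: "\<rho> \<in> ?P" if "\<rho> \<in> ?Q" for \<rho> :: "nat \<Rightarrow> nat"
    using that by (auto intro: permutes_subset)
  have perm: "permutation \<sigma>" if "\<sigma> \<in> ?P" for \<sigma> :: "nat \<Rightarrow> nat"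
    using that by (auto simp: permutation_permutes)
  have "wedge_2forms (Suc r) \<alpha> v = (\<Sum>\<sigma>\<in>?P. of_int (sign \<sigma>) * wedge_2forms r \<alpha> (\<lambda>i. v (\<sigma> i)) * ?b \<sigma> r) / (fact (2 * r) * 2)"
    by (simp add: wedge_def assms)
  also have "(\<Sum>\<sigma>\<in>?P. of_int (sign \<sigma>) * wedge_2forms r \<alpha> (\<lambda>i. v (\<sigma> i)) * ?b \<sigma> r)
    = (\<Sum>\<sigma>\<in>?P. \<Sum>\<rho>\<in>?Q. of_int (sign (\<sigma> \<circ> \<rho>)) * (\<Prod>s<Suc r. ?b (\<sigma> \<circ> \<rho>) s)) / 2 ^ r"
    unfolding Suc.IH sum_divide_distrib sum_distrib_left sum_distrib_right
  proof (intro sum.cong refl)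
    fix \<sigma> \<rho> :: "nat \<Rightarrow> nat" assume \<sigma>: "\<sigma> \<in> ?P" and \<rho>: "\<rho> \<in> ?Q"
    \<comment> \<open>The inner permutation fixes the last two slots, so composing with it leaves
      the factor of the newly added form unchanged.\<close>
    have "\<rho> (2 * r) = 2 * r" "\<rho> (2 * r + 1) = 2 * r + 1" using \<rho> by (auto simp: permutes_def)
    moreover have "sign (\<sigma> \<circ> \<rho>) = sign \<sigma> * sign \<rho>"
      by (intro sign_compose perm \<sigma> Q \<rho>)
    ultimately show "of_int (sign \<sigma>) * (of_int (sign \<rho>) *
        (\<Prod>s<r. B s (v (\<sigma> (\<rho> (2 * s)))) (v (\<sigma> (\<rho> (2 * s + 1))))) / 2 ^ r) * ?b \<sigma> r
      = of_int (sign (\<sigma> \<circ> \<rho>)) * (\<Prod>s<Suc r. ?b (\<sigma> \<circ> \<rho>) s) / 2 ^ r"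
      by simp
  qed
  also have "(\<Sum>\<sigma>\<in>?P. \<Sum>\<rho>\<in>?Q. of_int (sign (\<sigma> \<circ> \<rho>)) * (\<Prod>s<Suc r. ?b (\<sigma> \<circ> \<rho>) s))
    = (\<Sum>\<rho>\<in>?Q. \<Sum>\<sigma>\<in>?P. of_int (sign \<sigma>) * (\<Prod>s<Suc r. ?b \<sigma> s))"
    by (subst sum.swap, rule sum.cong[OF refl], rule sum_permutations_compose_right[symmetric])
      (use Q in simp)
  also have "\<dots> = fact (2 * r) * (\<Sum>\<sigma>\<in>?P. of_int (sign \<sigma>) * (\<Prod>s<Suc r. ?b \<sigma> s))"
    by (simp add: card_permutations)
  finally show ?case by (simp add: mult_ac)
qed simp

text \<open>Swapping the two slots of one pair exchanges the two terms of the difference and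
  reverses the sign of the permutation, so both terms contribute equally. This gives one factor 2
  per pair.\<close>

lemma sum_sign_antisymmetrize:
  fixes u :: "nat \<Rightarrow> nat \<Rightarrow> nat \<Rightarrow> real"
  shows "(\<Sum>\<sigma> | \<sigma> permutes {..<2 * r}. of_int (sign \<sigma>) *
      (\<Prod>s<r. u s (\<sigma> (2 * s)) (\<sigma> (2 * s + 1)) - u s (\<sigma> (2 * s + 1)) (\<sigma> (2 * s))))
    = 2 ^ r * (\<Sum>\<sigma> | \<sigma> permutes {..<2 * r}. of_int (sign \<sigma>) *
      (\<Prod>s<r. u s (\<sigma> (2 * s)) (\<sigma> (2 * s + 1))))"
proof -
  let ?P = "{\<sigma>. \<sigma> permutes {..<2 * r}}"
  define d where "d = (\<lambda>\<sigma> s. u s (\<sigma> (2 * s)) (\<sigma> (2 * s + 1)))"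
  define d' where "d' = (\<lambda>\<sigma> s. u s (\<sigma> (2 * s + 1)) (\<sigma> (2 * s)))"
  \<comment> \<open>Interpolates between the two sides: the first \<open>k\<close> factors are
    antisymmetrized, the others are not. Each induction step converts one factor.\<close>
  define w where "w = (\<lambda>k \<sigma> s. if s < k then d \<sigma> s - d' \<sigma> s else d \<sigma> s)"
  have "(\<Sum>\<sigma>\<in>?P. of_int (sign \<sigma>) * (\<Prod>s<r. w k \<sigma> s))
      = 2 ^ k * (\<Sum>\<sigma>\<in>?P. of_int (sign \<sigma>) * (\<Prod>s<r. d \<sigma> s))" if "k \<le> r" for k
    using that
  proof (induction k)
    case (Suc k)
    then have k: "k < r" "k \<in> {..<r}" by auto
    define R where "R = (\<lambda>\<sigma>. \<Prod>s\<in>{..<r} - {k}. w k \<sigma> s)"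
    define t where "t = Transposition.transpose (2 * k) (2 * k + 1)"
    have t: "t permutes {..<2 * r}" using k unfolding t_def by (intro permutes_swap_id) auto
    have t_eq: "t (2 * k) = Suc (2 * k)" "t (Suc (2 * k)) = 2 * k"
      "\<And>i. i \<noteq> 2 * k \<Longrightarrow> i \<noteq> 2 * k + 1 \<Longrightarrow> t i = i"
      by (auto simp: t_def Transposition.transpose_def)
    have sign_t: "sign t = -1" by (simp add: t_def sign_swap_id)
    have R: "R (\<sigma> \<circ> t) = R \<sigma>" for \<sigma>
    proof -
      have "w k (\<sigma> \<circ> t) s = w k \<sigma> s" if "s \<noteq> k" for s
      proof -
        have "2 * s \<noteq> 2 * k" "2 * s \<noteq> 2 * k + 1" "2 * s + 1 \<noteq> 2 * k" "2 * s + 1 \<noteq> 2 * k + 1"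
          using that by auto
        then show ?thesis by (simp add: w_def d_def d'_def t_eq)
      qed
      then show ?thesis unfolding R_def by (intro prod.cong) auto
    qed
    have Suck: "(\<Prod>s<r. w (Suc k) \<sigma> s) = (d \<sigma> k - d' \<sigma> k) * R \<sigma>" for \<sigma>
    proof -
      have "(\<Prod>s\<in>{..<r} - {k}. w (Suc k) \<sigma> s) = R \<sigma>"
        unfolding R_def by (intro prod.cong) (auto simp: w_def)
      then show ?thesis by (simp add: prod.remove[OF _ k(2)] w_def)
    qed
    have at_k: "(\<Prod>s<r. w k \<sigma> s) = d \<sigma> k * R \<sigma>" for \<sigma>
      by (simp add: prod.remove[OF _ k(2)] w_def R_def)
    have "(\<Sum>\<sigma>\<in>?P. of_int (sign \<sigma>) * (d' \<sigma> k * R \<sigma>))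
      = (\<Sum>\<sigma>\<in>?P. of_int (sign (\<sigma> \<circ> t)) * (d' (\<sigma> \<circ> t) k * R (\<sigma> \<circ> t)))"
      by (rule sum_permutations_compose_right[OF t])
    also have "\<dots> = (\<Sum>\<sigma>\<in>?P. - (of_int (sign \<sigma>) * (d \<sigma> k * R \<sigma>)))"
    proof (rule sum.cong[OF refl])
      fix \<sigma> assume "\<sigma> \<in> ?P"
      then have "sign (\<sigma> \<circ> t) = - sign \<sigma>"
        using t by (subst sign_compose) (auto simp: permutation_permutes sign_t)
      then show "of_int (sign (\<sigma> \<circ> t)) * (d' (\<sigma> \<circ> t) k * R (\<sigma> \<circ> t))
        = - (of_int (sign \<sigma>) * (d \<sigma> k * R \<sigma>))"
        by (simp add: R) (simp add: d_def d'_def t_eq)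
    qed
    finally have "(\<Sum>\<sigma>\<in>?P. of_int (sign \<sigma>) * (\<Prod>s<r. w (Suc k) \<sigma> s))
      = 2 * (\<Sum>\<sigma>\<in>?P. of_int (sign \<sigma>) * (d \<sigma> k * R \<sigma>))"
      by (simp add: Suck left_diff_distrib right_diff_distrib sum_subtractf sum_negf)
    then show ?case using Suc by (simp add: at_k)
  qed (simp add: w_def)
  from this[of r] have "(\<Sum>\<sigma>\<in>?P. of_int (sign \<sigma>) * (\<Prod>s<r. w r \<sigma> s))
      = 2 ^ r * (\<Sum>\<sigma>\<in>?P. of_int (sign \<sigma>) * (\<Prod>s<r. d \<sigma> s))" by simp
  then show ?thesis by (simp add: w_def d_def d'_def)
qed

lemma wedge_dual_covectors:
  "wedge 1 1 (dual_covector e i) (dual_covector e j) v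
    = inner (e i) (v 0) * inner (e j) (v 1) - inner (e i) (v 1) * inner (e j) (v 0)"
proof -
  have P: "{\<sigma>. \<sigma> permutes {..<Suc 1}} = {id, Transposition.transpose 0 (1::nat)}"
  proof -
    have "{..<Suc 1} = {0, 1::nat}" by auto
    then show ?thesis by (auto simp: permutes_doubleton_iff)
  qed
  have "id \<noteq> Transposition.transpose 0 (1::nat)" by (metis id_apply transpose_apply_first zero_neq_one)
  then show ?thesis
    using P by (simp add: wedge_def dual_covector_def sign_swap_id)
qed

text \<open>The hypothesis is the Gauss equation for a second fundamental form with coefficients \<open>h\<close>.\<close>

lemma pfaffian_form_eq:
  fixes h :: "nat \<Rightarrow> nat \<Rightarrow> 'a::euclidean_space"
  assumes gauss: "\<And>i j a b. i < 2 * r \<Longrightarrow> j < 2 * r \<Longrightarrow> a < 2 * r \<Longrightarrow> b < 2 * r \<Longrightarrow>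
    riemann_tensor M conn p (e i) (e j) (e a) (e b)
      = inner (h j a) (h i b) - inner (h i a) (h j b)"
  shows "pfaffian_form r M conn p e v = det_of (2 * r) (\<lambda>i j. inner (e i) (v j)) *
    (\<Sum>\<tau> | \<tau> permutes {..<2 * r}. \<Sum>\<rho> | \<rho> permutes {..<2 * r}. of_int (sign \<tau>) * of_int (sign \<rho>) *
      (\<Prod>s<r. inner (h (\<rho> (2 * s)) (\<tau> (2 * s))) (h (\<rho> (2 * s + 1)) (\<tau> (2 * s + 1)))))
    / (4 ^ r * pi ^ r * fact r)"
proof -
  let ?P = "{\<tau>. \<tau> permutes {..<2 * r}}" and ?I = "{..<2 * r}"
  let ?A = "\<lambda>i j. inner (e i) (v j)"
  \<comment> \<open>For fixed \<open>a\<close>, \<open>b\<close> the Gauss equation reads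
    \<open>R i j = q i j - q j i\<close>. This choice pairs \<open>i\<close> with \<open>a\<close>
    and \<open>j\<close> with \<open>b\<close>, at the price of a minus sign per factor; these signs
    cancel the \<open>(-1) ^ r\<close> of the Pfaffian.\<close>
  define q where "q = (\<lambda>a b i j. - inner (h i a) (h j b))"
  have "wedge_2forms r (\<lambda>s. curvature_form (2 * r) M conn p e (\<tau> (2 * s)) (\<tau> (2 * s + 1))) v
      = det_of (2 * r) ?A * (\<Sum>\<sigma>\<in>?P. of_int (sign \<sigma>) *
          (\<Prod>s<r. q (\<tau> (2 * s)) (\<tau> (2 * s + 1)) (\<sigma> (2 * s)) (\<sigma> (2 * s + 1))))"
    if "\<tau> \<in> ?P" for \<tau>
  proof -
    let ?R = "\<lambda>s i j. riemann_tensor M conn p (e i) (e j) (e (\<tau> (2 * s))) (e (\<tau> (2 * s + 1)))"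
    let ?q = "\<lambda>s. q (\<tau> (2 * s)) (\<tau> (2 * s + 1))"
    let ?B = "\<lambda>s x y. 1 / 2 * (\<Sum>i\<in>?I. \<Sum>j\<in>?I. ?R s i j *
      (inner (e i) x * inner (e j) y - inner (e i) y * inner (e j) x))"
    have \<tau>: "\<tau> i < 2 * r" if "i < 2 * r" for i
      using permutes_in_image[of \<tau> ?I i] \<open>\<tau> \<in> ?P\<close> that by simp
    have R: "?R s i j = ?q s i j - ?q s j i" if "s < r" "i < 2 * r" "j < 2 * r" for s i j
      using gauss[OF that(2,3) \<tau> \<tau>, of "2 * s" "2 * s + 1"] that(1) by (simp add: q_def)
    \<comment> \<open>The coefficients are antisymmetric in \<open>i\<close> and \<open>j\<close>,
      so both halves of the wedge contribute the same; this uses up the factor 1/2 of the curvature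
      form.\<close>
    have B: "?B s x y = (\<Sum>i\<in>?I. \<Sum>j\<in>?I. (?q s i j - ?q s j i) * (inner (e i) x * inner (e j) y))"
      if "s < r" for s x y
    proof -
      have "2 * ?B s x y = (\<Sum>i\<in>?I. \<Sum>j\<in>?I. (?q s i j - ?q s j i) *
          (inner (e i) x * inner (e j) y - inner (e i) y * inner (e j) x))"
        using R[OF that] by simp
      also have "\<dots> = (\<Sum>i\<in>?I. \<Sum>j\<in>?I. (?q s i j - ?q s j i) * (inner (e i) x * inner (e j) y))
          - (\<Sum>i\<in>?I. \<Sum>j\<in>?I. (?q s i j - ?q s j i) * (inner (e i) y * inner (e j) x))"
        by (simp add: right_diff_distrib sum_subtractf)
      also have "(\<Sum>i\<in>?I. \<Sum>j\<in>?I. (?q s i j - ?q s j i) * (inner (e i) y * inner (e j) x))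
          = - (\<Sum>i\<in>?I. \<Sum>j\<in>?I. (?q s i j - ?q s j i) * (inner (e i) x * inner (e j) y))"
        unfolding sum_negf[symmetric] by (subst sum.swap) (intro sum.cong refl, simp add: algebra_simps)
      finally show ?thesis by simp
    qed
    have "wedge_2forms r (\<lambda>s. curvature_form (2 * r) M conn p e (\<tau> (2 * s)) (\<tau> (2 * s + 1))) v
      = (\<Sum>\<rho>\<in>?P. of_int (sign \<rho>) * (\<Prod>s<r. ?B s (v (\<rho> (2 * s))) (v (\<rho> (2 * s + 1))))) / 2 ^ r"
      by (rule wedge_2forms_eq) (simp only: curvature_form_def wedge_dual_covectors)
    also have "(\<Sum>\<rho>\<in>?P. of_int (sign \<rho>) * (\<Prod>s<r. ?B s (v (\<rho> (2 * s))) (v (\<rho> (2 * s + 1)))))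
      = (\<Sum>\<rho>\<in>?P. of_int (sign \<rho>) * (\<Sum>f\<in>?I \<rightarrow>\<^sub>E ?I.
          (\<Prod>s<r. ?q s (f (2 * s)) (f (2 * s + 1)) - ?q s (f (2 * s + 1)) (f (2 * s))) *
          (\<Prod>i<2 * r. ?A (f i) (\<rho> i))))"
    proof (rule sum.cong[OF refl])
      fix \<rho>
      have "(\<Prod>s<r. ?B s (v (\<rho> (2 * s))) (v (\<rho> (2 * s + 1))))
        = (\<Prod>s<r. \<Sum>i\<in>?I. \<Sum>j\<in>?I. (?q s i j - ?q s j i) * (?A i (\<rho> (2 * s)) * ?A j (\<rho> (2 * s + 1))))"
        by (rule prod.cong[OF refl]) (rule B, simp)
      also have "\<dots> = (\<Sum>f\<in>?I \<rightarrow>\<^sub>E ?I. \<Prod>s<r. (?q s (f (2 * s)) (f (2 * s + 1)) - ?q s (f (2 * s + 1)) (f (2 * s))) *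
          (?A (f (2 * s)) (\<rho> (2 * s)) * ?A (f (2 * s + 1)) (\<rho> (2 * s + 1))))"
        by (rule prod_sum_pairs) simp
      also have "\<dots> = (\<Sum>f\<in>?I \<rightarrow>\<^sub>E ?I.
          (\<Prod>s<r. ?q s (f (2 * s)) (f (2 * s + 1)) - ?q s (f (2 * s + 1)) (f (2 * s))) *
          (\<Prod>i<2 * r. ?A (f i) (\<rho> i)))"
      proof (rule sum.cong[OF refl])
        fix f :: "nat \<Rightarrow> nat"
        have "(\<Prod>i<2 * r. g i) = (\<Prod>s<r. g (2 * s) * g (2 * s + 1))" for g :: "nat \<Rightarrow> real"
          by (induction r) (simp_all add: mult.assoc)
        then show "(\<Prod>s<r. (?q s (f (2 * s)) (f (2 * s + 1)) - ?q s (f (2 * s + 1)) (f (2 * s))) *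
          (?A (f (2 * s)) (\<rho> (2 * s)) * ?A (f (2 * s + 1)) (\<rho> (2 * s + 1))))
          = (\<Prod>s<r. ?q s (f (2 * s)) (f (2 * s + 1)) - ?q s (f (2 * s + 1)) (f (2 * s))) *
          (\<Prod>i<2 * r. ?A (f i) (\<rho> i))"
          by (simp add: prod.distrib)
      qed
      finally show "of_int (sign \<rho>) * (\<Prod>s<r. ?B s (v (\<rho> (2 * s))) (v (\<rho> (2 * s + 1))))
        = of_int (sign \<rho>) * (\<Sum>f\<in>?I \<rightarrow>\<^sub>E ?I.
          (\<Prod>s<r. ?q s (f (2 * s)) (f (2 * s + 1)) - ?q s (f (2 * s + 1)) (f (2 * s))) *
          (\<Prod>i<2 * r. ?A (f i) (\<rho> i)))" by simp
    qed
    also have "\<dots> = det_of (2 * r) ?A * (\<Sum>\<sigma>\<in>?P. of_int (sign \<sigma>) *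
          (\<Prod>s<r. ?q s (\<sigma> (2 * s)) (\<sigma> (2 * s + 1)) - ?q s (\<sigma> (2 * s + 1)) (\<sigma> (2 * s))))"
      by (rule alternating_expansion) simp
    \<comment> \<open>This \<open>2 ^ r\<close> cancels the division by \<open>2 ^ r\<close> left
      over from \<open>wedge_2forms_eq\<close>.\<close>
    also have "\<dots> = det_of (2 * r) ?A * (2 ^ r * (\<Sum>\<sigma>\<in>?P. of_int (sign \<sigma>) *
          (\<Prod>s<r. ?q s (\<sigma> (2 * s)) (\<sigma> (2 * s + 1)))))"
      by (subst sum_sign_antisymmetrize) simp
    finally show ?thesis by simp
  qed
  then have "pfaffian_form r M conn p e v = (-1) ^ r / (2 ^ (2 * r) * pi ^ r * fact r) *
    (\<Sum>\<tau>\<in>?P. of_int (sign \<tau>) * (det_of (2 * r) ?A * (\<Sum>\<sigma>\<in>?P. of_int (sign \<sigma>) *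
          (\<Prod>s<r. q (\<tau> (2 * s)) (\<tau> (2 * s + 1)) (\<sigma> (2 * s)) (\<sigma> (2 * s + 1))))))"
    by (simp add: pfaffian_form_def)
  also have "(\<Sum>\<tau>\<in>?P. of_int (sign \<tau>) * (det_of (2 * r) ?A * (\<Sum>\<sigma>\<in>?P. of_int (sign \<sigma>) *
          (\<Prod>s<r. q (\<tau> (2 * s)) (\<tau> (2 * s + 1)) (\<sigma> (2 * s)) (\<sigma> (2 * s + 1))))))
    = (-1) ^ r * det_of (2 * r) ?A * (\<Sum>\<tau>\<in>?P. \<Sum>\<rho>\<in>?P. of_int (sign \<tau>) * of_int (sign \<rho>) *
      (\<Prod>s<r. inner (h (\<rho> (2 * s)) (\<tau> (2 * s))) (h (\<rho> (2 * s + 1)) (\<tau> (2 * s + 1)))))"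
    (is "_ = _ * ?S")
  proof -
    have "(\<Prod>s<r. - g s) = (-1) ^ r * (\<Prod>s<r. g s)" for g :: "nat \<Rightarrow> real"
      by (induction r) simp_all
    then show ?thesis by (simp add: q_def sum_distrib_left mult_ac)
  qed
  finally have "pfaffian_form r M conn p e v = (-1) ^ r / (2 ^ (2 * r) * pi ^ r * fact r) *
    ((-1) ^ r * det_of (2 * r) ?A * ?S)" .
  moreover have "(-1) ^ r / (2 ^ (2 * r) * pi ^ r * fact r) * ((-1) ^ r * d * S)
      = d * S / (4 ^ r * pi ^ r * fact r)" for d S :: real
  proof -
    have "(-1) ^ r * (-1) ^ r = (1::real)" by (simp flip: power_mult_distrib)
    then have "(-1) ^ r / c * ((-1) ^ r * d * S) = d * S / c" for c :: real
      by (metis mult.assoc mult_1 times_divide_eq_left)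
    then show ?thesis by (simp add: power_mult[of 2 2 r, simplified])
  qed
  ultimately show ?thesis by simp
qed

section \<open>Gram determinants and change of orthonormal basis\<close>

text \<open>The matrices on the two sides may differ, so that two orthonormal bases can be compared
  through a common reference basis.\<close>

lemma det_of_congruence:
  "det_of m (\<lambda>i j. \<Sum>k<m. \<Sum>l<m. A k i * (B k l * A' l j)) = det_of m A * (det_of m B * det_of m A')"
proof -
  have "det_of m (\<lambda>i j. \<Sum>k<m. \<Sum>l<m. A k i * (B k l * A' l j))
      = det_of m (\<lambda>i j. \<Sum>k<m. A k i * (\<Sum>l<m. B k l * A' l j))"
    by (simp only: sum_distrib_left)
  also have "\<dots> = det_of m (\<lambda>i j. A j i) * det_of m (\<lambda>k j. \<Sum>l<m. B k l * A' l j)"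
    by (rule det_of_mult)
  finally show ?thesis by (simp only: det_of_transpose[of m A] det_of_mult[of m B A'])
qed

lemma inner_sum_scaleR:
  "inner (\<Sum>k\<in>K. f k *\<^sub>R b k) (\<Sum>l\<in>L. g l *\<^sub>R b' l) = (\<Sum>k\<in>K. \<Sum>l\<in>L. f k * (inner (b k) (b' l) * g l))"
  unfolding inner_sum_left unfolding inner_sum_right by (simp add: mult_ac)

text \<open>Orthonormality of \<open>e\<close> says that the Gram matrix of \<open>b\<close>,
  transformed by \<open>A\<close>, is the identity. The consequence of interest is that the Gram
  determinant of \<open>b\<close> is nonzero and positive.\<close>

lemma det_of_gram:
  assumes "\<And>i j. i < m \<Longrightarrow> j < m \<Longrightarrow> inner (e i) (e j) = (if i = j then 1 else 0)"
    and "\<And>j. j < m \<Longrightarrow> e j = (\<Sum>i<m. A i j *\<^sub>R b i)"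
  shows "det_of m A * det_of m A * det_of m (\<lambda>i j. inner (b i) (b j)) = 1"
proof -
  have "1 = det_of m (\<lambda>i j. inner (e i) (e j))"
    using det_of_id[of m] assms(1) by (simp cong: det_of_cong)
  also have "\<dots> = det_of m (\<lambda>i j. \<Sum>k<m. \<Sum>l<m. A k i * (inner (b k) (b l) * A l j))"
    by (intro det_of_cong) (simp add: assms(2) inner_sum_scaleR)
  also have "\<dots> = det_of m A * (det_of m (\<lambda>i j. inner (b i) (b j)) * det_of m A)"
    by (rule det_of_congruence)
  finally show ?thesis by (simp add: mult_ac)
qed

lemma orthonormal_basis_expansion:
  assumes "orthonormal_basis_of m S e" "x \<in> S"
  shows "x = (\<Sum>i<m. inner (e i) x *\<^sub>R e i)"
proof -
  have "x \<in> span (e ` {..<m})" and inj: "inj_on e {..<m}"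
    using assms by (auto simp: orthonormal_basis_of_def basis_of_def)
  then obtain u where u: "x = (\<Sum>y\<in>e ` {..<m}. u y *\<^sub>R y)"
    using span_finite[of "e ` {..<m}"] by auto
  then have x: "x = (\<Sum>j<m. u (e j) *\<^sub>R e j)" by (simp add: sum.reindex[OF inj])
  have "inner (e i) x = u (e i)" if i: "i < m" for i
  proof -
    have "inner (e i) x = (\<Sum>j<m. if j = i then u (e j) else 0)"
      unfolding x inner_sum_right using assms(1) i
      by (intro sum.cong) (auto simp: orthonormal_basis_of_def)
    then show ?thesis using i by simp
  qed
  then show ?thesis using x by simp
qed

text \<open>The determinant is 1 or -1 by orthogonality. Its sign comes from the orientation: both
  bases arise from one reference basis by matrices of positive determinant, and the Gram determinant
  of that basis is positive.\<close>

lemma det_of_positive_orthonormal_bases: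
  assumes "orientation m M \<O>" "p \<in> M" "positive_onb m M \<O> p e" "positive_onb m M \<O> p e'"
  shows "det_of m (\<lambda>i j. inner (e i) (e' j)) = 1"
proof -
  obtain b where "\<O> p = {c. same_orientation m b c}"
    using assms(1,2) by (auto simp: orientation_def)
  then obtain A A' where A: "0 < det_of m A" "\<And>j. j < m \<Longrightarrow> e j = (\<Sum>i<m. A i j *\<^sub>R b i)"
    and A': "0 < det_of m A'" "\<And>j. j < m \<Longrightarrow> e' j = (\<Sum>i<m. A' i j *\<^sub>R b i)"
    using assms(3,4) unfolding positive_onb_def same_orientation_def by blast
  have on: "inner (e i) (e j) = (if i = j then 1 else 0)" "inner (e' i) (e' j) = (if i = j then 1 else 0)"
    if "i < m" "j < m" for i j
    using assms(3,4) that by (auto simp: positive_onb_def orthonormal_basis_of_def)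
  let ?Q = "\<lambda>i j. inner (e i) (e' j)"
  let ?g = "det_of m (\<lambda>i j. inner (b i) (b j))"
  have "det_of m ?Q = det_of m (\<lambda>i j. \<Sum>k<m. \<Sum>l<m. A k i * (inner (b k) (b l) * A' l j))"
    by (intro det_of_cong) (simp add: A A' inner_sum_scaleR)
  also have "\<dots> = det_of m A * (?g * det_of m A')"
    by (rule det_of_congruence)
  finally have Q: "det_of m ?Q = det_of m A * (?g * det_of m A')" .
  have "det_of m A * det_of m A * ?g = 1"
    by (rule det_of_gram[OF on(1) A(2)])
  then have "0 < (det_of m A * det_of m A) * ?g" by simp
  then have "0 < ?g" by (rule zero_less_mult_pos) (use A(1) in simp)
  then have pos: "0 < det_of m ?Q" using A A' Q by simp
  \<comment> \<open>Since \<open>e\<close> spans the tangent space, the transition matrix times its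
    transpose is the Gram matrix of \<open>e'\<close>, which is the identity.\<close>
  have "det_of m (\<lambda>i j. inner (e' i) (e' j)) = det_of m (\<lambda>i j. \<Sum>k<m. ?Q k i * ?Q k j)"
  proof (rule det_of_cong)
    fix i j assume "i < m" "j < m"
    then have "e' j \<in> tangent_space M p"
      using assms(4) by (auto simp: positive_onb_def orthonormal_basis_of_def basis_of_def intro: span_base)
    then have "e' j = (\<Sum>k<m. ?Q k j *\<^sub>R e k)"
      using assms(3) by (intro orthonormal_basis_expansion) (auto simp: positive_onb_def)
    then have "inner (e' i) (e' j) = inner (e' i) (\<Sum>k<m. ?Q k j *\<^sub>R e k)" by simp
    then show "inner (e' i) (e' j) = (\<Sum>k<m. ?Q k i * ?Q k j)"
      by (simp add: inner_sum_right inner_commute mult.commute)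
  qed
  also have "\<dots> = det_of m ?Q * det_of m ?Q"
    using det_of_transpose[of m ?Q] by (simp add: det_of_mult)
  also have "det_of m (\<lambda>i j. inner (e' i) (e' j)) = 1"
    using det_of_id[of m] on(2) by (simp cong: det_of_cong)
  finally have "(det_of m ?Q - 1) * (det_of m ?Q + 1) = 0" by (simp add: algebra_simps)
  then show ?thesis using pos by simp
qed

text \<open>The basis chosen by \<open>SOME\<close> in \<open>volume_form\<close> may be replaced by
  \<open>e\<close>, because the transition matrix has determinant 1.\<close>

lemma volume_form_eq:
  assumes "orientation m M \<O>" "p \<in> M" "positive_onb m M \<O> p e"
    and "\<And>i. i < m \<Longrightarrow> v i \<in> tangent_space M p"
  shows "volume_form m M \<O> p v = det_of m (\<lambda>i j. inner (e i) (v j))"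
proof -
  define e' where "e' = (SOME e. positive_onb m M \<O> p e)"
  have e': "positive_onb m M \<O> p e'" unfolding e'_def by (rule someI[of _ e]) (rule assms)
  have "det_of m (\<lambda>i j. inner (e' i) (v j))
      = det_of m (\<lambda>i j. \<Sum>k<m. inner (e' i) (e k) * inner (e k) (v j))"
  proof (rule det_of_cong)
    fix i j assume "i < m" "j < m"
    then have "v j = (\<Sum>k<m. inner (e k) (v j) *\<^sub>R e k)"
      using assms(3,4) by (intro orthonormal_basis_expansion) (auto simp: positive_onb_def)
    then have "inner (e' i) (v j) = inner (e' i) (\<Sum>k<m. inner (e k) (v j) *\<^sub>R e k)" by simp
    then show "inner (e' i) (v j) = (\<Sum>k<m. inner (e' i) (e k) * inner (e k) (v j))"
      by (simp add: inner_sum_right mult.commute)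
  qed
  also have "\<dots> = det_of m (\<lambda>i j. inner (e' i) (e j)) * det_of m (\<lambda>i j. inner (e i) (v j))"
    by (rule det_of_mult)
  finally show ?thesis
    using det_of_positive_orthonormal_bases[OF assms(1,2) e' assms(3)]
    by (simp add: volume_form_def e'_def[symmetric] Let_def)
qed

section \<open>Polarization\<close>

text \<open>Inclusion-exclusion over the set \<open>X\<close> of values to be missed retains only
  the surjective functions, which are permutations. With \<open>\<Phi>\<close> arbitrary, the same
  coefficients polarize both sides of the moment formula.\<close>

lemma sum_functions_inclusion_exclusion:
  fixes \<Phi> :: "('b \<Rightarrow> 'b) \<Rightarrow> 'c::comm_ring_1"
  assumes S: "finite S"
  shows "(\<Sum>X\<in>Pow S. (-1) ^ card X * (\<Sum>f\<in>S \<rightarrow>\<^sub>E (S - X). \<Phi> f)) = (\<Sum>\<tau> | \<tau> permutes S. \<Phi> (restrict \<tau> S))"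
proof -
  have avoid: "(\<Sum>X\<in>Pow S. (-1) ^ card X * (if X \<inter> f ` S = {} then 1 else 0)) = (if S \<subseteq> f ` S then 1 else 0 :: 'c)" for f
  proof -
    \<comment> \<open>Indicator of the values that \<open>f\<close> misses. Expanding the product of
      all \<open>1 - ?h x\<close> gives the alternating sum over \<open>X\<close>.\<close>
    let ?h = "\<lambda>x. if x \<in> f ` S then 0 else 1 :: 'c"
    have "(\<Prod>x\<in>S. 1 - ?h x) = (\<Sum>X\<in>Pow S. (-1) ^ card X * (\<Prod>x\<in>X. ?h x) * (\<Prod>x\<in>S - X. 1))"
      by (rule prod_diff_conv_sum[OF S])
    also have "\<dots> = (\<Sum>X\<in>Pow S. (-1) ^ card X * (if X \<inter> f ` S = {} then 1 else 0))"
    proof (intro sum.cong refl)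
      fix X assume "X \<in> Pow S"
      then have "finite X" using S finite_subset by auto
      then have "(\<Prod>x\<in>X. ?h x) = (if X \<inter> f ` S = {} then 1 else 0)"
      proof (cases "X \<inter> f ` S = {}")
        case True
        then have "(\<Prod>x\<in>X. ?h x) = 1" by (intro prod.neutral) auto
        then show ?thesis using True by simp
      next
        case False
        then have "\<exists>x\<in>X. ?h x = 0" by auto
        then have "(\<Prod>x\<in>X. ?h x) = 0" by (rule prod_zero[OF \<open>finite X\<close>])
        then show ?thesis using False by simp
      qed
      then show "(-1) ^ card X * (\<Prod>x\<in>X. ?h x) * (\<Prod>x\<in>S - X. 1) = (-1) ^ card X * (if X \<inter> f ` S = {} then 1 else 0)"
        by simp
    qed
    moreover have "(\<Prod>x\<in>S. 1 - ?h x) = (if S \<subseteq> f ` S then 1 else 0)"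
      using S by (auto intro!: prod.neutral prod_zero)
    ultimately show ?thesis by simp
  qed
  have "(\<Sum>X\<in>Pow S. (-1) ^ card X * (\<Sum>f\<in>S \<rightarrow>\<^sub>E (S - X). \<Phi> f))
      = (\<Sum>X\<in>Pow S. \<Sum>f\<in>S \<rightarrow>\<^sub>E S. \<Phi> f * ((-1) ^ card X * (if X \<inter> f ` S = {} then 1 else 0)))"
  proof (rule sum.cong[OF refl])
    fix X assume "X \<in> Pow S"
    have "(\<Sum>f\<in>S \<rightarrow>\<^sub>E S. if X \<inter> f ` S = {} then \<Phi> f else 0) = (\<Sum>f | f \<in> S \<rightarrow>\<^sub>E S \<and> X \<inter> f ` S = {}. \<Phi> f)"
      using S by (subst sum.If_cases) (auto intro: finite_PiE simp: Int_def)
    also have "{f. f \<in> S \<rightarrow>\<^sub>E S \<and> X \<inter> f ` S = {}} = S \<rightarrow>\<^sub>E (S - X)"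
      by (auto simp: PiE_iff extensional_def)
    finally have "(\<Sum>f\<in>S \<rightarrow>\<^sub>E (S - X). \<Phi> f) = (\<Sum>f\<in>S \<rightarrow>\<^sub>E S. if X \<inter> f ` S = {} then \<Phi> f else 0)" by simp
    then show "(-1) ^ card X * (\<Sum>f\<in>S \<rightarrow>\<^sub>E (S - X). \<Phi> f)
        = (\<Sum>f\<in>S \<rightarrow>\<^sub>E S. \<Phi> f * ((-1) ^ card X * (if X \<inter> f ` S = {} then 1 else 0)))"
      by (simp add: sum_distrib_left if_distrib mult.commute cong: if_cong)
  qed
  also have "\<dots> = (\<Sum>f\<in>S \<rightarrow>\<^sub>E S. \<Phi> f * (if S \<subseteq> f ` S then 1 else 0))"
    by (subst sum.swap) (simp only: sum_distrib_left[symmetric] avoid)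
  also have "\<dots> = (\<Sum>f\<in>S \<rightarrow>\<^sub>E S. if bij_betw f S S then \<Phi> f else 0)"
  proof (rule sum.cong[OF refl])
    fix f assume "f \<in> S \<rightarrow>\<^sub>E S"
    then have "S \<subseteq> f ` S \<longleftrightarrow> bij_betw f S S"
      using S endo_inj_surj[of S f] finite_surj_inj[of S f] by (auto simp: bij_betw_def PiE_iff)
    then show "\<Phi> f * (if S \<subseteq> f ` S then 1 else 0) = (if bij_betw f S S then \<Phi> f else 0)" by simp
  qed
  also have "\<dots> = (\<Sum>f | f \<in> S \<rightarrow>\<^sub>E S \<and> bij_betw f S S. \<Phi> f)"
    using S by (subst sum.If_cases) (auto intro: finite_PiE simp: Int_def)
  also have "\<dots> = (\<Sum>\<tau> | \<tau> permutes S. \<Phi> (restrict \<tau> S))"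
    by (rule sum_bij_PiE_permutes[OF S])
  finally show ?thesis .
qed

text \<open>A power of a sum expands over all index functions; inclusion-exclusion leaves the
  permutations, each giving the same product, whence \<open>fact m\<close>.\<close>

lemma prod_polarization:
  fixes x :: "nat \<Rightarrow> real"
  shows "fact m * (\<Prod>i<m. x i) = (\<Sum>X\<in>Pow {..<m}. (-1) ^ card X * (\<Sum>j\<in>{..<m} - X. x j) ^ m)"
proof -
  have "(\<Sum>X\<in>Pow {..<m}. (-1) ^ card X * (\<Sum>j\<in>{..<m} - X. x j) ^ m)
      = (\<Sum>X\<in>Pow {..<m}. (-1) ^ card X * (\<Sum>f\<in>{..<m} \<rightarrow>\<^sub>E ({..<m} - X). \<Prod>i<m. x (f i)))"
    using prod_sum_PiE[of "{..<m}" "\<lambda>_. {..<m} - X" "\<lambda>_. x" for X] by simp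
  also have "\<dots> = (\<Sum>\<tau> | \<tau> permutes {..<m}. \<Prod>i<m. x (restrict \<tau> {..<m} i))"
    by (rule sum_functions_inclusion_exclusion) simp
  also have "\<dots> = (\<Sum>\<tau> | \<tau> permutes {..<m}. \<Prod>i<m. x i)"
    by (intro sum.cong refl) (simp add: prod.permute[of _ _ x] comp_def)
  finally show ?thesis by (simp add: card_permutations)
qed

text \<open>The coefficients are those of \<open>prod_polarization\<close>. Hence a formula
  expressing integrals of powers of a linear form through powers of its squared norm extends term by
  term to products of different linear forms.\<close>

lemma inner_pairs_polarization:
  fixes A :: "nat \<Rightarrow> 'a::real_inner"
  shows "(\<Sum>\<tau> | \<tau> permutes {..<2 * r}. \<Prod>s<r. inner (A (\<tau> (2 * s))) (A (\<tau> (2 * s + 1))))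
    = (\<Sum>X\<in>Pow {..<2 * r}. (-1) ^ card X * (inner (\<Sum>j\<in>{..<2 * r} - X. A j) (\<Sum>j\<in>{..<2 * r} - X. A j)) ^ r)"
proof -
  have "(inner (\<Sum>j\<in>T. A j) (\<Sum>j\<in>T. A j)) ^ r
      = (\<Sum>f\<in>{..<2 * r} \<rightarrow>\<^sub>E T. \<Prod>s<r. inner (A (f (2 * s))) (A (f (2 * s + 1))))" if "finite T" for T
    using prod_sum_pairs[OF that, of "\<lambda>_ i j. inner (A i) (A j)" r] 
    unfolding inner_sum_left unfolding inner_sum_right by simp
  then have "(\<Sum>X\<in>Pow {..<2 * r}. (-1) ^ card X * (inner (\<Sum>j\<in>{..<2 * r} - X. A j) (\<Sum>j\<in>{..<2 * r} - X. A j)) ^ r)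
    = (\<Sum>X\<in>Pow {..<2 * r}. (-1) ^ card X * (\<Sum>f\<in>{..<2 * r} \<rightarrow>\<^sub>E ({..<2 * r} - X).
        \<Prod>s<r. inner (A (f (2 * s))) (A (f (2 * s + 1)))))" by simp
  also have "\<dots> = (\<Sum>\<tau> | \<tau> permutes {..<2 * r}.
      \<Prod>s<r. inner (A (restrict \<tau> {..<2 * r} (2 * s))) (A (restrict \<tau> {..<2 * r} (2 * s + 1))))"
    by (rule sum_functions_inclusion_exclusion) simp
  finally show ?thesis by simp
qed

section \<open>Integrals over spheres\<close>

text \<open>The two measures agree on boxes, where each coordinate contributes one factor
  \<open>t\<close>. The restriction to \<open>{..<n}\<close> keeps the scaled point extensional,
  that is, in the product space.\<close>

lemma nn_integral_PiM_lborel_scale: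
  assumes t: "0 < t" and F: "F \<in> borel_measurable (Pi\<^sub>M {..<n} (\<lambda>_. lborel :: real measure))"
  shows "(\<integral>\<^sup>+c. F c \<partial>Pi\<^sub>M {..<n} (\<lambda>_. lborel))
    = ennreal (t ^ n) * (\<integral>\<^sup>+c. F (\<lambda>i\<in>{..<n}. t * c i) \<partial>Pi\<^sub>M {..<n} (\<lambda>_. lborel))"
proof -
  interpret product_sigma_finite "\<lambda>_::nat. lborel :: real measure" by standard
  let ?P = "Pi\<^sub>M {..<n} (\<lambda>_. lborel :: real measure)"
  let ?S = "\<lambda>c. \<lambda>i\<in>{..<n}. t * c i"
  have S[measurable]: "?S \<in> ?P \<rightarrow>\<^sub>M ?P"
    by (rule measurable_restrict) measurable
  have "density (distr ?P ?P ?S) (\<lambda>_. ennreal (t ^ n)) = ?P"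
  proof (rule PiM_eqI)
    fix A assume "\<And>i. i \<in> {..<n} \<Longrightarrow> A i \<in> sets (lborel :: real measure)"
    then have A[measurable]: "A i \<in> sets borel" if "i < n" for i using that by simp
    have PA: "Pi\<^sub>E {..<n} A \<in> sets ?P" by (rule sets_PiM_I_finite) (auto simp: A)
    have V: "(*) t -` A i \<in> sets borel" if "i < n" for i
      using measurable_sets[of "(*) t" borel borel "A i"] A[OF that] by simp
    have "?S -` Pi\<^sub>E {..<n} A \<inter> space ?P = Pi\<^sub>E {..<n} (\<lambda>i. (*) t -` A i)"
      by (auto simp: space_PiM PiE_iff)
    then have "emeasure (density (distr ?P ?P ?S) (\<lambda>_. ennreal (t ^ n))) (Pi\<^sub>E {..<n} A)
        = ennreal (t ^ n) * (\<Prod>i<n. emeasure lborel ((*) t -` A i))"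
      using PA V emeasure_PiM[of "{..<n}" "\<lambda>i. (*) t -` A i"]
      by (simp add: emeasure_density_const emeasure_distr)
    also have "\<dots> = (\<Prod>i<n. ennreal t * emeasure lborel ((*) t -` A i))"
      using t by (simp add: prod.distrib ennreal_power)
    also have "\<dots> = (\<Prod>i<n. emeasure lborel (A i))"
    proof (rule prod.cong[OF refl])
      fix i assume "i \<in> {..<n}"
      then have "emeasure lborel (A i) = emeasure (density (distr lborel borel ((*) t)) (\<lambda>_. ennreal \<bar>t\<bar>)) (A i)"
        using lborel_distr_mult'[of t] t by simp
      also have "\<dots> = ennreal t * emeasure lborel ((*) t -` A i)"
        using t \<open>i \<in> {..<n}\<close> A by (simp add: emeasure_density_const emeasure_distr)
      finally show "ennreal t * emeasure lborel ((*) t -` A i) = emeasure lborel (A i)" by simp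
    qed
    finally show "emeasure (density (distr ?P ?P ?S) (\<lambda>_. ennreal (t ^ n))) (Pi\<^sub>E {..<n} A)
      = (\<Prod>i\<in>{..<n}. emeasure lborel (A i))" .
  qed simp_all
  then have "(\<integral>\<^sup>+c. F c \<partial>?P) = (\<integral>\<^sup>+c. F c \<partial>density (distr ?P ?P ?S) (\<lambda>_. ennreal (t ^ n)))" by simp
  also have "\<dots> = ennreal (t ^ n) * (\<integral>\<^sup>+c. F (?S c) \<partial>?P)"
    using F by (simp add: nn_integral_density nn_integral_cmult nn_integral_distr)
  finally show ?thesis .
qed

lemma nn_integral_ball_homogeneous:
  fixes H :: "(nat \<Rightarrow> real) \<Rightarrow> ennreal"
  assumes t: "0 < t" and H[measurable]: "H \<in> borel_measurable (Pi\<^sub>M {..<n} (\<lambda>_. lborel))"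
    and hom: "\<And>c. H (\<lambda>i\<in>{..<n}. t * c i) = ennreal (t ^ d) * H c"
  shows "(\<integral>\<^sup>+c. H c * indicator {..t} (L2_set c {..<n}) \<partial>Pi\<^sub>M {..<n} (\<lambda>_. lborel))
    = ennreal (t ^ (n + d)) * (\<integral>\<^sup>+c. H c * indicator {..1} (L2_set c {..<n}) \<partial>Pi\<^sub>M {..<n} (\<lambda>_. lborel))"
proof -
  let ?P = "Pi\<^sub>M {..<n} (\<lambda>_. lborel :: real measure)"
  have L[measurable]: "(\<lambda>c. L2_set c {..<n}) \<in> borel_measurable ?P"
    unfolding L2_set_def by measurable
  have "L2_set (\<lambda>i\<in>{..<n}. t * c i) {..<n} = t * L2_set c {..<n}" for c
  proof -
    have "L2_set (\<lambda>i\<in>{..<n}. t * c i) {..<n} = L2_set (\<lambda>i. t * c i) {..<n}"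
      by (rule L2_set_cong) simp_all
    then show ?thesis using t by (simp add: L2_set_right_distrib)
  qed
  then have ind: "indicator {..t} (L2_set (\<lambda>i\<in>{..<n}. t * c i) {..<n}) = (indicator {..1} (L2_set c {..<n}) :: ennreal)" for c
    using t by (simp add: indicator_def)
  have "(\<integral>\<^sup>+c. H c * indicator {..t} (L2_set c {..<n}) \<partial>?P)
    = ennreal (t ^ n) * (\<integral>\<^sup>+c. H (\<lambda>i\<in>{..<n}. t * c i) * indicator {..t} (L2_set (\<lambda>i\<in>{..<n}. t * c i) {..<n}) \<partial>?P)"
    by (rule nn_integral_PiM_lborel_scale[OF t]) measurable
  also have "\<dots> = ennreal (t ^ n) * (\<integral>\<^sup>+c. ennreal (t ^ d) * (H c * indicator {..1} (L2_set c {..<n})) \<partial>?P)"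
    unfolding ind hom by (simp add: mult.assoc)
  also have "\<dots> = ennreal (t ^ n) * (ennreal (t ^ d) * (\<integral>\<^sup>+c. H c * indicator {..1} (L2_set c {..<n}) \<partial>?P))"
    by (subst nn_integral_cmult) simp_all
  also have "\<dots> = ennreal (t ^ (n + d)) * (\<integral>\<^sup>+c. H c * indicator {..1} (L2_set c {..<n}) \<partial>?P)"
    using t by (simp add: power_add ennreal_mult' mult.assoc[symmetric])
  finally show ?thesis .
qed

text \<open>Euler's integral for Gamma. In the layer-cake formula below, the level \<open>s\<close>
  has weight \<open>exp (- s)\<close> and corresponds to a ball of radius
  \<open>sqrt (2 * s)\<close>.\<close>

lemma nn_integral_exp_sqrt_power:
  "(\<integral>\<^sup>+s. ennreal (exp (- s) * sqrt (2 * s) ^ k) * indicator {0<..} s \<partial>lborel)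
    = ennreal (2 powr (real k / 2) * Gamma (real k / 2 + 1))"
proof -
  have "((\<lambda>t. t powr (real k / 2 + 1 - 1) / exp t) has_integral Gamma (real k / 2 + 1)) {0..}"
    by (rule Gamma_integral_real) simp
  then have "((\<lambda>t. 2 powr (real k / 2) * (t powr (real k / 2) / exp t)) has_integral 2 powr (real k / 2) * Gamma (real k / 2 + 1)) {0..}"
    by (intro has_integral_mult_right) simp
  then have "(\<integral>\<^sup>+s. ennreal (indicator {0..} s * (2 powr (real k / 2) * (s powr (real k / 2) / exp s))) \<partial>lborel)
      = ennreal (2 powr (real k / 2) * Gamma (real k / 2 + 1))"
    by (intro nn_integral_has_integral_lebesgue) simp_all
  moreover have "(\<integral>\<^sup>+s. ennreal (exp (- s) * sqrt (2 * s) ^ k) * indicator {0<..} s \<partial>lborel)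
    = (\<integral>\<^sup>+s. ennreal (indicator {0..} s * (2 powr (real k / 2) * (s powr (real k / 2) / exp s))) \<partial>lborel)"
  \<comment> \<open>The indicators of \<open>{0<..}\<close> and \<open>{0..}\<close> differ at
    \<open>s = 0\<close>, a null set.\<close>
  proof (rule nn_integral_cong_AE, rule AE_I[where N="{0}"])
    show "{s \<in> space lborel. \<not> ennreal (exp (- s) * sqrt (2 * s) ^ k) * indicator {0<..} s =
        ennreal (indicator {0..} s * (2 powr (real k / 2) * (s powr (real k / 2) / exp s)))} \<subseteq> {0}"
    proof clarsimp
      fix s :: real
      assume ne: "ennreal (exp (- s) * sqrt (2 * s) ^ k) * indicator {0<..} s \<noteq>
        ennreal (indicator {0..} s * (2 powr (real k / 2) * s powr (real k / 2)) / exp s)"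
      show "s = 0"
      proof (rule ccontr)
        assume "s \<noteq> 0"
        then consider "s < 0" | "0 < s" by linarith
        then show False
        proof cases
          case 2
          then have "sqrt (2 * s) ^ k = (2 * s) powr (real k / 2)"
            by (simp add: powr_half_sqrt[symmetric] powr_power mult.commute)
          then have "sqrt (2 * s) ^ k = 2 powr (real k / 2) * s powr (real k / 2)"
            using 2 by (simp add: powr_mult)
          then show ?thesis using ne 2 by (simp add: exp_minus field_simps)
        qed (use ne in simp)
      qed
    qed
  qed simp_all
  ultimately show ?thesis by simp
qed

text \<open>Layer-cake in place of polar coordinates: the Gaussian weight at radius \<open>u\<close>
  is the integral of \<open>exp (- s)\<close> over all \<open>s\<close> above half of
  \<open>u\<close> squared. By Fubini the Gaussian integral is a superposition of integrals over
  balls of radius \<open>sqrt (2 * s)\<close>, and homogeneity makes each of them a power of the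
  radius times the unit-ball integral.\<close>

lemma nn_integral_gaussian_homogeneous:
  fixes H :: "(nat \<Rightarrow> real) \<Rightarrow> ennreal"
  assumes H[measurable]: "H \<in> borel_measurable (Pi\<^sub>M {..<n} (\<lambda>_. lborel))"
    and hom: "\<And>t c. 0 < t \<Longrightarrow> H (\<lambda>i\<in>{..<n}. t * c i) = ennreal (t ^ d) * H c"
  shows "(\<integral>\<^sup>+c. H c * ennreal (exp (- (L2_set c {..<n})\<^sup>2 / 2)) \<partial>Pi\<^sub>M {..<n} (\<lambda>_. lborel))
    = ennreal (2 powr (real (n + d) / 2) * Gamma (real (n + d) / 2 + 1)) *
      (\<integral>\<^sup>+c. H c * indicator {..1} (L2_set c {..<n}) \<partial>Pi\<^sub>M {..<n} (\<lambda>_. lborel))"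
proof -
  interpret product_sigma_finite "\<lambda>_::nat. lborel :: real measure" by standard
  let ?P = "Pi\<^sub>M {..<n} (\<lambda>_. lborel :: real measure)"
  let ?B = "\<integral>\<^sup>+c. H c * indicator {..1} (L2_set c {..<n}) \<partial>?P"
  interpret P: sigma_finite_measure ?P by (rule sigma_finite) simp
  interpret pair_sigma_finite ?P "lborel :: real measure" by standard
  have L[measurable]: "(\<lambda>c. L2_set c {..<n}) \<in> borel_measurable ?P"
    unfolding L2_set_def by measurable
  have layer: "ennreal (exp (- u\<^sup>2 / 2)) = (\<integral>\<^sup>+s. ennreal (exp (- s)) * indicator {u\<^sup>2 / 2..} s \<partial>lborel)" for u :: real
  proof -
    have "(\<integral>\<^sup>+s. ennreal (exp (- s)) * indicator {u\<^sup>2 / 2..} s \<partial>lborel) = ennreal (0 - - exp (- (u\<^sup>2 / 2)))"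
    proof (rule nn_integral_FTC_atLeast)
      show "((\<lambda>s::real. - exp (- s)) \<longlongrightarrow> 0) at_top"
        using tendsto_minus[OF filterlim_compose[OF exp_at_bot filterlim_uminus_at_bot_at_top]] by simp
    qed (auto intro!: derivative_eq_intros)
    then show ?thesis by simp
  qed
  have ind: "indicator {u\<^sup>2 / 2..} s = (indicator {u..} (sqrt (2 * s)) :: ennreal)" if "0 \<le> u" for u s :: real
  proof -
    have "u\<^sup>2 / 2 \<le> s \<longleftrightarrow> u \<le> sqrt (2 * s)"
    proof
      assume "u\<^sup>2 / 2 \<le> s"
      then show "u \<le> sqrt (2 * s)" by (intro real_le_rsqrt) simp
    next
      assume u: "u \<le> sqrt (2 * s)"
      then have "0 \<le> s" using that by (metis order_trans real_sqrt_ge_0_iff zero_le_mult_iff zero_le_numeral not_numeral_le_zero)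
      moreover have "u\<^sup>2 \<le> (sqrt (2 * s))\<^sup>2" using u that by (intro power_mono)
      ultimately show "u\<^sup>2 / 2 \<le> s" by simp
    qed
    then show ?thesis by (simp add: indicator_def)
  qed
  have "(\<integral>\<^sup>+c. H c * ennreal (exp (- (L2_set c {..<n})\<^sup>2 / 2)) \<partial>?P)
    = (\<integral>\<^sup>+c. \<integral>\<^sup>+s. H c * (ennreal (exp (- s)) * indicator {(L2_set c {..<n})\<^sup>2 / 2..} s) \<partial>lborel \<partial>?P)"
    by (subst layer) (simp add: nn_integral_cmult)
  also have "\<dots> = (\<integral>\<^sup>+c. \<integral>\<^sup>+s. ennreal (exp (- s)) * (H c * indicator {..sqrt (2 * s)} (L2_set c {..<n})) \<partial>lborel \<partial>?P)"
    by (subst ind) (simp_all add: indicator_def mult_ac)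
  also have "\<dots> = (\<integral>\<^sup>+s. \<integral>\<^sup>+c. ennreal (exp (- s)) * (H c * indicator {..sqrt (2 * s)} (L2_set c {..<n})) \<partial>?P \<partial>lborel)"
    by (rule Fubini'[symmetric]) (simp add: indicator_def)
  also have "\<dots> = (\<integral>\<^sup>+s. ennreal (exp (- s)) * (\<integral>\<^sup>+c. H c * indicator {..sqrt (2 * s)} (L2_set c {..<n}) \<partial>?P) \<partial>lborel)"
    by (subst nn_integral_cmult) simp_all
  also have "\<dots> = (\<integral>\<^sup>+s. (ennreal (exp (- s) * sqrt (2 * s) ^ (n + d)) * indicator {0<..} s) * ?B \<partial>lborel)"
  proof (rule nn_integral_cong_AE, rule AE_I[where N="{0}"])
    show "{s \<in> space lborel. \<not> ennreal (exp (- s)) * (\<integral>\<^sup>+c. H c * indicator {..sqrt (2 * s)} (L2_set c {..<n}) \<partial>?P) =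
        (ennreal (exp (- s) * sqrt (2 * s) ^ (n + d)) * indicator {0<..} s) * ?B} \<subseteq> {0}"
    proof (rule subsetI, rule ccontr)
      fix s :: real
      assume ne: "s \<in> {s \<in> space lborel. \<not> ennreal (exp (- s)) * (\<integral>\<^sup>+c. H c * indicator {..sqrt (2 * s)} (L2_set c {..<n}) \<partial>?P) =
        (ennreal (exp (- s) * sqrt (2 * s) ^ (n + d)) * indicator {0<..} s) * ?B}" and "s \<notin> {0}"
      then consider "s < 0" | "0 < s" by fastforce
      then show False
      proof cases
        \<comment> \<open>The real root of a negative number is negative here, so the ball of radius
          \<open>sqrt (2 * s)\<close> is empty.\<close>
        case 1
        then have "\<not> L2_set c {..<n} \<le> sqrt (2 * s)" for c
          using L2_set_nonneg[of c "{..<n}"] real_sqrt_lt_0_iff[of "2 * s"] by linarith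
        then show ?thesis using ne 1 by simp
      next
        case 2
        then have "(\<integral>\<^sup>+c. H c * indicator {..sqrt (2 * s)} (L2_set c {..<n}) \<partial>?P) = ennreal (sqrt (2 * s) ^ (n + d)) * ?B"
          by (intro nn_integral_ball_homogeneous hom) auto
        then show ?thesis using ne 2 by (simp add: ennreal_mult mult.assoc)
      qed
    qed
  qed simp_all
  also have "\<dots> = ennreal (2 powr (real (n + d) / 2) * Gamma (real (n + d) / 2 + 1)) * ?B"
    by (subst nn_integral_multc) (simp_all only: nn_integral_exp_sqrt_power, simp_all)
  finally show ?thesis .
qed


text \<open>The factor \<open>n / (n + d)\<close> is the ratio of the radial integrals of
  \<open>t ^ (n + d - 1)\<close> and \<open>t ^ (n - 1)\<close> over the unit interval. It is
  obtained by writing 1 as \<open>u ^ d\<close> plus the integral of \<open>d * t ^ (d - 1)\<close>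
  from \<open>u\<close> to 1, which yields a linear equation between the two ball integrals. It
  converts a function of the direction into a homogeneous one of degree \<open>d\<close>.\<close>

lemma nn_integral_ball_radial_power:
  fixes G :: "(nat \<Rightarrow> real) \<Rightarrow> ennreal"
  assumes n: "0 < n" and G[measurable]: "G \<in> borel_measurable (Pi\<^sub>M {..<n} (\<lambda>_. lborel))"
    and hom: "\<And>t c. 0 < t \<Longrightarrow> G (\<lambda>i\<in>{..<n}. t * c i) = G c"
    and bounded: "\<And>c. G c \<le> ennreal K"
  shows "ennreal (real n) * (\<integral>\<^sup>+c. G c * indicator {..1} (L2_set c {..<n}) \<partial>Pi\<^sub>M {..<n} (\<lambda>_. lborel))
    = ennreal (real (n + d)) * (\<integral>\<^sup>+c. G c * ennreal (L2_set c {..<n} ^ d) * indicator {..1} (L2_set c {..<n})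
        \<partial>Pi\<^sub>M {..<n} (\<lambda>_. lborel))"
proof -
  interpret product_sigma_finite "\<lambda>_::nat. lborel :: real measure" by standard
  let ?P = "Pi\<^sub>M {..<n} (\<lambda>_. lborel :: real measure)"
  let ?N = "\<lambda>c. L2_set c {..<n}"
  let ?B = "\<integral>\<^sup>+c. G c * indicator {..1} (?N c) \<partial>?P"
  let ?F = "\<integral>\<^sup>+c. G c * ennreal (?N c ^ d) * indicator {..1} (?N c) \<partial>?P"
  interpret P: sigma_finite_measure ?P by (rule sigma_finite) simp
  interpret pair_sigma_finite ?P "lborel :: real measure" by standard
  have L[measurable]: "?N \<in> borel_measurable ?P"
    unfolding L2_set_def by measurable
  \<comment> \<open>The integral of \<open>d * t ^ (n + d - 1)\<close> over the unit interval: the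
    share of the integral that is lost to the factor \<open>u ^ d\<close>.\<close>
  define q where "q = real d / real (n + d)"
  have q: "0 \<le> q" "q * real (n + d) = real d" using n by (auto simp: q_def)
  define w where "w = (\<lambda>t::real. ennreal (real d * t ^ (d - 1)))"
  have [measurable]: "w \<in> borel_measurable borel" unfolding w_def by measurable
  have layer: "ennreal (u ^ d) + (\<integral>\<^sup>+t. w t * indicator {u..1} t \<partial>lborel) = 1" if "0 \<le> u" "u \<le> 1" for u
  proof -
    have "(\<integral>\<^sup>+t. w t * indicator {u..1} t \<partial>lborel) = ennreal (1 ^ d - u ^ d)"
      unfolding w_def using that
      by (intro nn_integral_FTC_Icc) (auto intro!: derivative_eq_intros)
    then show ?thesis
      using that by (simp add: ennreal_plus[symmetric] power_le_one del: ennreal_plus)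
  qed
  have "?B = (\<integral>\<^sup>+c. G c * ennreal (?N c ^ d) * indicator {..1} (?N c) +
      (\<integral>\<^sup>+t. G c * indicator {..1} (?N c) * (w t * indicator {?N c..1} t) \<partial>lborel) \<partial>?P)"
  proof (rule nn_integral_cong)
    fix c
    show "G c * indicator {..1} (?N c) = G c * ennreal (?N c ^ d) * indicator {..1} (?N c) +
      (\<integral>\<^sup>+t. G c * indicator {..1} (?N c) * (w t * indicator {?N c..1} t) \<partial>lborel)"
    proof (cases "?N c \<le> 1")
      case True
      have "G c * ennreal (?N c ^ d) + G c * (\<integral>\<^sup>+t. w t * indicator {?N c..1} t \<partial>lborel) = G c"
        using layer[OF L2_set_nonneg True] by (simp flip: distrib_left)
      then show ?thesis using True by (simp add: nn_integral_cmult)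
    qed simp
  qed
  also have "\<dots> = ?F + (\<integral>\<^sup>+c. \<integral>\<^sup>+t. G c * indicator {..1} (?N c) * (w t * indicator {?N c..1} t) \<partial>lborel \<partial>?P)"
    by (rule nn_integral_add) (simp_all add: indicator_def)
  also have "(\<integral>\<^sup>+c. \<integral>\<^sup>+t. G c * indicator {..1} (?N c) * (w t * indicator {?N c..1} t) \<partial>lborel \<partial>?P)
    = (\<integral>\<^sup>+c. \<integral>\<^sup>+t. w t * indicator {0..1} t * (G c * indicator {..t} (?N c)) \<partial>lborel \<partial>?P)"
    by (intro nn_integral_cong)
      (auto simp: indicator_def mult_ac intro: order_trans dest: order_trans[OF L2_set_nonneg])
  also have "\<dots> = (\<integral>\<^sup>+t. \<integral>\<^sup>+c. w t * indicator {0..1} t * (G c * indicator {..t} (?N c)) \<partial>?P \<partial>lborel)"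
    by (rule Fubini'[symmetric]) (simp add: indicator_def)
  also have "\<dots> = (\<integral>\<^sup>+t. w t * indicator {0..1} t * (\<integral>\<^sup>+c. G c * indicator {..t} (?N c) \<partial>?P) \<partial>lborel)"
    by (subst nn_integral_cmult) simp_all
  also have "\<dots> = (\<integral>\<^sup>+t. (ennreal (real d * t ^ (n + d - 1)) * indicator {0..1} t) * ?B \<partial>lborel)"
  proof (rule nn_integral_cong_AE, rule AE_I[where N="{0}"])
    show "{t \<in> space lborel. \<not> w t * indicator {0..1} t * (\<integral>\<^sup>+c. G c * indicator {..t} (?N c) \<partial>?P) =
        (ennreal (real d * t ^ (n + d - 1)) * indicator {0..1} t) * ?B} \<subseteq> {0}"
    proof (rule subsetI, rule ccontr)
      fix t :: real
      assume ne: "t \<in> {t \<in> space lborel. \<not> w t * indicator {0..1} t * (\<integral>\<^sup>+c. G c * indicator {..t} (?N c) \<partial>?P) =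
        (ennreal (real d * t ^ (n + d - 1)) * indicator {0..1} t) * ?B}" and "t \<notin> {0}"
      then have t: "0 < t" by (cases "0 \<le> t") (auto simp: indicator_def)
      then have scale: "(\<integral>\<^sup>+c. G c * indicator {..t} (?N c) \<partial>?P) = ennreal (t ^ (n + 0)) * ?B"
        by (intro nn_integral_ball_homogeneous) (auto simp: hom)
      \<comment> \<open>For \<open>d = 0\<close> the truncated exponent \<open>d - 1\<close> breaks
        this identity, but then \<open>real d\<close> makes both weights zero.\<close>
      have "d \<noteq> 0 \<Longrightarrow> t ^ (d - 1) * t ^ n = t ^ (n + d - 1)"
        by (simp flip: power_add add: add.commute)
      then have "w t * ennreal (t ^ n) = ennreal (real d * t ^ (n + d - 1))"
        using t by (cases "d = 0") (simp_all add: w_def ennreal_mult[symmetric] mult.assoc)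
      moreover have "w t * indicator {0..1} t * (ennreal (t ^ (n + 0)) * ?B)
          = (w t * ennreal (t ^ n)) * indicator {0..1} t * ?B" by (simp add: mult_ac)
      ultimately show False using ne scale by simp
    qed
  qed simp_all
  also have "\<dots> = (\<integral>\<^sup>+t. ennreal (real d * t ^ (n + d - 1)) * indicator {0..1} t \<partial>lborel) * ?B"
    by (rule nn_integral_multc) simp
  also have "(\<integral>\<^sup>+t. ennreal (real d * t ^ (n + d - 1)) * indicator {0..1} t \<partial>lborel)
      = ennreal (q * 1 ^ (n + d) - q * 0 ^ (n + d))"
  proof (rule nn_integral_FTC_Icc)
    fix t :: real
    have "((\<lambda>t. q * t ^ (n + d)) has_real_derivative q * (real (n + d) * t ^ (n + d - Suc 0))) (at t)"
      by (intro DERIV_cmult DERIV_pow)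
    then show "((\<lambda>t. q * t ^ (n + d)) has_real_derivative real d * t ^ (n + d - 1)) (at t)"
      using q(2) by (simp add: mult.assoc[symmetric])
  qed auto
  also have "\<dots> = ennreal q" using n by (simp add: zero_power)
  finally have eq: "?B = ?F + ennreal q * ?B" .
  \<comment> \<open>Solving \<open>B = F + q * B\<close> requires a subtraction, which fails in
    \<open>ennreal\<close> at infinity. The bound on \<open>G\<close> and the finite volume of the
    ball make \<open>B\<close> finite.\<close>
  have "?B \<le> (\<integral>\<^sup>+c. ennreal K * indicator ({f. sqrt (\<Sum>i\<in>{..<n}. (f i)\<^sup>2) \<le> 1} \<inter> space ?P) c \<partial>?P)"
    using bounded by (intro nn_integral_mono) (auto simp: indicator_def L2_set_def)
  also have "\<dots> = ennreal K * emeasure ?P ({f. sqrt (\<Sum>i\<in>{..<n}. (f i)\<^sup>2) \<le> 1} \<inter> space ?P)"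
  proof (rule nn_integral_cmult_indicator)
    have "{c \<in> space ?P. ?N c \<le> 1} \<in> sets ?P" by measurable
    then show "{f. sqrt (\<Sum>i\<in>{..<n}. (f i)\<^sup>2) \<le> 1} \<inter> space ?P \<in> sets ?P"
      by (simp add: L2_set_def Int_def conj_commute)
  qed
  also have "\<dots> = ennreal K * ennreal (unit_ball_vol (real n))"
    using emeasure_cball_aux[of "{..<n}" 1] by simp
  also have "\<dots> < \<infinity>" by (simp add: ennreal_mult_less_top)
  finally have B_fin: "?B < \<infinity>" .
  moreover have "?F \<le> ?B" by (subst eq) simp
  ultimately have F_fin: "?F < \<infinity>" by (rule order.strict_trans1[rotated])
  obtain b where b: "?B = ennreal b" "0 \<le> b" using B_fin by (cases ?B) auto
  obtain f where f: "?F = ennreal f" "0 \<le> f" using F_fin by (cases ?F) auto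
  have "ennreal b = ennreal (f + q * b)"
    using eq b f q(1) by (simp add: ennreal_mult)
  then have "b = f + q * b" using b f q(1) by (subst (asm) ennreal_inj) auto
  then have "real (n + d) * b = real (n + d) * f + (q * real (n + d)) * b"
    by (metis distrib_left mult.assoc mult.commute)
  then have "real (n + d) * b = real (n + d) * f + real d * b" by (simp only: q(2))
  then have "real n * b = real (n + d) * f" by (simp add: algebra_simps)
  then have "ennreal (real n) * ennreal b = ennreal (real (n + d)) * ennreal f"
    using b f by (simp add: ennreal_mult[symmetric] del: of_nat_add)
  then show ?thesis using b f by simp
qed

section \<open>Moments of linear forms: Gaussian, then spherical\<close>

text \<open>In independent standard normal coordinates the linear form is normal, with variance the
  squared norm of \<open>a\<close>. The constant is the even moment of the standard normal
  distribution, which counts the pairings of \<open>2 * r\<close> objects.\<close>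

lemma gaussian_moment_PiM:
  fixes a :: "nat \<Rightarrow> real"
  shows "(\<integral>\<^sup>+c. ennreal ((\<Sum>i<n. a i * c i) ^ (2 * r)) * ennreal (\<Prod>i<n. std_normal_density (c i)) \<partial>Pi\<^sub>M {..<n} (\<lambda>_. lborel))
    = ennreal (fact (2 * r) / (2 ^ r * fact r) * (\<Sum>i<n. (a i)\<^sup>2) ^ r)"
proof -
  let ?P = "Pi\<^sub>M {..<n} (\<lambda>_. lborel :: real measure)"
  define N where "N = density lborel (\<lambda>x. ennreal (std_normal_density x))"
  define Q where "Q = Pi\<^sub>M {..<n} (\<lambda>_. N)"
  have N_sets[measurable_cong]: "sets N = sets borel" by (simp add: N_def)
  have N: "prob_space N" unfolding N_def by (rule prob_space_normal_density) simp
  interpret N: prob_space N by fact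
  interpret L: product_sigma_finite "\<lambda>_::nat. lborel :: real measure" by standard
  interpret NN: product_sigma_finite "\<lambda>_::nat. N" by standard
  interpret Q: prob_space Q unfolding Q_def by (intro prob_space_PiM N)
  have Q_sets[measurable_cong]: "sets Q = sets ?P"
    unfolding Q_def by (intro sets_PiM_cong) (simp_all add: N_sets)
  \<comment> \<open>Identifies the weighted Lebesgue measure with a product of probability spaces,
    where independence of the coordinates is available.\<close>
  have Q_eq: "density ?P (\<lambda>c. ennreal (\<Prod>i<n. std_normal_density (c i))) = Q"
    unfolding Q_def
  proof (rule NN.PiM_eqI)
    fix A assume "\<And>i. i \<in> {..<n} \<Longrightarrow> A i \<in> sets N"
    then have A[measurable]: "A i \<in> sets borel" if "i < n" for i using that by (simp add: N_sets)
    have PA: "Pi\<^sub>E {..<n} A \<in> sets ?P" by (rule sets_PiM_I_finite) (auto simp: A)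
    have "emeasure (density ?P (\<lambda>c. ennreal (\<Prod>i<n. std_normal_density (c i)))) (Pi\<^sub>E {..<n} A)
        = (\<integral>\<^sup>+c. ennreal (\<Prod>i<n. std_normal_density (c i)) * indicator (Pi\<^sub>E {..<n} A) c \<partial>?P)"
      using PA by (intro emeasure_density) measurable
    also have "\<dots> = (\<integral>\<^sup>+c. (\<Prod>i<n. ennreal (std_normal_density (c i)) * indicator (A i) (c i)) \<partial>?P)"
    proof (rule nn_integral_cong)
      fix c assume c: "c \<in> space ?P"
      have "(\<Prod>i<n. indicator (A i) (c i)) = (indicator (Pi\<^sub>E {..<n} A) c :: ennreal)"
      proof (cases "c \<in> Pi\<^sub>E {..<n} A")
        case True
        then show ?thesis by (simp add: PiE_iff)
      next
        case False
        then obtain i where "i < n" "c i \<notin> A i" using c by (auto simp: space_PiM PiE_iff)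
        then have "\<exists>i\<in>{..<n}. indicator (A i) (c i) = (0 :: ennreal)" by (intro bexI[of _ i]) simp_all
        then show ?thesis using False prod_zero[of "{..<n}"] by simp
      qed
      then show "ennreal (\<Prod>i<n. std_normal_density (c i)) * indicator (Pi\<^sub>E {..<n} A) c
          = (\<Prod>i<n. ennreal (std_normal_density (c i)) * indicator (A i) (c i))"
        by (simp add: prod.distrib prod_ennreal)
    qed
    also have "\<dots> = (\<Prod>i<n. \<integral>\<^sup>+x. ennreal (std_normal_density x) * indicator (A i) x \<partial>lborel)"
      by (rule L.product_nn_integral_prod) (simp_all add: A)
    also have "\<dots> = (\<Prod>i<n. emeasure N (A i))"
      using A by (intro prod.cong refl) (simp add: N_def emeasure_density)
    finally show "emeasure (density ?P (\<lambda>c. ennreal (\<Prod>i<n. std_normal_density (c i)))) (Pi\<^sub>E {..<n} A)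
      = (\<Prod>i\<in>{..<n}. emeasure N (A i))" .
  qed (simp_all add: Q_sets[unfolded Q_def])
  \<comment> \<open>A vanishing coefficient would give a degenerate normal variable, which has no
    density; such summands are dropped.\<close>
  define J where "J = {i. i < n \<and> a i \<noteq> 0}"
  have J: "finite J" "J \<subseteq> {..<n}" by (auto simp: J_def)
  have sum_J: "(\<Sum>i<n. g i) = (\<Sum>i\<in>J. g i)" if "\<And>i. a i = 0 \<Longrightarrow> g i = 0" for g :: "nat \<Rightarrow> real"
    using that by (intro sum.mono_neutral_right) (auto simp: J_def)
  have "(\<integral>\<^sup>+c. ennreal ((\<Sum>i<n. a i * c i) ^ (2 * r)) * ennreal (\<Prod>i<n. std_normal_density (c i)) \<partial>?P)
      = (\<integral>\<^sup>+c. ennreal ((\<Sum>i\<in>J. a i * c i) ^ (2 * r)) \<partial>Q)"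
  proof -
    have "(\<Sum>i<n. a i * c i) = (\<Sum>i\<in>J. a i * c i)" for c by (rule sum_J) simp
    moreover have "(\<integral>\<^sup>+c. ennreal ((\<Sum>i<n. a i * c i) ^ (2 * r)) \<partial>density ?P (\<lambda>c. ennreal (\<Prod>i<n. std_normal_density (c i))))
      = (\<integral>\<^sup>+c. ennreal (\<Prod>i<n. std_normal_density (c i)) * ennreal ((\<Sum>i<n. a i * c i) ^ (2 * r)) \<partial>?P)"
      by (rule nn_integral_density) measurable
    ultimately show ?thesis unfolding Q_eq by (simp add: mult.commute)
  qed
  also have "\<dots> = ennreal (fact (2 * r) / (2 ^ r * fact r) * (\<Sum>i\<in>J. (a i)\<^sup>2) ^ r)"
  proof (cases "J = {}")
    \<comment> \<open>The form is zero: the integral vanishes unless \<open>r = 0\<close>, when it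
      is the total mass 1.\<close>
    case True
    then show ?thesis by (cases "r = 0") (simp_all add: Q.emeasure_space_1 zero_power)
  next
    case False
    define \<sigma> where "\<sigma> = sqrt (\<Sum>i\<in>J. \<bar>a i\<bar>\<^sup>2)"
    have "0 < (\<Sum>i\<in>J. \<bar>a i\<bar>\<^sup>2)" using False J by (intro sum_pos) (auto simp: J_def)
    then have \<sigma>: "0 < \<sigma>" by (simp add: \<sigma>_def)
    have coord: "distr Q borel (\<lambda>c. c i) = N" if "i < n" for i
    proof -
      have "distr Q borel (\<lambda>c. c i) = distr Q N (\<lambda>c. c i)" by (rule distr_cong) (simp_all add: N_sets)
      also have "\<dots> = N" unfolding Q_def by (rule distr_PiM_component) (use N that in simp_all)
      finally show ?thesis .
    qed
    have coord_meas[measurable]: "(\<lambda>c. c i) \<in> borel_measurable Q" if "i < n" for i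
      using that unfolding measurable_cong_sets[OF Q_sets refl]
      by (intro measurable_component_singleton[THEN measurable_compose]) simp_all
    have "Q.indep_vars (\<lambda>_. borel) (\<lambda>i c. c i) {..<n}"
    proof (subst Q.indep_vars_iff_distr_eq_PiM')
      show "{..<n} \<noteq> {}" using False J by auto
      have "distr Q (Pi\<^sub>M {..<n} (\<lambda>_. borel)) (\<lambda>c. \<lambda>i\<in>{..<n}. c i) = distr Q Q (\<lambda>c. c)"
      proof (rule distr_cong)
        show "sets (Pi\<^sub>M {..<n} (\<lambda>_. borel)) = sets Q"
          unfolding Q_sets by (intro sets_PiM_cong) simp_all
        show "(\<lambda>i\<in>{..<n}. c i) = c" if "c \<in> space Q" for c
          using that unfolding Q_def by (simp add: space_PiM PiE_restrict)
      qed simp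
      also have "\<dots> = Pi\<^sub>M {..<n} (\<lambda>_. N)" by (simp add: distr_id Q_def)
      also have "\<dots> = (\<Pi>\<^sub>M i\<in>{..<n}. distr Q borel (\<lambda>c. c i))"
        by (rule PiM_cong) (simp_all add: coord)
      finally show "distr Q (Pi\<^sub>M {..<n} (\<lambda>_. borel)) (\<lambda>c. \<lambda>i\<in>{..<n}. c i)
          = (\<Pi>\<^sub>M i\<in>{..<n}. distr Q borel (\<lambda>c. c i))" .
    qed simp_all
    then have "Q.indep_vars (\<lambda>_. borel) (\<lambda>i c. c i) J" by (rule Q.indep_vars_subset) (rule J)
    then have indep: "Q.indep_vars (\<lambda>_. borel) (\<lambda>i c. a i * c i) J"
      by (rule Q.indep_vars_compose2) simp
    have "distributed Q lborel (\<lambda>c. a i * c i) (normal_density 0 \<bar>a i\<bar>)" if "i \<in> J" for i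
    proof -
      have i: "i < n" "a i \<noteq> 0" using that by (auto simp: J_def)
      have "distributed Q lborel (\<lambda>c. c i) (normal_density 0 1)"
        unfolding distributed_def
      proof (intro conjI)
        have "distr Q lborel (\<lambda>c. c i) = distr Q borel (\<lambda>c. c i)" by (rule distr_cong) simp_all
        then show "distr Q lborel (\<lambda>c. c i) = density lborel (\<lambda>x. ennreal (normal_density 0 1 x))"
          using coord[OF i(1)] by (simp add: N_def)
      qed (use i in simp_all)
      from Q.normal_density_affine[OF this _ i(2), of 0] show ?thesis by simp
    qed
    then have "distributed Q lborel (\<lambda>c. \<Sum>i\<in>J. a i * c i) (normal_density (\<Sum>i\<in>J. 0) \<sigma>)"
      unfolding \<sigma>_def using J False indep by (intro Q.sum_indep_normal) (auto simp: J_def)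
    then have "(\<integral>\<^sup>+c. ennreal ((\<Sum>i\<in>J. a i * c i) ^ (2 * r)) \<partial>Q)
        = (\<integral>\<^sup>+x. ennreal (normal_density 0 \<sigma> x) * ennreal (x ^ (2 * r)) \<partial>lborel)"
      using distributed_nn_integral[of Q lborel "\<lambda>c. \<Sum>i\<in>J. a i * c i" "\<lambda>x. ennreal (normal_density 0 \<sigma> x)"
        "\<lambda>x. ennreal (x ^ (2 * r))"] by simp
    also have "\<dots> = (\<integral>\<^sup>+x. ennreal (normal_density 0 \<sigma> x * (x - 0) ^ (2 * r)) \<partial>lborel)"
      by (simp add: ennreal_mult')
    also have "\<dots> = ennreal (fact (2 * r) / ((2 / \<sigma>\<^sup>2) ^ r * fact r))"
    proof -
      have "integrable lborel (\<lambda>x. normal_density 0 \<sigma> x * (x - 0) ^ (2 * r))"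
        and "integral\<^sup>L lborel (\<lambda>x. normal_density 0 \<sigma> x * (x - 0) ^ (2 * r)) = fact (2 * r) / ((2 / \<sigma>\<^sup>2) ^ r * fact r)"
        using normal_moment_even[OF \<sigma>, of 0 r] unfolding has_bochner_integral_iff by blast+
      then show ?thesis by (subst nn_integral_eq_integral) simp_all
    qed
    also have "fact (2 * r) / ((2 / \<sigma>\<^sup>2) ^ r * fact r) = fact (2 * r) / (2 ^ r * fact r) * (\<sigma>\<^sup>2) ^ r"
      by (simp add: power_divide)
    also have "\<sigma>\<^sup>2 = (\<Sum>i\<in>J. (a i)\<^sup>2)" by (simp add: \<sigma>_def sum_nonneg)
    finally show ?thesis .
  qed
  finally show ?thesis by (simp add: sum_J)
qed

text \<open>Three integrals in coordinates of \<open>N\<close> are compared: over the ball of the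
  direction part \<open>G\<close>, which is what the sphere measure gives; over the ball of the
  polynomial \<open>H\<close>; and the Gaussian integral of \<open>H\<close>, which is
  known.\<close>

lemma nn_integral_sphere_power:
  fixes N :: "'a::euclidean_space set"
  assumes N: "subspace N" "0 < dim N" and A: "A \<in> N"
  shows "(\<integral>\<^sup>+\<nu>. ennreal (inner A \<nu> ^ (2 * r)) \<partial>sphere_measure N)
    = ennreal (sphere_vol (dim N + 2 * r - 1) / (2 * pi) ^ r * (fact (2 * r) / (2 ^ r * fact r) * inner A A ^ r))"
proof -
  define n where "n = dim N"
  define k where "k = n + 2 * r"
  define b where "b = (SOME b. orthonormal_basis_of n N b)"
  define P where "P = Pi\<^sub>M {..<n} (\<lambda>_. lborel :: real measure)"
  define g where "g = (\<lambda>c. \<Sum>i<n. c i *\<^sub>R b i)"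
  have n: "0 < n" using N by (simp add: n_def)
  have b: "orthonormal_basis_of n N b"
    unfolding b_def n_def by (rule someI_ex[OF orthonormal_basis_of_exists[OF N(1)]])
  have g[measurable]: "g \<in> P \<rightarrow>\<^sub>M borel"
    unfolding g_def P_def by measurable
  have L: "subspace_lborel N = distr P borel g"
    by (simp add: subspace_lborel_def Let_def P_def g_def b_def n_def)
  have sgn[measurable]: "(sgn :: 'a \<Rightarrow> 'a) \<in> borel_measurable borel"
    unfolding sgn_div_norm by measurable
  have norm_g: "norm (g c) = L2_set c {..<n}" for c
    unfolding g_def L2_set_def by (rule norm_orthonormal_sum[OF b])
  have g_scale: "g (\<lambda>i\<in>{..<n}. t * c i) = t *\<^sub>R g c" for t c
    by (simp add: g_def scaleR_sum_right)
  define G where "G = (\<lambda>c. ennreal (inner A (sgn (g c)) ^ (2 * r)))"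
  define H where "H = (\<lambda>c. ennreal ((\<Sum>i<n. inner A (b i) * c i) ^ (2 * r)))"
  have M1: "(\<lambda>x. ennreal (real n) * indicator (cball 0 1) x) \<in> borel_measurable (borel :: 'a measure)"
    by (intro borel_measurable_times_ennreal borel_measurable_indicator) auto
  have M2: "(\<lambda>x. ennreal (inner A (sgn x) ^ (2 * r))) \<in> borel_measurable borel" by measurable
  have [measurable]: "(\<lambda>c. L2_set c {..<n}) \<in> borel_measurable P"
    unfolding L2_set_def P_def by measurable
  have G_meas[measurable]: "G \<in> borel_measurable P" unfolding G_def by measurable
  have H_meas[measurable]: "H \<in> borel_measurable P" unfolding H_def P_def by measurable
  have inner_g: "inner A (g c) = (\<Sum>i<n. inner A (b i) * c i)" for c
    by (simp add: g_def inner_sum_right mult.commute)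
  have GH: "G c * ennreal (L2_set c {..<n} ^ (2 * r)) = H c" for c
  proof -
    have "inner A (sgn (g c)) * norm (g c) = inner A (g c)"
      by (cases "g c = 0") (simp_all add: sgn_div_norm)
    then have "inner A (sgn (g c)) ^ (2 * r) * norm (g c) ^ (2 * r) = inner A (g c) ^ (2 * r)"
      by (simp flip: power_mult_distrib)
    then show ?thesis
      unfolding G_def H_def norm_g[symmetric] inner_g[symmetric]
      by (subst ennreal_mult[symmetric]) simp_all
  qed
  have "(\<integral>\<^sup>+\<nu>. ennreal (inner A \<nu> ^ (2 * r)) \<partial>sphere_measure N)
    = (\<integral>\<^sup>+x. ennreal (inner A (sgn x) ^ (2 * r)) \<partial>density (distr P borel g) (\<lambda>x. ennreal (real n) * indicator (cball 0 1) x))"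
    unfolding sphere_measure_def n_def[symmetric] L by (rule nn_integral_distr) measurable
  also have "\<dots> = (\<integral>\<^sup>+x. ennreal (real n) * indicator (cball 0 1) x * ennreal (inner A (sgn x) ^ (2 * r)) \<partial>distr P borel g)"
    by (rule nn_integral_density) (use M1 M2 in simp_all)
  also have "\<dots> = (\<integral>\<^sup>+c. ennreal (real n) * indicator (cball 0 1) (g c) * ennreal (inner A (sgn (g c)) ^ (2 * r)) \<partial>P)"
    by (rule nn_integral_distr[OF g]) (use M1 M2 in simp)
  also have "\<dots> = (\<integral>\<^sup>+c. ennreal (real n) * (G c * indicator {..1} (L2_set c {..<n})) \<partial>P)"
    by (simp add: G_def indicator_def norm_g mult_ac)
  also have "\<dots> = ennreal (real n) * (\<integral>\<^sup>+c. G c * indicator {..1} (L2_set c {..<n}) \<partial>P)"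
    by (rule nn_integral_cmult) measurable
  also have "\<dots> = ennreal (real (n + 2 * r)) * (\<integral>\<^sup>+c. G c * ennreal (L2_set c {..<n} ^ (2 * r)) * indicator {..1} (L2_set c {..<n}) \<partial>P)"
    unfolding P_def
  proof (rule nn_integral_ball_radial_power[OF n])
    show "G \<in> borel_measurable (Pi\<^sub>M {..<n} (\<lambda>_. lborel))" using G_meas by (simp add: P_def)
    show "G (\<lambda>i\<in>{..<n}. t * c i) = G c" if "0 < t" for t c
      using that by (simp add: G_def g_scale sgn_scaleR)
    show "G c \<le> ennreal (norm A ^ (2 * r))" for c
    proof -
      have "\<bar>inner A (sgn (g c))\<bar> \<le> norm A * norm (sgn (g c))" by (rule Cauchy_Schwarz_ineq2)
      also have "\<dots> \<le> norm A" by (simp add: norm_sgn mult_left_le)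
      finally have "\<bar>inner A (sgn (g c))\<bar> ^ (2 * r) \<le> norm A ^ (2 * r)" by (intro power_mono) simp_all
      then show ?thesis unfolding G_def by (intro ennreal_leI) (simp add: power_even_abs)
    qed
  qed
  also have "\<dots> = ennreal (real k) * (\<integral>\<^sup>+c. H c * indicator {..1} (L2_set c {..<n}) \<partial>P)" (is "_ = _ * ?F")
    by (simp add: GH k_def)
  finally have sphere: "(\<integral>\<^sup>+\<nu>. ennreal (inner A \<nu> ^ (2 * r)) \<partial>sphere_measure N) = ennreal (real k) * ?F" .

  define m where "m = fact (2 * r) / (2 ^ r * fact r) * inner A A ^ r"
  define \<gamma> where "\<gamma> = 2 powr (real k / 2) * Gamma (real k / 2 + 1)"
  have \<gamma>: "0 < \<gamma>" by (simp add: \<gamma>_def Gamma_real_pos)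
  have "inner A A = inner A (\<Sum>i<n. inner (b i) A *\<^sub>R b i)"
    using orthonormal_basis_expansion[OF b A] by simp
  also have "\<dots> = (\<Sum>i<n. (inner A (b i))\<^sup>2)"
    by (simp add: inner_sum_right power2_eq_square inner_commute[of "b _" A])
  finally have "inner A A = (\<Sum>i<n. (inner A (b i))\<^sup>2)" .
  then have "ennreal m = (\<integral>\<^sup>+c. H c * ennreal (\<Prod>i<n. std_normal_density (c i)) \<partial>P)"
    unfolding H_def P_def m_def by (simp only: gaussian_moment_PiM)
  also have "\<dots> = (\<integral>\<^sup>+c. ennreal ((1 / sqrt (2 * pi)) ^ n) * (H c * ennreal (exp (- (L2_set c {..<n})\<^sup>2 / 2))) \<partial>P)"
  proof (rule nn_integral_cong)
    fix c
    have "(\<Prod>i<n. std_normal_density (c i)) = (1 / sqrt (2 * pi)) ^ n * exp (\<Sum>i<n. - (c i)\<^sup>2 / 2)"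
      unfolding std_normal_density_def prod.distrib by (simp add: exp_sum)
    also have "(\<Sum>i<n. - (c i)\<^sup>2 / 2) = - (L2_set c {..<n})\<^sup>2 / 2"
      by (simp add: L2_set_def sum_nonneg sum_negf flip: sum_divide_distrib)
    finally show "H c * ennreal (\<Prod>i<n. std_normal_density (c i))
        = ennreal ((1 / sqrt (2 * pi)) ^ n) * (H c * ennreal (exp (- (L2_set c {..<n})\<^sup>2 / 2)))"
      by (simp only:) (subst ennreal_mult, simp_all add: mult_ac)
  qed
  also have "\<dots> = ennreal ((1 / sqrt (2 * pi)) ^ n) * (\<integral>\<^sup>+c. H c * ennreal (exp (- (L2_set c {..<n})\<^sup>2 / 2)) \<partial>P)"
    by (rule nn_integral_cmult) measurable
  also have "(\<integral>\<^sup>+c. H c * ennreal (exp (- (L2_set c {..<n})\<^sup>2 / 2)) \<partial>P) = ennreal \<gamma> * ?F"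
    unfolding P_def \<gamma>_def k_def
  proof (rule nn_integral_gaussian_homogeneous)
    show "H \<in> borel_measurable (Pi\<^sub>M {..<n} (\<lambda>_. lborel))" using H_meas by (simp add: P_def)
    show "H (\<lambda>i\<in>{..<n}. t * c i) = ennreal (t ^ (2 * r)) * H c" if "0 < t" for t c
    proof -
      have "inner A (g (\<lambda>i\<in>{..<n}. t * c i)) ^ (2 * r) = t ^ (2 * r) * inner A (g c) ^ (2 * r)"
        by (simp add: g_scale power_mult_distrib)
      then show ?thesis unfolding H_def inner_g[symmetric] by (simp add: ennreal_mult)
    qed
  qed
  also have "ennreal ((1 / sqrt (2 * pi)) ^ n) * (ennreal \<gamma> * ?F) = ennreal (\<gamma> / sqrt (2 * pi) ^ n) * ?F"
    using \<gamma> by (simp add: ennreal_mult[symmetric] mult.assoc[symmetric] power_divide)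
  finally have eq: "ennreal m = ennreal (\<gamma> / sqrt (2 * pi) ^ n) * ?F" .
  \<comment> \<open>Finiteness is read off from \<open>eq\<close>: a positive multiple of this
    integral is a finite moment.\<close>
  have "?F < \<infinity>"
    using \<gamma> eq by (cases ?F) (auto simp: ennreal_mult_top)
  then obtain f where f: "?F = ennreal f" "0 \<le> f" by (cases ?F) auto
  have "m = \<gamma> / sqrt (2 * pi) ^ n * f"
  proof -
    have "ennreal (\<gamma> / sqrt (2 * pi) ^ n * f) = ennreal (\<gamma> / sqrt (2 * pi) ^ n) * ennreal f"
      by (rule ennreal_mult) (use f \<gamma> in simp_all)
    then have "ennreal m = ennreal (\<gamma> / sqrt (2 * pi) ^ n * f)" using eq f by simp
    moreover have "0 \<le> m" by (simp add: m_def)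
    ultimately show ?thesis using f \<gamma> by (subst (asm) ennreal_inj) auto
  qed
  then have f_eq: "f = m * sqrt (2 * pi) ^ n / \<gamma>" using \<gamma> by (simp add: field_simps)
  \<comment> \<open>The radial factor \<open>k\<close>, the power \<open>pi powr (k / 2)\<close> and
    \<open>Gamma (k / 2 + 1)\<close> combine to \<open>k\<close> times the volume of the
    \<open>k\<close>-dimensional unit ball. The normalization of a Gaussian in \<open>n\<close>
    variables supplies only \<open>(2 * pi) powr (n / 2)\<close>, hence the division by
    \<open>(2 * pi) ^ r\<close>.\<close>
  have "real k * f = sphere_vol (k - 1) / (2 * pi) ^ r * m"
  proof -
    have k: "0 < k" "real (Suc (k - 1)) = real k" using n by (simp_all add: k_def)
    have "sqrt (2 * pi) ^ n * (2 * pi) ^ r = (2 * pi) powr (real k / 2)"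
    proof -
      have "sqrt (2 * pi) ^ n = (2 * pi) powr (real n / 2)"
        by (simp add: powr_half_sqrt[symmetric] powr_power)
      moreover have "(2 * pi) ^ r = (2 * pi) powr real r" by (simp add: powr_realpow)
      moreover have "real k / 2 = real n / 2 + real r" by (simp add: k_def)
      ultimately show ?thesis by (simp only: powr_add)
    qed
    also have "\<dots> = 2 powr (real k / 2) * pi powr (real k / 2)" by (rule powr_mult)
    finally have st: "sqrt (2 * pi) ^ n * (2 * pi) ^ r = 2 powr (real k / 2) * pi powr (real k / 2)" .
    have "s / (a * c) = b / c / t" if "s * t = a * b" "a \<noteq> 0" "c \<noteq> 0" "t \<noteq> 0" for s t a b c :: real
      using that by (simp add: field_simps)
    from this[OF st, of "Gamma (real k / 2 + 1)"]
    have "sqrt (2 * pi) ^ n / \<gamma> = unit_ball_vol (real k) / (2 * pi) ^ r"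
      using Gamma_real_pos[of "real k / 2 + 1", THEN less_imp_neq] unfolding \<gamma>_def unit_ball_vol_def by simp
    then have "real k * (m * (sqrt (2 * pi) ^ n / \<gamma>)) = real k * (m * (unit_ball_vol (real k) / (2 * pi) ^ r))"
      by (simp only:)
    then show ?thesis
      unfolding f_eq sphere_vol_def k(2) by (simp add: mult_ac)
  qed
  then show ?thesis
    using f by (simp add: sphere m_def n_def[symmetric] k_def[symmetric] flip: ennreal_mult)
qed


text \<open>Even powers are nonnegative, so the value of the nonnegative integral gives both
  integrability and the Bochner integral. Polarization has alternating signs and needs the
  latter.\<close>

lemma integral_sphere_power:
  fixes N :: "'a::euclidean_space set"
  assumes "subspace N" "0 < dim N" "A \<in> N"
  shows "integrable (sphere_measure N) (\<lambda>\<nu>. inner A \<nu> ^ (2 * r))"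
    and "(\<integral>\<nu>. inner A \<nu> ^ (2 * r) \<partial>sphere_measure N)
      = sphere_vol (dim N + 2 * r - 1) / (2 * pi) ^ r * (fact (2 * r) / (2 ^ r * fact r) * inner A A ^ r)"
proof -
  have "0 \<le> sphere_vol (dim N + 2 * r - 1) / (2 * pi) ^ r * (fact (2 * r) / (2 ^ r * fact r) * inner A A ^ r)"
    by (simp add: sphere_vol_def)
  moreover have "sets (sphere_measure N) = sets borel" by (simp add: sphere_measure_def)
  then have "(\<lambda>\<nu>. inner A \<nu> ^ (2 * r)) \<in> borel_measurable (sphere_measure N)"
    by (subst measurable_cong_sets[OF _ refl]) (assumption, measurable)
  ultimately show "integrable (sphere_measure N) (\<lambda>\<nu>. inner A \<nu> ^ (2 * r))"
    and "(\<integral>\<nu>. inner A \<nu> ^ (2 * r) \<partial>sphere_measure N)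
      = sphere_vol (dim N + 2 * r - 1) / (2 * pi) ^ r * (fact (2 * r) / (2 ^ r * fact r) * inner A A ^ r)"
    using nn_integral_sphere_power[OF assms, of r]
      nn_integral_eq_integrable[of "\<lambda>\<nu>. inner A \<nu> ^ (2 * r)" "sphere_measure N"] by simp_all
qed

text \<open>Wick's formula; the sum counts every pairing \<open>2\<^sup>r r!\<close> times.\<close>

lemma integral_sphere_prod:
  fixes N :: "'a::euclidean_space set"
  assumes N: "subspace N" "0 < dim N" and A: "\<And>i. i < 2 * r \<Longrightarrow> A i \<in> N"
  shows "integrable (sphere_measure N) (\<lambda>\<nu>. \<Prod>i<2 * r. inner (A i) \<nu>)"
    and "(\<integral>\<nu>. (\<Prod>i<2 * r. inner (A i) \<nu>) \<partial>sphere_measure N)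
      = sphere_vol (dim N + 2 * r - 1) / (2 * pi) ^ r / (2 ^ r * fact r) *
        (\<Sum>\<tau> | \<tau> permutes {..<2 * r}. \<Prod>s<r. inner (A (\<tau> (2 * s))) (A (\<tau> (2 * s + 1))))"
proof -
  let ?A = "\<lambda>X. \<Sum>j\<in>{..<2 * r} - X. A j"
  let ?c = "sphere_vol (dim N + 2 * r - 1) / (2 * pi) ^ r"
  have A': "?A X \<in> N" for X by (rule subspace_sum[OF N(1)]) (simp add: A)
  have polar: "(\<Prod>i<2 * r. inner (A i) \<nu>)
      = (\<Sum>X\<in>Pow {..<2 * r}. (-1) ^ card X * inner (?A X) \<nu> ^ (2 * r)) / fact (2 * r)" for \<nu>
    using prod_polarization[of "2 * r" "\<lambda>i. inner (A i) \<nu>"] by (simp add: inner_sum_left field_simps)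
  have int: "integrable (sphere_measure N) (\<lambda>\<nu>. inner (?A X) \<nu> ^ (2 * r))" for X
    by (rule integral_sphere_power(1)[OF N A'])
  show "integrable (sphere_measure N) (\<lambda>\<nu>. \<Prod>i<2 * r. inner (A i) \<nu>)"
    unfolding polar by (intro integrable_divide Bochner_Integration.integrable_sum integrable_mult_right int)
  have "(\<integral>\<nu>. (\<Prod>i<2 * r. inner (A i) \<nu>) \<partial>sphere_measure N)
    = (\<Sum>X\<in>Pow {..<2 * r}. (-1) ^ card X * (\<integral>\<nu>. inner (?A X) \<nu> ^ (2 * r) \<partial>sphere_measure N)) / fact (2 * r)"
    unfolding polar by (subst integral_divide_zero, subst Bochner_Integration.integral_sum)
      (intro integrable_mult_right int, simp)
  \<comment> \<open>The \<open>fact (2 * r)\<close> of polarization cancels the one in the moment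
    formula.\<close>
  also have "\<dots> = (\<Sum>X\<in>Pow {..<2 * r}. ?c / (2 ^ r * fact r) * ((-1) ^ card X * inner (?A X) (?A X) ^ r))"
    unfolding integral_sphere_power(2)[OF N A'] sum_divide_distrib
    by (intro sum.cong refl) (simp add: mult_ac)
  also have "\<dots> = ?c / (2 ^ r * fact r) * (\<Sum>X\<in>Pow {..<2 * r}. (-1) ^ card X * inner (?A X) (?A X) ^ r)"
    by (rule sum_distrib_left[symmetric])
  also have "\<dots> = ?c / (2 ^ r * fact r) *
      (\<Sum>\<tau> | \<tau> permutes {..<2 * r}. \<Prod>s<r. inner (A (\<tau> (2 * s))) (A (\<tau> (2 * s + 1))))"
    by (simp only: inner_pairs_polarization)
  finally show "(\<integral>\<nu>. (\<Prod>i<2 * r. inner (A i) \<nu>) \<partial>sphere_measure N) = \<dots>" .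
qed

text \<open>Wick's formula applies to each Leibniz term \<open>\<sigma>\<close>, with a pairing
  permutation \<open>\<tau>\<close>. Substituting \<open>\<rho>\<close> for
  \<open>\<sigma> \<circ> \<tau>\<close> makes the two permutations independent, which is the form
  that the Pfaffian takes.\<close>

lemma integral_sphere_det:
  fixes N :: "'a::euclidean_space set" and h :: "nat \<Rightarrow> nat \<Rightarrow> 'a"
  assumes N: "subspace N" "0 < dim N" and h: "\<And>i j. i < 2 * r \<Longrightarrow> j < 2 * r \<Longrightarrow> h i j \<in> N"
  shows "(\<integral>\<nu>. det_of (2 * r) (\<lambda>i j. inner (h i j) \<nu>) \<partial>sphere_measure N)
    = sphere_vol (dim N + 2 * r - 1) / (2 * pi) ^ r / (2 ^ r * fact r) *
      (\<Sum>\<tau> | \<tau> permutes {..<2 * r}. \<Sum>\<rho> | \<rho> permutes {..<2 * r}. of_int (sign \<tau>) * of_int (sign \<rho>) *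
        (\<Prod>s<r. inner (h (\<rho> (2 * s)) (\<tau> (2 * s))) (h (\<rho> (2 * s + 1)) (\<tau> (2 * s + 1)))))"
proof -
  let ?P = "{\<tau>. \<tau> permutes {..<2 * r}}"
  let ?c = "sphere_vol (dim N + 2 * r - 1) / (2 * pi) ^ r / (2 ^ r * fact r)"
  let ?w = "\<lambda>\<tau> \<rho>. \<Prod>s<r. inner (h (\<rho> (2 * s)) (\<tau> (2 * s))) (h (\<rho> (2 * s + 1)) (\<tau> (2 * s + 1)))"
  have hN: "h i (\<sigma> i) \<in> N" if "\<sigma> \<in> ?P" "i < 2 * r" for \<sigma> i
    using h that permutes_in_image[of \<sigma> "{..<2 * r}" i] by simp
  have "(\<integral>\<nu>. det_of (2 * r) (\<lambda>i j. inner (h i j) \<nu>) \<partial>sphere_measure N)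
    = (\<Sum>\<sigma>\<in>?P. of_int (sign \<sigma>) * (\<integral>\<nu>. (\<Prod>i<2 * r. inner (h i (\<sigma> i)) \<nu>) \<partial>sphere_measure N))"
    unfolding det_of_sum
    by (subst Bochner_Integration.integral_sum) (intro integrable_mult_right integral_sphere_prod(1)[OF N] hN, simp_all)
  also have "\<dots> = (\<Sum>\<sigma>\<in>?P. \<Sum>\<tau>\<in>?P. ?c * (of_int (sign \<sigma>) * ?w (\<sigma> \<circ> \<tau>) \<tau>))"
  proof (rule sum.cong[OF refl])
    fix \<sigma> assume "\<sigma> \<in> ?P"
    then show "of_int (sign \<sigma>) * (\<integral>\<nu>. (\<Prod>i<2 * r. inner (h i (\<sigma> i)) \<nu>) \<partial>sphere_measure N)
        = (\<Sum>\<tau>\<in>?P. ?c * (of_int (sign \<sigma>) * ?w (\<sigma> \<circ> \<tau>) \<tau>))"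
      by (subst integral_sphere_prod(2)[OF N hN]) (simp_all add: sum_distrib_left mult_ac)
  qed
  \<comment> \<open>Signs square to 1, so the sign of \<open>\<sigma>\<close> is the product of
    those of \<open>\<tau>\<close> and \<open>\<sigma> \<circ> \<tau>\<close>.\<close>
  also have "\<dots> = (\<Sum>\<tau>\<in>?P. \<Sum>\<sigma>\<in>?P. ?c * (of_int (sign \<tau>) * of_int (sign (\<sigma> \<circ> \<tau>)) * ?w (\<sigma> \<circ> \<tau>) \<tau>))"
  proof (subst sum.swap, intro sum.cong refl)
    fix \<tau> \<sigma> :: "nat \<Rightarrow> nat" assume "\<tau> \<in> ?P" "\<sigma> \<in> ?P"
    then have "sign (\<sigma> \<circ> \<tau>) = sign \<sigma> * sign \<tau>"
      by (intro sign_compose) (auto simp: permutation_permutes)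
    moreover have "of_int (sign \<tau>) * (of_int (sign \<sigma>) * of_int (sign \<tau>)) = (of_int (sign \<sigma>) :: real)"
      by (simp add: sign_def)
    ultimately show "?c * (of_int (sign \<sigma>) * ?w (\<sigma> \<circ> \<tau>) \<tau>)
        = ?c * (of_int (sign \<tau>) * of_int (sign (\<sigma> \<circ> \<tau>)) * ?w (\<sigma> \<circ> \<tau>) \<tau>)"
      by simp
  qed
  also have "\<dots> = (\<Sum>\<tau>\<in>?P. \<Sum>\<rho>\<in>?P. ?c * (of_int (sign \<tau>) * of_int (sign \<rho>) * ?w \<rho> \<tau>))"
    by (intro sum.cong refl sum_permutations_compose_right[symmetric]) simp
  also have "\<dots> = ?c * (\<Sum>\<tau>\<in>?P. \<Sum>\<rho>\<in>?P. of_int (sign \<rho>) * of_int (sign \<tau>) * ?w \<rho> \<tau>)"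
    by (simp add: sum_distrib_left mult_ac)
  also have "(\<Sum>\<tau>\<in>?P. \<Sum>\<rho>\<in>?P. of_int (sign \<rho>) * of_int (sign \<tau>) * ?w \<rho> \<tau>)
      = (\<Sum>\<tau>\<in>?P. \<Sum>\<rho>\<in>?P. of_int (sign \<tau>) * of_int (sign \<rho>) * ?w \<tau> \<rho>)"
    by (rule sum.swap)
  finally show ?thesis .
qed

section \<open>Smooth maps\<close>

lemma C_n_on_cong:
  fixes f g :: "'a::real_normed_vector \<Rightarrow> 'b::real_normed_vector"
  assumes "open U"
  shows "(\<And>x. x \<in> U \<Longrightarrow> f x = g x) \<Longrightarrow> C_n_on n U f \<Longrightarrow> C_n_on n U g"
proof (induction n arbitrary: f g)
  case 0
  then show ?case by (simp cong: continuous_on_cong)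
next
  case (Suc n)
  have der: "(g has_derivative frechet_derivative f (at x)) (at x)" if "x \<in> U" for x
  proof (rule has_derivative_transform_within_open[OF _ assms that])
    show "(f has_derivative frechet_derivative f (at x)) (at x)"
      using Suc.prems(2) that by (simp add: frechet_derivative_works)
  qed (use Suc.prems(1) in simp)
  then have eq: "frechet_derivative g (at x) = frechet_derivative f (at x)" if "x \<in> U" for x
    using frechet_derivative_at that by metis
  show ?case
    unfolding C_n_on.simps
  proof (intro conjI allI ballI)
    show "g differentiable (at x)" if "x \<in> U" for x using der[OF that] by (auto simp: differentiable_def)
    show "C_n_on n U (\<lambda>x. frechet_derivative g (at x) v)" for v
      by (rule Suc.IH[of "\<lambda>x. frechet_derivative f (at x) v"]) (use Suc.prems(2) eq in simp_all)
  qed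
qed

text \<open>Lets the closure properties below give derivatives by explicit formulas rather than
  through \<open>frechet_derivative\<close>.\<close>

lemma C_n_on_SucI:
  assumes "open U"
    and "\<And>x. x \<in> U \<Longrightarrow> (f has_derivative f' x) (at x)"
    and "\<And>v. C_n_on n U (\<lambda>x. f' x v)"
  shows "C_n_on (Suc n) U f"
  unfolding C_n_on.simps
proof (intro conjI allI ballI)
  show "f differentiable (at x)" if "x \<in> U" for x using assms(2)[OF that] by (auto simp: differentiable_def)
  have "frechet_derivative f (at x) = f' x" if "x \<in> U" for x
    using frechet_derivative_at[OF assms(2)[OF that]] by simp
  then show "C_n_on n U (\<lambda>x. frechet_derivative f (at x) v)" for v
    by (intro C_n_on_cong[OF assms(1) _ assms(3)[of v]]) simp
qed

lemma C_n_on_Suc_has_derivative: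
  "C_n_on (Suc n) U f \<Longrightarrow> x \<in> U \<Longrightarrow> (f has_derivative frechet_derivative f (at x)) (at x)"
  by (simp add: frechet_derivative_works)

lemma C_n_on_SucD: "C_n_on (Suc n) U f \<Longrightarrow> C_n_on n U f"
proof (induction n arbitrary: f)
  case 0
  then show ?case by (auto intro!: continuous_at_imp_continuous_on differentiable_imp_continuous_within)
next
  case (Suc n)
  then show ?case by (metis C_n_on.simps(2))
qed

lemma C_n_on_subset: "C_n_on n U f \<Longrightarrow> V \<subseteq> U \<Longrightarrow> C_n_on n V f"
  by (induction n arbitrary: f) (auto intro: continuous_on_subset)

lemma C_n_on_const: "C_n_on n U (\<lambda>x. c)"
proof (induction n arbitrary: c)
  case (Suc n)
  then show ?case by (simp add: frechet_derivative_const)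
qed simp

lemma C_n_on_add:
  assumes "open U"
  shows "C_n_on n U f \<Longrightarrow> C_n_on n U g \<Longrightarrow> C_n_on n U (\<lambda>x. f x + g x)"
proof (induction n arbitrary: f g)
  case (Suc n)
  show ?case
  proof (rule C_n_on_SucI[OF assms])
    show "((\<lambda>x. f x + g x) has_derivative (\<lambda>v. frechet_derivative f (at x) v + frechet_derivative g (at x) v)) (at x)"
      if "x \<in> U" for x
      using Suc.prems that by (intro has_derivative_add C_n_on_Suc_has_derivative)
  qed (use Suc in simp)
qed (auto intro: continuous_intros)

lemma C_n_on_bounded_linear:
  assumes "open U" "bounded_linear L"
  shows "C_n_on n U f \<Longrightarrow> C_n_on n U (\<lambda>x. L (f x))"
proof (induction n arbitrary: f)
  case 0
  then show ?case by (simp add: bounded_linear.continuous_on[OF assms(2)])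
next
  case (Suc n)
  show ?case
  proof (rule C_n_on_SucI[OF assms(1)])
    show "((\<lambda>x. L (f x)) has_derivative (\<lambda>v. L (frechet_derivative f (at x) v))) (at x)" if "x \<in> U" for x
      using Suc.prems that by (intro bounded_linear.has_derivative[OF assms(2)] C_n_on_Suc_has_derivative)
  qed (use Suc in simp)
qed

lemma C_n_on_bilinear:
  assumes "open U" "bounded_bilinear B"
  shows "C_n_on n U f \<Longrightarrow> C_n_on n U g \<Longrightarrow> C_n_on n U (\<lambda>x. B (f x) (g x))"
proof (induction n arbitrary: f g)
  case 0
  then show ?case by (simp add: bounded_bilinear.continuous_on[OF assms(2)])
next
  case (Suc n)
  show ?case
  proof (rule C_n_on_SucI[OF assms(1)])
    show "((\<lambda>x. B (f x) (g x)) has_derivative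
        (\<lambda>v. B (f x) (frechet_derivative g (at x) v) + B (frechet_derivative f (at x) v) (g x))) (at x)"
      if "x \<in> U" for x
      using Suc.prems that by (intro bounded_bilinear.FDERIV[OF assms(2)] C_n_on_Suc_has_derivative)
    show "C_n_on n U (\<lambda>x. B (f x) (frechet_derivative g (at x) v) + B (frechet_derivative f (at x) v) (g x))" for v
      using Suc.prems C_n_on_SucD[OF Suc.prems(1)] C_n_on_SucD[OF Suc.prems(2)]
      by (intro C_n_on_add[OF assms(1)] Suc.IH) simp_all
  qed
qed

lemma C_n_on_inverse:
  fixes f :: "'a::real_normed_vector \<Rightarrow> real"
  assumes "open U" "\<And>x. x \<in> U \<Longrightarrow> f x \<noteq> 0"
  shows "C_n_on n U f \<Longrightarrow> C_n_on n U (\<lambda>x. inverse (f x))"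
proof (induction n)
  case 0
  then show ?case using assms(2) by (auto intro: continuous_on_inverse)
next
  case (Suc n)
  have inv: "C_n_on n U (\<lambda>x. inverse (f x))" by (rule Suc.IH[OF C_n_on_SucD[OF Suc.prems]])
  show ?case
  proof (rule C_n_on_SucI[OF assms(1)])
    show "((\<lambda>x. inverse (f x)) has_derivative
        (\<lambda>v. - (inverse (f x) * frechet_derivative f (at x) v * inverse (f x)))) (at x)" if "x \<in> U" for x
      using Suc.prems that assms(2) by (intro Deriv.has_derivative_inverse C_n_on_Suc_has_derivative)
    show "C_n_on n U (\<lambda>x. - (inverse (f x) * frechet_derivative f (at x) v * inverse (f x)))" for v
      using Suc.prems inv
      by (intro C_n_on_bounded_linear[OF assms(1) bounded_linear_minus[OF bounded_linear_ident]]
          C_n_on_bilinear[OF assms(1) bounded_bilinear_mult]) simp_all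
  qed
qed

lemma smooth_on_subset: "smooth_on U f \<Longrightarrow> V \<subseteq> U \<Longrightarrow> smooth_on V f"
  unfolding smooth_on_def using C_n_on_subset by blast

lemma smooth_on_const: "smooth_on U (\<lambda>x. c)"
  by (simp add: smooth_on_def C_n_on_const)

lemma smooth_on_add: "open U \<Longrightarrow> smooth_on U f \<Longrightarrow> smooth_on U g \<Longrightarrow> smooth_on U (\<lambda>x. f x + g x)"
  by (simp add: smooth_on_def C_n_on_add)

lemma smooth_on_bounded_linear:
  "open U \<Longrightarrow> bounded_linear L \<Longrightarrow> smooth_on U f \<Longrightarrow> smooth_on U (\<lambda>x. L (f x))"
  by (simp add: smooth_on_def C_n_on_bounded_linear)

lemma smooth_on_bilinear:
  "open U \<Longrightarrow> bounded_bilinear B \<Longrightarrow> smooth_on U f \<Longrightarrow> smooth_on U g \<Longrightarrow> smooth_on U (\<lambda>x. B (f x) (g x))"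
  by (simp add: smooth_on_def C_n_on_bilinear)

lemma smooth_on_inverse:
  fixes f :: "'a::real_normed_vector \<Rightarrow> real"
  shows "open U \<Longrightarrow> (\<And>x. x \<in> U \<Longrightarrow> f x \<noteq> 0) \<Longrightarrow> smooth_on U f \<Longrightarrow> smooth_on U (\<lambda>x. inverse (f x))"
  by (simp add: smooth_on_def C_n_on_inverse)

lemma smooth_on_diff:
  assumes "open U" "smooth_on U f" "smooth_on U g"
  shows "smooth_on U (\<lambda>x. f x - g x)"
  using smooth_on_add[OF assms(1,2) smooth_on_bounded_linear[OF assms(1) bounded_linear_minus[OF bounded_linear_ident] assms(3)]]
  by simp

lemma smooth_on_sum:
  assumes "open U" "finite I" "\<And>i. i \<in> I \<Longrightarrow> smooth_on U (f i)"
  shows "smooth_on U (\<lambda>x. \<Sum>i\<in>I. f i x)"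
  using assms(2,3) by (induction I rule: finite_induct) (auto intro: smooth_on_const smooth_on_add[OF assms(1)])

lemma smooth_on_has_derivative:
  "smooth_on U f \<Longrightarrow> x \<in> U \<Longrightarrow> (f has_derivative frechet_derivative f (at x)) (at x)"
  unfolding smooth_on_def using C_n_on_Suc_has_derivative by blast

lemma smooth_on_frechet_derivative:
  "smooth_on U f \<Longrightarrow> smooth_on U (\<lambda>x. frechet_derivative f (at x) v)"
  unfolding smooth_on_def by (metis C_n_on.simps(2))

lemma smooth_on_continuous_on: "smooth_on U f \<Longrightarrow> continuous_on U f"
  unfolding smooth_on_def by (metis C_n_on.simps(1))

section \<open>Symmetry of second derivatives\<close>

text \<open>The mean value theorem, once along \<open>u\<close> and once along \<open>v\<close>. The
  second difference is symmetric in \<open>u\<close> and \<open>v\<close>, while the mixed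
  derivative on the right carries a definite order.\<close>

lemma second_difference:
  fixes f :: "'a::real_normed_vector \<Rightarrow> real"
  assumes f: "smooth_on U f" and h: "0 < h"
    and U: "\<And>s t. 0 \<le> s \<Longrightarrow> s \<le> h \<Longrightarrow> 0 \<le> t \<Longrightarrow> t \<le> h \<Longrightarrow> p + s *\<^sub>R u + t *\<^sub>R v \<in> U"
  obtains s t where "0 < s" "s < h" "0 < t" "t < h"
    "f (p + h *\<^sub>R u + h *\<^sub>R v) - f (p + h *\<^sub>R u) - f (p + h *\<^sub>R v) + f p
      = h\<^sup>2 * frechet_derivative (\<lambda>x. frechet_derivative f (at x) u) (at (p + s *\<^sub>R u + t *\<^sub>R v)) v"
proof -
  let ?D = "\<lambda>x. frechet_derivative f (at x) u"
  have lin: "frechet_derivative g (at x) (c *\<^sub>R w) = c * frechet_derivative g (at x) w"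
    if "smooth_on U g" "x \<in> U" for g :: "'a \<Rightarrow> real" and x w c
    using linear_scale[OF has_derivative_linear[OF smooth_on_has_derivative[OF that]], of c w] by simp
  have der_u: "((\<lambda>s. f (p + s *\<^sub>R u + t *\<^sub>R v)) has_real_derivative ?D (p + s *\<^sub>R u + t *\<^sub>R v)) (at s)"
    if "0 \<le> s" "s \<le> h" "0 \<le> t" "t \<le> h" for s t
  proof -
    have "((\<lambda>s. f (p + s *\<^sub>R u + t *\<^sub>R v)) has_derivative
        (\<lambda>c. frechet_derivative f (at (p + s *\<^sub>R u + t *\<^sub>R v)) (c *\<^sub>R u))) (at s)"
      by (rule has_derivative_compose[where f = "\<lambda>s. p + s *\<^sub>R u + t *\<^sub>R v" and x = s and g = f,
            OF _ smooth_on_has_derivative[OF f U[OF that]]])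
        (auto intro!: derivative_eq_intros)
    then show ?thesis
      unfolding has_field_derivative_def
      by (rule has_derivative_eq_rhs) (simp add: lin[OF f U[OF that]] fun_eq_iff mult.commute)
  qed
  have D: "smooth_on U ?D" by (rule smooth_on_frechet_derivative[OF f])
  have der_v: "((\<lambda>t. ?D (p + s *\<^sub>R u + t *\<^sub>R v)) has_real_derivative frechet_derivative ?D (at (p + s *\<^sub>R u + t *\<^sub>R v)) v) (at t)"
    if "0 \<le> s" "s \<le> h" "0 \<le> t" "t \<le> h" for s t
  proof -
    have "((\<lambda>t. ?D (p + s *\<^sub>R u + t *\<^sub>R v)) has_derivative
        (\<lambda>c. frechet_derivative ?D (at (p + s *\<^sub>R u + t *\<^sub>R v)) (c *\<^sub>R v))) (at t)"
      by (rule has_derivative_compose[where f = "\<lambda>t. p + s *\<^sub>R u + t *\<^sub>R v" and x = t and g = ?D,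
            OF _ smooth_on_has_derivative[OF D U[OF that]]])
        (auto intro!: derivative_eq_intros)
    then show ?thesis
      unfolding has_field_derivative_def
      by (rule has_derivative_eq_rhs) (simp add: lin[OF D U[OF that]] fun_eq_iff mult.commute)
  qed
  have "\<exists>s. 0 < s \<and> s < h \<and>
      (f (p + h *\<^sub>R u + h *\<^sub>R v) - f (p + h *\<^sub>R u + 0 *\<^sub>R v)) - (f (p + 0 *\<^sub>R u + h *\<^sub>R v) - f (p + 0 *\<^sub>R u + 0 *\<^sub>R v))
      = (h - 0) * (?D (p + s *\<^sub>R u + h *\<^sub>R v) - ?D (p + s *\<^sub>R u + 0 *\<^sub>R v))"
    by (rule MVT2[OF h], rule DERIV_diff; rule der_u) (use h in simp_all)
  then obtain s where s: "0 < s" "s < h" and 1: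
    "(f (p + h *\<^sub>R u + h *\<^sub>R v) - f (p + h *\<^sub>R u + 0 *\<^sub>R v)) - (f (p + 0 *\<^sub>R u + h *\<^sub>R v) - f (p + 0 *\<^sub>R u + 0 *\<^sub>R v))
      = (h - 0) * (?D (p + s *\<^sub>R u + h *\<^sub>R v) - ?D (p + s *\<^sub>R u + 0 *\<^sub>R v))" by blast
  have "\<exists>t. 0 < t \<and> t < h \<and> ?D (p + s *\<^sub>R u + h *\<^sub>R v) - ?D (p + s *\<^sub>R u + 0 *\<^sub>R v)
      = (h - 0) * frechet_derivative ?D (at (p + s *\<^sub>R u + t *\<^sub>R v)) v"
    by (rule MVT2[OF h], rule der_v) (use s in simp_all)
  then obtain t where t: "0 < t" "t < h" and 2: "?D (p + s *\<^sub>R u + h *\<^sub>R v) - ?D (p + s *\<^sub>R u + 0 *\<^sub>R v)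
      = (h - 0) * frechet_derivative ?D (at (p + s *\<^sub>R u + t *\<^sub>R v)) v" by blast
  from 1[unfolded 2] show ?thesis
    by (intro that[OF s t]) (simp add: power2_eq_square)
qed

lemma second_derivative_symmetric_real:
  fixes f :: "'a::real_normed_vector \<Rightarrow> real"
  assumes "open U" "p \<in> U" and f: "smooth_on U f"
  shows "frechet_derivative (\<lambda>x. frechet_derivative f (at x) u) (at p) v
    = frechet_derivative (\<lambda>x. frechet_derivative f (at x) v) (at p) u"
proof (rule ccontr)
  let ?H = "\<lambda>u v q. frechet_derivative (\<lambda>x. frechet_derivative f (at x) u) (at q) v"
  assume ne: "?H u v p \<noteq> ?H v u p"
  \<comment> \<open>Half of the supposed gap: two errors below \<open>e\<close> cannot bridge
    it.\<close>
  define e where "e = \<bar>?H u v p - ?H v u p\<bar> / 2"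
  have e: "0 < e" using ne by (simp add: e_def)
  have cont: "isCont (?H a b) p" for a b
    using smooth_on_continuous_on[OF smooth_on_frechet_derivative[OF smooth_on_frechet_derivative[OF f]]] assms(1,2)
    by (simp add: continuous_on_eq_continuous_at)
  have ev: "\<forall>\<^sub>F q in nhds p. dist (?H a b q) (?H a b p) < e" for a b
  proof -
    have "(?H a b \<longlongrightarrow> ?H a b p) (nhds p)"
      using cont[of a b] tendsto_at_iff_tendsto_nhds[of "?H a b" p] unfolding isCont_def by simp
    then show ?thesis using e by (rule tendstoD)
  qed
  have "\<forall>\<^sub>F q in nhds p. q \<in> U \<and> dist (?H u v q) (?H u v p) < e \<and> dist (?H v u q) (?H v u p) < e"
    by (intro eventually_conj eventually_nhds_in_open assms(1,2) ev)
  then obtain d where d: "0 < d" "\<And>q. dist q p < d \<Longrightarrow> q \<in> U \<and> dist (?H u v q) (?H u v p) < e \<and> dist (?H v u q) (?H v u p) < e"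
    unfolding eventually_nhds_metric by blast
  \<comment> \<open>The summand 1 keeps \<open>C\<close> positive. With
    \<open>h = d / (2 * C)\<close> the whole parallelogram of sides \<open>h *\<^sub>R u\<close> and
    \<open>h *\<^sub>R v\<close> lies within distance \<open>d\<close> of \<open>p\<close>.\<close>
  define C where "C = norm u + norm v + 1"
  have C: "0 < C" by (simp add: C_def add_nonneg_pos)
  define h where "h = d / (2 * C)"
  have h: "0 < h" using d C by (simp add: h_def)
  have near: "dist (p + s *\<^sub>R u + t *\<^sub>R v) p < d" if "0 \<le> s" "s \<le> h" "0 \<le> t" "t \<le> h" for s t
  proof -
    have "dist (p + s *\<^sub>R u + t *\<^sub>R v) p = norm (s *\<^sub>R u + t *\<^sub>R v)" by (simp add: dist_norm)
    also have "\<dots> \<le> norm (s *\<^sub>R u) + norm (t *\<^sub>R v)" by (rule norm_triangle_ineq)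
    also have "\<dots> \<le> h * norm u + h * norm v" using that by (simp add: add_mono mult_right_mono)
    also have "\<dots> \<le> h * C" using h by (simp add: C_def algebra_simps)
    also have "\<dots> = d / 2" using C by (simp add: h_def)
    also have "\<dots> < d" using d by simp
    finally show ?thesis .
  qed
  have in_U: "p + s *\<^sub>R u + t *\<^sub>R v \<in> U" if "0 \<le> s" "s \<le> h" "0 \<le> t" "t \<le> h" for s t
    using d(2)[OF near[OF that]] by blast
  have in_U': "p + s *\<^sub>R v + t *\<^sub>R u \<in> U" if "0 \<le> s" "s \<le> h" "0 \<le> t" "t \<le> h" for s t
    using in_U[OF that(3,4,1,2)] by (simp add: add_ac)
  obtain s t where st: "0 < s" "s < h" "0 < t" "t < h" and
    1: "f (p + h *\<^sub>R u + h *\<^sub>R v) - f (p + h *\<^sub>R u) - f (p + h *\<^sub>R v) + f p = h\<^sup>2 * ?H u v (p + s *\<^sub>R u + t *\<^sub>R v)"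
    by (rule second_difference[OF f h in_U])
  obtain s' t' where st': "0 < s'" "s' < h" "0 < t'" "t' < h" and
    2: "f (p + h *\<^sub>R v + h *\<^sub>R u) - f (p + h *\<^sub>R v) - f (p + h *\<^sub>R u) + f p = h\<^sup>2 * ?H v u (p + s' *\<^sub>R v + t' *\<^sub>R u)"
    by (rule second_difference[OF f h in_U'])
  have "h\<^sup>2 * ?H u v (p + s *\<^sub>R u + t *\<^sub>R v) = h\<^sup>2 * ?H v u (p + s' *\<^sub>R v + t' *\<^sub>R u)"
    using 1 2 by (simp add: algebra_simps)
  then have "?H u v (p + s *\<^sub>R u + t *\<^sub>R v) = ?H v u (p + t' *\<^sub>R u + s' *\<^sub>R v)"
    using h by (simp add: algebra_simps)
  moreover have "dist (?H u v (p + s *\<^sub>R u + t *\<^sub>R v)) (?H u v p) < e"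
    using d(2)[OF near] st by simp
  moreover have "dist (?H v u (p + t' *\<^sub>R u + s' *\<^sub>R v)) (?H v u p) < e"
    using d(2)[OF near] st' by simp
  moreover have "dist (?H u v p) (?H v u p) = e + e" by (simp add: e_def dist_real_def)
  ultimately show False
    using dist_triangle3[of "?H u v p" "?H v u p" "?H u v (p + s *\<^sub>R u + t *\<^sub>R v)"] by simp
qed

text \<open>Tested on components, because the mean value theorem is about real-valued
  functions.\<close>

lemma second_derivative_symmetric:
  fixes f :: "'a::real_normed_vector \<Rightarrow> 'b::euclidean_space"
  assumes U: "open U" "p \<in> U" and f: "smooth_on U f"
  shows "frechet_derivative (\<lambda>x. frechet_derivative f (at x) u) (at p) v
    = frechet_derivative (\<lambda>x. frechet_derivative f (at x) v) (at p) u"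
proof (rule euclidean_eqI)
  fix b :: 'b
  let ?g = "\<lambda>x. inner (f x) b"
  have bl: "bounded_linear (\<lambda>y. inner y b)" by (rule bounded_linear_inner_left)
  have g: "smooth_on U ?g" by (rule smooth_on_bounded_linear[OF U(1) bl f])
  have der: "frechet_derivative (\<lambda>x. inner (k x) b) (at x) w = inner (frechet_derivative k (at x) w) b"
    if "smooth_on U k" "x \<in> U" for k :: "'a \<Rightarrow> 'b" and x w
    using bounded_linear.has_derivative[OF bl smooth_on_has_derivative[OF that]] frechet_derivative_at by metis
  have "inner (frechet_derivative (\<lambda>x. frechet_derivative f (at x) u) (at p) v) b
      = frechet_derivative (\<lambda>x. frechet_derivative ?g (at x) u) (at p) v" for u v
  proof -
    have "inner (frechet_derivative (\<lambda>x. frechet_derivative f (at x) u) (at p) v) b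
      = frechet_derivative (\<lambda>x. inner (frechet_derivative f (at x) u) b) (at p) v"
      using der[OF smooth_on_frechet_derivative[OF f] U(2)] by simp
    also have "\<dots> = frechet_derivative (\<lambda>x. frechet_derivative ?g (at x) u) (at p) v"
    proof -
      have "((\<lambda>x. inner (frechet_derivative f (at x) u) b) has_derivative
          frechet_derivative (\<lambda>x. frechet_derivative ?g (at x) u) (at p)) (at p)"
        by (rule has_derivative_transform_within_open[OF
              smooth_on_has_derivative[OF smooth_on_frechet_derivative[OF g] U(2)] U]) (simp add: der[OF f])
      then show ?thesis using frechet_derivative_at by metis
    qed
    finally show ?thesis .
  qed
  then show "inner (frechet_derivative (\<lambda>x. frechet_derivative f (at x) u) (at p) v) b
      = inner (frechet_derivative (\<lambda>x. frechet_derivative f (at x) v) (at p) u) b"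
    using second_derivative_symmetric_real[OF U g] by simp
qed

section \<open>Submanifolds\<close>

text \<open>Gram--Schmidt without normalization. Where the rejected vector vanishes the coefficient is the
  junk value \<open>x / 0 = 0\<close>, which is harmless.\<close>

primrec reject :: "(nat \<Rightarrow> 'b \<Rightarrow> 'a::real_inner) \<Rightarrow> nat \<Rightarrow> ('b \<Rightarrow> 'a) \<Rightarrow> 'b \<Rightarrow> 'a" where
  "reject \<nu> 0 Y q = Y q"
| "reject \<nu> (Suc l) Y q = reject \<nu> l Y q -
     (inner (reject \<nu> l Y q) (reject \<nu> l (\<nu> l) q) / inner (reject \<nu> l (\<nu> l) q) (reject \<nu> l (\<nu> l) q))
       *\<^sub>R reject \<nu> l (\<nu> l) q"

lemma diff_reject_in_span: "Y q - reject \<nu> l Y q \<in> span ((\<lambda>i. \<nu> i q) ` {..<l})"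
proof (induction l arbitrary: Y)
  case (Suc l)
  let ?S = "span ((\<lambda>i. \<nu> i q) ` {..<Suc l})"
  have mono: "span ((\<lambda>i. \<nu> i q) ` {..<l}) \<subseteq> ?S" by (intro span_mono) auto
  have "\<nu> l q \<in> ?S" by (intro span_base) auto
  then have w: "reject \<nu> l (\<nu> l) q \<in> ?S"
    using Suc.IH[of "\<nu> l"] mono span_diff[of "\<nu> l q" _ "\<nu> l q - reject \<nu> l (\<nu> l) q"] by auto
  have "Y q - reject \<nu> l Y q \<in> ?S" using Suc.IH[of Y] mono by auto
  then have "(Y q - reject \<nu> l Y q) + c *\<^sub>R reject \<nu> l (\<nu> l) q \<in> ?S" for c
    using w by (intro span_add span_scale)
  then show ?case by (simp add: diff_diff_eq2 diff_add_eq)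
qed (simp add: span_zero)

lemma inner_eq_0_span:
  assumes "\<And>x. x \<in> S \<Longrightarrow> inner y x = 0" "x \<in> span S"
  shows "inner y x = (0::real)"
  using assms(2) by (induction rule: span_induct_alt) (auto simp: assms(1) inner_add_right)

text \<open>The new direction splits into its rejected part, to which the remainder is orthogonal by
  construction (trivially if that part is zero), and a combination of earlier directions, covered by
  induction.\<close>

lemma inner_reject: "i < l \<Longrightarrow> inner (reject \<nu> l Y q) (\<nu> i q) = 0"
proof (induction l arbitrary: Y i)
  case (Suc l)
  let ?w = "reject \<nu> l (\<nu> l) q"
  let ?R = "reject \<nu> (Suc l) Y q"
  have below: "inner ?R (\<nu> i q) = 0" if "i < l" for i
    using Suc.IH[OF that, of Y] Suc.IH[OF that, of "\<nu> l"] by (simp add: inner_diff_left)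
  have "inner ?R (\<nu> l q - ?w) = 0"
    by (rule inner_eq_0_span[OF _ diff_reject_in_span]) (auto simp del: reject.simps intro: below)
  moreover have "inner ?R ?w = 0" by (cases "?w = 0") (simp_all add: inner_diff_left)
  ultimately have "inner ?R (\<nu> l q) = 0" by (simp add: inner_diff_right)
  then show ?case using below Suc.prems by (cases "i = l") auto
qed simp

lemma smooth_on_reject:
  assumes U: "open U" and \<nu>: "\<And>i. i < l \<Longrightarrow> smooth_on U (\<nu> i)"
    and indep: "\<And>i q. i < l \<Longrightarrow> q \<in> U \<Longrightarrow> \<nu> i q \<notin> span ((\<lambda>j. \<nu> j q) ` {..<i})"
  shows "smooth_on U Y \<Longrightarrow> smooth_on U (reject \<nu> l Y)"
  using \<nu> indep
proof (induction l arbitrary: Y)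
  case (Suc l)
  have Y: "smooth_on U (reject \<nu> l Y)" and w: "smooth_on U (reject \<nu> l (\<nu> l))"
    using Suc by auto
  \<comment> \<open>If the rejected vector vanished, \<open>\<nu> l q\<close> would lie in the span
    of its predecessors. So the division in \<open>reject\<close> is a smooth one.\<close>
  have "inner (reject \<nu> l (\<nu> l) q) (reject \<nu> l (\<nu> l) q) \<noteq> 0" if "q \<in> U" for q
    using Suc.prems(3)[of l q] diff_reject_in_span[of "\<nu> l" q \<nu> l] that by auto
  moreover have "reject \<nu> (Suc l) Y = (\<lambda>q. reject \<nu> l Y q -
      (inner (reject \<nu> l Y q) (reject \<nu> l (\<nu> l) q) * inverse (inner (reject \<nu> l (\<nu> l) q) (reject \<nu> l (\<nu> l) q)))
       *\<^sub>R reject \<nu> l (\<nu> l) q)"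
    by (rule ext) (simp add: divide_inverse)
  ultimately show ?case
    using smooth_on_diff[OF U Y smooth_on_bilinear[OF U bounded_bilinear_scaleR
          smooth_on_bilinear[OF U bounded_bilinear_mult
            smooth_on_bilinear[OF U bounded_bilinear_inner Y w]
            smooth_on_inverse[OF U _ smooth_on_bilinear[OF U bounded_bilinear_inner w w]]] w]]
    by simp
next
  case 0
  have "reject \<nu> 0 Y = Y" by (rule ext) simp
  then show ?case using 0 by simp
qed

text \<open>Along a curve in \<open>M\<close> with velocity \<open>v\<close>, the chain rule turns
  any derivative within \<open>M\<close> into an ordinary derivative at 0 of a function of one
  variable, which is unique.\<close>

lemma tangent_vector_derivative:
  assumes v: "v \<in> tangent_space M p" and F: "(f has_derivative F) (at p within M)"
    and G: "(f has_derivative G) (at p within M)"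
  shows "F v = G v"
proof -
  obtain \<gamma> :: "real \<Rightarrow> 'a" and \<epsilon> where \<gamma>: "0 < \<epsilon>" "\<gamma> ` {-\<epsilon><..<\<epsilon>} \<subseteq> M" "\<gamma> 0 = p"
    "(\<gamma> has_vector_derivative v) (at 0)"
    using v by (auto simp: tangent_space_def)
  have at0: "at 0 within {-\<epsilon><..<\<epsilon>} = (at 0 :: real filter)" using \<gamma>(1) by (intro at_within_open) auto
  have "((\<lambda>t. f (\<gamma> t)) has_derivative (\<lambda>t. H (t *\<^sub>R v))) (at 0)" if "(f has_derivative H) (at p within M)" for H
  proof -
    have "(f has_derivative H) (at (\<gamma> 0) within \<gamma> ` {-\<epsilon><..<\<epsilon>})"
      using that \<gamma>(2,3) by (auto intro: has_derivative_subset)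
    then show ?thesis
      using has_derivative_in_compose[of \<gamma> "\<lambda>t. t *\<^sub>R v" 0 "{-\<epsilon><..<\<epsilon>}" f H] \<gamma>(4)
      unfolding has_vector_derivative_def at0 by simp
  qed
  from has_derivative_unique[OF this[OF F] this[OF G]] show ?thesis
    by (metis scaleR_one)
qed

lemma dir_deriv_eq:
  assumes "v \<in> tangent_space M p" "(f has_derivative F) (at p within M)"
  shows "dir_deriv M v f p = F v"
proof -
  have "f differentiable (at p within M)" using assms(2) by (auto simp: differentiable_def)
  then have "(f has_derivative frechet_derivative f (at p within M)) (at p within M)"
    by (simp add: frechet_derivative_works)
  then show ?thesis unfolding dir_deriv_def by (rule tangent_vector_derivative[OF assms(1) _ assms(2)])
qed

text \<open>The frame consists of the gradients of those components of the chart that vanish on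
  \<open>M\<close>. The last property bounds the common kernel from above; with
  \<open>m\<close>-dimensional tangent spaces it forces the kernel to be the tangent space.\<close>

lemma submanifold_normal_frame:
  fixes M :: "'a::euclidean_space set"
  assumes M: "submanifold m M" and p: "p \<in> M"
  obtains U and \<nu> :: "nat \<Rightarrow> 'a \<Rightarrow> 'a" where "open U" "p \<in> U"
    "\<And>i. smooth_on U (\<nu> i)"
    "\<And>i q. i < DIM('a) - m \<Longrightarrow> q \<in> U \<Longrightarrow> \<nu> i q \<notin> span ((\<lambda>j. \<nu> j q) ` {..<i})"
    "\<And>q v i. q \<in> M \<inter> U \<Longrightarrow> v \<in> tangent_space M q \<Longrightarrow> i < DIM('a) - m \<Longrightarrow> inner (\<nu> i q) v = 0"
    "\<And>q. q \<in> U \<Longrightarrow> dim {x. \<forall>i<DIM('a) - m. inner (\<nu> i q) x = 0} \<le> m"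
proof -
  obtain U V \<Phi> \<Psi> and E :: "'a set" where chart: "p \<in> U" "diffeomorphism U V \<Phi> \<Psi>" "subspace E" "dim E = m"
    "\<Phi> ` (U \<inter> M) = V \<inter> E"
    using M p unfolding submanifold_def by blast
  have U: "open U" and V: "open V" and \<Phi>: "smooth_on U \<Phi>" and \<Psi>: "smooth_on V \<Psi>"
    and \<Phi>U: "\<Phi> ` U = V" and \<Psi>V: "\<Psi> ` V = U"
    and inv: "\<And>x. x \<in> U \<Longrightarrow> \<Psi> (\<Phi> x) = x" "\<And>y. y \<in> V \<Longrightarrow> \<Phi> (\<Psi> y) = y"
    using chart(2) by (auto simp: diffeomorphism_def homeomorphism_def)
  let ?D\<Phi> = "\<lambda>q. frechet_derivative \<Phi> (at q)"
  let ?D\<Psi> = "\<lambda>q. frechet_derivative \<Psi> (at (\<Phi> q))"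
  have D\<Phi>: "(\<Phi> has_derivative ?D\<Phi> q) (at q)" if "q \<in> U" for q
    by (rule smooth_on_has_derivative[OF \<Phi> that])
  have D\<Psi>: "(\<Psi> has_derivative ?D\<Psi> q) (at (\<Phi> q))" if "q \<in> U" for q
    using that \<Phi>U by (intro smooth_on_has_derivative[OF \<Psi>]) auto
  have left: "?D\<Psi> q (?D\<Phi> q x) = x" if q: "q \<in> U" for q x
  proof -
    have 1: "((\<lambda>x. \<Psi> (\<Phi> x)) has_derivative (\<lambda>x. ?D\<Psi> q (?D\<Phi> q x))) (at q)"
      by (rule has_derivative_compose[OF D\<Phi>[OF q] D\<Psi>[OF q]])
    have 2: "((\<lambda>x. \<Psi> (\<Phi> x)) has_derivative (\<lambda>x. x)) (at q)"
      by (rule has_derivative_transform_within_open[OF has_derivative_ident U q]) (simp add: inv)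
    from has_derivative_unique[OF 1 2] show ?thesis by (simp add: fun_eq_iff)
  qed
  have right: "?D\<Phi> q (?D\<Psi> q x) = x" if q: "q \<in> U" for q x
  proof -
    have "(\<Phi> has_derivative ?D\<Phi> q) (at (\<Psi> (\<Phi> q)))" using D\<Phi>[OF q] inv(1)[OF q] by simp
    then have 1: "((\<lambda>y. \<Phi> (\<Psi> y)) has_derivative (\<lambda>x. ?D\<Phi> q (?D\<Psi> q x))) (at (\<Phi> q))"
      by (rule has_derivative_compose[OF D\<Psi>[OF q]])
    have "\<Phi> q \<in> V" using q \<Phi>U by auto
    then have 2: "((\<lambda>y. \<Phi> (\<Psi> y)) has_derivative (\<lambda>x. x)) (at (\<Phi> q))"
      by (rule has_derivative_transform_within_open[OF has_derivative_ident V]) (simp add: inv)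
    from has_derivative_unique[OF 1 2] show ?thesis by (simp add: fun_eq_iff)
  qed
  define n where "n = DIM('a) - m"
  have dim_n: "dim (orthogonal_comp E) = n"
  proof -
    have "orthogonal_comp E = {y \<in> UNIV. \<forall>x\<in>E. real_inner_class.orthogonal x y}"
      by (auto simp: orthogonal_comp_def)
    then show ?thesis
      using dim_subspace_orthogonal_to_vectors[OF chart(3) subspace_UNIV] chart(4) by (simp add: n_def)
  qed
  obtain c where c: "orthonormal_basis_of n (orthogonal_comp E) c"
    using orthonormal_basis_of_exists[OF subspace_orthogonal_comp[of E]] dim_n by auto
  have c_on: "inner (c i) (c j) = (if i = j then 1 else 0)" if "i < n" "j < n" for i j
    using c that by (auto simp: orthonormal_basis_of_def)
  have c_E: "inner (c i) x = 0" if "i < n" "x \<in> E" for i x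
  proof -
    have "c i \<in> orthogonal_comp E"
      using c that by (auto simp: orthonormal_basis_of_def basis_of_def intro: span_base)
    then show ?thesis using that by (auto simp: orthogonal_comp_def real_inner_class.orthogonal_def inner_commute)
  qed
  have E_c: "x \<in> E" if x: "\<And>i. i < n \<Longrightarrow> inner (c i) x = 0" for x
  proof -
    have "inner y x = 0" if "y \<in> orthogonal_comp E" for y
    proof -
      have y: "y \<in> span (c ` {..<n})" using c that by (simp add: orthonormal_basis_of_def basis_of_def)
      have "inner x z = 0" if z: "z \<in> c ` {..<n}" for z
      proof -
        obtain i where "i < n" "z = c i" using z by auto
        then show ?thesis using x[of i] by (simp add: inner_commute)
      qed
      from inner_eq_0_span[OF this y] show ?thesis by (simp add: inner_commute)
    qed
    then have "x \<in> orthogonal_comp (orthogonal_comp E)"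
      unfolding orthogonal_comp_def[of "orthogonal_comp E"] real_inner_class.orthogonal_def by blast
    then show ?thesis using orthogonal_comp_self[OF chart(3)] by simp
  qed
  \<comment> \<open>The gradient of the component of \<open>\<Phi>\<close> along \<open>c i\<close>,
    written in the standard basis.\<close>
  define \<nu> where "\<nu> = (\<lambda>i q. \<Sum>b\<in>Basis. inner (?D\<Phi> q b) (c i) *\<^sub>R b)"
  have \<nu>_inner: "inner (\<nu> i q) x = inner (c i) (?D\<Phi> q x)" if "q \<in> U" for i q x
  proof -
    have lin: "linear (?D\<Phi> q)" by (rule has_derivative_linear[OF D\<Phi>[OF that]])
    have "?D\<Phi> q x = ?D\<Phi> q (\<Sum>b\<in>Basis. inner x b *\<^sub>R b)" by (simp add: euclidean_representation)
    also have "\<dots> = (\<Sum>b\<in>Basis. inner x b *\<^sub>R ?D\<Phi> q b)"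
      by (simp add: linear_sum[OF lin] linear_scale[OF lin])
    finally have "inner (c i) (?D\<Phi> q x) = (\<Sum>b\<in>Basis. inner x b * inner (c i) (?D\<Phi> q b))"
      by (simp add: inner_sum_right)
    moreover have "inner (\<nu> i q) x = (\<Sum>b\<in>Basis. inner (?D\<Phi> q b) (c i) * inner b x)"
      by (simp add: \<nu>_def inner_sum_left)
    ultimately show ?thesis by (simp add: inner_commute mult.commute)
  qed
  show ?thesis
  proof (rule that[of U \<nu>, folded n_def])
    show "smooth_on U (\<nu> i)" for i
      unfolding \<nu>_def
      by (rule smooth_on_sum[OF U finite_Basis], rule smooth_on_bounded_linear[OF U bounded_linear_scaleR_left
            smooth_on_bounded_linear[OF U bounded_linear_inner_left smooth_on_frechet_derivative[OF \<Phi>]]])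
    show "\<nu> i q \<notin> span ((\<lambda>j. \<nu> j q) ` {..<i})" if "i < n" "q \<in> U" for i q
    proof
      assume mem: "\<nu> i q \<in> span ((\<lambda>j. \<nu> j q) ` {..<i})"
      \<comment> \<open>The vector \<open>?D\<Psi> q (c i)\<close> is dual to the frame: orthogonal
        to the earlier gradients, and of inner product 1 with the \<open>i\<close>-th.\<close>
      have "inner (?D\<Psi> q (c i)) x = 0" if x: "x \<in> (\<lambda>j. \<nu> j q) ` {..<i}" for x
      proof -
        obtain j where j: "j < i" "x = \<nu> j q" using x by auto
        then have "inner x (?D\<Psi> q (c i)) = 0"
          using \<open>i < n\<close> by (simp add: \<nu>_inner[OF \<open>q \<in> U\<close>] right[OF \<open>q \<in> U\<close>] c_on)
        then show ?thesis by (simp add: inner_commute)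
      qed
      from inner_eq_0_span[OF this mem] have "inner (\<nu> i q) (?D\<Psi> q (c i)) = 0"
        by (simp add: inner_commute)
      then show False using \<open>i < n\<close> by (simp add: \<nu>_inner[OF \<open>q \<in> U\<close>] right[OF \<open>q \<in> U\<close>] c_on)
    qed
    show "inner (\<nu> i q) v = 0" if q: "q \<in> M \<inter> U" and v: "v \<in> tangent_space M q" and i: "i < n" for q v i
    proof -
      have "((\<lambda>x. inner (c i) (\<Phi> x)) has_derivative (\<lambda>x. inner (c i) (?D\<Phi> q x))) (at q within M)"
        by (rule has_derivative_inner_right[OF has_derivative_at_withinI[OF D\<Phi>]]) (use q in auto)
      moreover have "((\<lambda>x. inner (c i) (\<Phi> x)) has_derivative (\<lambda>x. 0)) (at q within M)"
      proof -
        obtain d where d: "0 < d" "ball q d \<subseteq> U" using U q by (auto simp: open_contains_ball)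
        have "inner (c i) (\<Phi> x) = 0" if x: "x \<in> M" "dist x q < d" for x
        proof -
          have "x \<in> U" using x(2) d(2) by (auto simp: dist_commute)
          then have "\<Phi> x \<in> V \<inter> E" using x(1) chart(5) by blast
          then show ?thesis using i c_E by blast
        qed
        then show ?thesis
          by (intro has_derivative_transform_within[OF has_derivative_const d(1)]) (use q in auto)
      qed
      ultimately have "inner (c i) (?D\<Phi> q v) = 0" by (rule tangent_vector_derivative[OF v])
      then show ?thesis using q by (simp add: \<nu>_inner)
    qed
    show "dim {x. \<forall>i<n. inner (\<nu> i q) x = 0} \<le> m" if q: "q \<in> U" for q
    proof -
      let ?W = "{x. \<forall>i<n. inner (\<nu> i q) x = 0}"
      have "?D\<Phi> q ` ?W \<subseteq> E" 
      proof clarify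
        fix x assume "\<forall>i<n. inner (\<nu> i q) x = 0"
        then show "?D\<Phi> q x \<in> E" by (intro E_c) (simp add: \<nu>_inner[OF q])
      qed
      moreover have "inj (?D\<Phi> q)" by (rule inj_on_inverseI[of _ "?D\<Psi> q"]) (rule left[OF q])
      then have "dim (?D\<Phi> q ` ?W) = dim ?W"
        by (rule dim_image_eq[OF has_derivative_linear[OF D\<Phi>[OF q]] inj_on_subset]) simp
      ultimately show ?thesis using dim_subset[of "?D\<Phi> q ` ?W" E] chart(4) by simp
    qed
  qed (use U chart(1) in auto)
qed

lemma smooth_funE:
  assumes "smooth_fun M f" "p \<in> M"
  obtains U F where "open U" "p \<in> U" "smooth_on U F" "\<And>q. q \<in> M \<inter> U \<Longrightarrow> F q = f q"
proof -
  from assms have "\<exists>U F. open U \<and> p \<in> U \<and> smooth_on U F \<and> (\<forall>q\<in>M \<inter> U. F q = f q)"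
    unfolding smooth_fun_def by (rule bspec)
  then show ?thesis by (elim exE conjE) (rule that, assumption+, erule bspec)
qed

lemma smooth_fun_has_derivative:
  assumes "smooth_fun M f" "p \<in> M"
  shows "(f has_derivative frechet_derivative f (at p within M)) (at p within M)"
proof -
  obtain U F where U: "open U" "p \<in> U" "smooth_on U F" "\<And>q. q \<in> M \<inter> U \<Longrightarrow> F q = f q"
    by (rule smooth_funE[OF assms]) blast
  obtain d where d: "0 < d" "ball p d \<subseteq> U" using U(1,2) by (auto simp: open_contains_ball)
  have "(f has_derivative frechet_derivative F (at p)) (at p within M)"
  proof (rule has_derivative_transform_within[OF has_derivative_at_withinI[OF smooth_on_has_derivative[OF U(3,2)]] d(1) assms(2)])
    fix x assume "x \<in> M" "dist x p < d"
    then show "F x = f x" using d(2) by (intro U(4)) (auto simp: dist_commute)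
  qed
  then have "f differentiable (at p within M)" by (rule differentiableI)
  then show ?thesis by (simp only: frechet_derivative_works)
qed

lemma smooth_fun_diff:
  assumes "smooth_fun M f" "smooth_fun M g"
  shows "smooth_fun M (\<lambda>q. f q - g q)"
  unfolding smooth_fun_def
proof
  fix p assume p: "p \<in> M"
  obtain U F where U: "open U" "p \<in> U" "smooth_on U F" "\<forall>q\<in>M \<inter> U. F q = f q"
    by (rule smooth_funE[OF assms(1) p]) blast
  obtain V G where V: "open V" "p \<in> V" "smooth_on V G" "\<forall>q\<in>M \<inter> V. G q = g q"
    by (rule smooth_funE[OF assms(2) p]) blast
  have "smooth_on (U \<inter> V) (\<lambda>q. F q - G q)"
    by (rule smooth_on_diff[OF open_Int[OF U(1) V(1)] smooth_on_subset[OF U(3)] smooth_on_subset[OF V(3)]]) auto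
  then show "\<exists>U F. open U \<and> p \<in> U \<and> smooth_on U F \<and> (\<forall>q\<in>M \<inter> U. F q = f q - g q)"
    using U(1,2,4) V(1,2,4) by (intro exI[of _ "U \<inter> V"] exI[of _ "\<lambda>q. F q - G q"] conjI ballI) auto
qed

lemma smooth_fun_cong:
  assumes "\<And>q. q \<in> M \<Longrightarrow> f q = g q"
  shows "smooth_fun M f \<longleftrightarrow> smooth_fun M g"
  using assms by (simp add: smooth_fun_def)

lemma linear_dir_deriv: "smooth_fun M f \<Longrightarrow> p \<in> M \<Longrightarrow> linear (\<lambda>v. dir_deriv M v f p)"
  unfolding dir_deriv_def by (rule has_derivative_linear[OF smooth_fun_has_derivative])

lemma dir_deriv_cong:
  assumes "v \<in> tangent_space M p" "p \<in> M" "\<And>q. q \<in> M \<Longrightarrow> f q = g q" "(g has_derivative G) (at p within M)"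
  shows "dir_deriv M v f p = dir_deriv M v g p"
proof -
  have "(f has_derivative G) (at p within M)"
    by (rule has_derivative_transform[OF assms(2) _ assms(4)]) (rule assms(3))
  then show ?thesis by (simp only: dir_deriv_eq[OF assms(1)] dir_deriv_eq[OF assms(1,4)])
qed

lemma dir_deriv_inner:
  assumes "v \<in> tangent_space M p" "(f has_derivative F) (at p within M)" "(g has_derivative G) (at p within M)"
  shows "dir_deriv M v (\<lambda>q. inner (f q) (g q)) p
    = inner (dir_deriv M v f p) (g p) + inner (f p) (dir_deriv M v g p)"
  using dir_deriv_eq[OF assms(1) has_derivative_inner[OF assms(2,3)]]
    dir_deriv_eq[OF assms(1,2)] dir_deriv_eq[OF assms(1,3)] by simp

section \<open>Tangential projection and the flat connection\<close>

text \<open>Velocities of curves do not visibly form an \<open>m\<close>-dimensional subspace. The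
  last two assumptions are discharged later by the bases that an orientation provides.\<close>

locale submanifold_with_tangent_dim =
  fixes m :: nat and M :: "'a::euclidean_space set"
  assumes submanifold: "submanifold m M"
    and subspace_tangent: "\<And>p. p \<in> M \<Longrightarrow> subspace (tangent_space M p)"
    and dim_tangent: "\<And>p. p \<in> M \<Longrightarrow> dim (tangent_space M p) = m"
begin

lemma subspace_normal: "subspace (normal_space M p)"
  by (simp add: normal_space_def subspace_orthogonal_comp)

lemma inner_normal_tangent: "z \<in> normal_space M p \<Longrightarrow> t \<in> tangent_space M p \<Longrightarrow> inner z t = 0"
  by (simp add: normal_space_def orthogonal_comp_def real_inner_class.orthogonal_def inner_commute)

lemma dim_normal: "p \<in> M \<Longrightarrow> dim (normal_space M p) = DIM('a) - m"
proof -
  assume p: "p \<in> M"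
  have "normal_space M p = {y \<in> UNIV. \<forall>x\<in>tangent_space M p. real_inner_class.orthogonal x y}"
    by (auto simp: normal_space_def orthogonal_comp_def)
  then show ?thesis
    using dim_subspace_orthogonal_to_vectors[OF subspace_tangent[OF p] subspace_UNIV] dim_tangent[OF p] by simp
qed

lemma normal_part_unique:
  assumes "p \<in> M" "z \<in> normal_space M p" "w - z \<in> tangent_space M p"
  shows "normal_part M p w = z"
  unfolding normal_part_def
proof (rule the_equality)
  fix z' assume z': "z' \<in> normal_space M p \<and> w - z' \<in> tangent_space M p"
  have "z - z' \<in> normal_space M p" using assms z' subspace_diff[OF subspace_normal] by blast
  moreover have "(w - z') - (w - z) \<in> tangent_space M p"
    using assms z' subspace_diff[OF subspace_tangent] by blast
  then have "z - z' \<in> tangent_space M p" by simp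
  ultimately have "inner (z - z') (z - z') = 0" by (rule inner_normal_tangent)
  then show "z' = z" by simp
qed (use assms in simp)

lemma
  assumes p: "p \<in> M"
  shows normal_part_normal: "normal_part M p w \<in> normal_space M p"
    and diff_normal_part_tangent: "w - normal_part M p w \<in> tangent_space M p"
proof -
  obtain y z where yz: "y \<in> span (tangent_space M p)" "\<And>u. u \<in> span (tangent_space M p) \<Longrightarrow> real_inner_class.orthogonal z u"
    "w = y + z"
    using orthogonal_subspace_decomp_exists[of "tangent_space M p" w] by metis
  have "z \<in> normal_space M p"
  proof -
    have "inner u z = 0" if "u \<in> tangent_space M p" for u
      using yz(2)[OF span_base[OF that]] by (simp add: real_inner_class.orthogonal_def inner_commute)
    then show ?thesis by (simp add: normal_space_def orthogonal_comp_def real_inner_class.orthogonal_def)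
  qed
  moreover have "w - z \<in> tangent_space M p"
    using yz subspace_tangent[OF p] by (simp add: span_eq_iff[THEN iffD2])
  ultimately show "normal_part M p w \<in> normal_space M p" "w - normal_part M p w \<in> tangent_space M p"
    using normal_part_unique[OF p] by auto
qed

lemma linear_normal_part:
  assumes p: "p \<in> M"
  shows "linear (normal_part M p)"
proof (rule linearI)
  fix x y
  show "normal_part M p (x + y) = normal_part M p x + normal_part M p y"
  proof (rule normal_part_unique[OF p])
    show "normal_part M p x + normal_part M p y \<in> normal_space M p"
      by (intro subspace_add[OF subspace_normal] normal_part_normal p)
    have "(x - normal_part M p x) + (y - normal_part M p y) \<in> tangent_space M p"
      by (intro subspace_add[OF subspace_tangent] diff_normal_part_tangent p)
    then show "x + y - (normal_part M p x + normal_part M p y) \<in> tangent_space M p" by (simp add: algebra_simps)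
  qed
next
  fix c x
  show "normal_part M p (c *\<^sub>R x) = c *\<^sub>R normal_part M p x"
  proof (rule normal_part_unique[OF p])
    show "c *\<^sub>R normal_part M p x \<in> normal_space M p"
      by (intro subspace_scale[OF subspace_normal] normal_part_normal p)
    have "c *\<^sub>R (x - normal_part M p x) \<in> tangent_space M p"
      by (intro subspace_scale[OF subspace_tangent] diff_normal_part_tangent p)
    then show "c *\<^sub>R x - c *\<^sub>R normal_part M p x \<in> tangent_space M p" by (simp add: scaleR_diff_right)
  qed
qed

lemma normal_part_tangent: "p \<in> M \<Longrightarrow> t \<in> tangent_space M p \<Longrightarrow> normal_part M p t = 0"
  by (rule normal_part_unique) (simp_all add: subspace_0 subspace_normal)

text \<open>Tangency is clear; smoothness holds because near each point the projection is the
  Gram-Schmidt rejection of the constant field \<open>v\<close> along a smooth normal frame.\<close>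

lemma vector_field_projection: "vector_field M (\<lambda>q. v - normal_part M q v)"
  unfolding vector_field_def
proof (intro conjI ballI)
  show "v - normal_part M p v \<in> tangent_space M p" if "p \<in> M" for p
    by (rule diff_normal_part_tangent[OF that])
  show "smooth_fun M (\<lambda>q. v - normal_part M q v)"
    unfolding smooth_fun_def
  proof
    fix p assume p: "p \<in> M"
    let ?n = "DIM('a) - m"
    show "\<exists>U F. open U \<and> p \<in> U \<and> smooth_on U F \<and> (\<forall>q\<in>M \<inter> U. F q = v - normal_part M q v)"
    proof (rule submanifold_normal_frame[OF submanifold p])
      fix U and \<nu> :: "nat \<Rightarrow> 'a \<Rightarrow> 'a"
      assume U: "open U" "p \<in> U" and \<nu>: "\<And>i. smooth_on U (\<nu> i)"
        and indep: "\<And>i q. i < ?n \<Longrightarrow> q \<in> U \<Longrightarrow> \<nu> i q \<notin> span ((\<lambda>j. \<nu> j q) ` {..<i})"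
        and tangent: "\<And>q v i. q \<in> M \<inter> U \<Longrightarrow> v \<in> tangent_space M q \<Longrightarrow> i < ?n \<Longrightarrow> inner (\<nu> i q) v = 0"
        and dim: "\<And>q. q \<in> U \<Longrightarrow> dim {x. \<forall>i<?n. inner (\<nu> i q) x = 0} \<le> m"
      let ?F = "reject \<nu> ?n (\<lambda>_. v)"
      have "smooth_on U ?F"
        by (rule smooth_on_reject[OF U(1) \<nu> indep smooth_on_const])
      moreover have "?F q = v - normal_part M q v" if q: "q \<in> M \<inter> U" for q
      proof -
        let ?W = "{x. \<forall>i<?n. inner (\<nu> i q) x = 0}"
        have "subspace ?W" by (auto simp: subspace_def inner_add_right)
        \<comment> \<open>The tangent space is contained in \<open>?W\<close> and has dimension
          \<open>m\<close>, the upper bound for the dimension of \<open>?W\<close>.\<close>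
        then have W: "tangent_space M q = ?W"
          using q tangent[OF q] dim[of q] dim_tangent[of q] subspace_tangent[of q]
          by (intro subspace_dim_equal) auto
        have "?F q \<in> tangent_space M q"
          unfolding W using inner_reject[of _ ?n \<nu> "\<lambda>_. v" q] by (simp add: inner_commute)
        moreover have "v - ?F q \<in> normal_space M q"
        proof -
          have "inner t (v - ?F q) = 0" if t: "t \<in> tangent_space M q" for t
          proof (rule inner_eq_0_span[OF _ diff_reject_in_span[of "\<lambda>_. v" q \<nu> ?n]])
            fix x assume "x \<in> (\<lambda>i. \<nu> i q) ` {..<?n}"
            then show "inner t x = 0" using tangent[OF q t] by (auto simp: inner_commute)
          qed
          then show ?thesis by (simp add: normal_space_def orthogonal_comp_def real_inner_class.orthogonal_def)
        qed
        ultimately have "normal_part M q v = v - ?F q"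
          using q by (intro normal_part_unique) auto
        then show ?thesis by simp
      qed
      ultimately show "\<exists>U F. open U \<and> p \<in> U \<and> smooth_on U F \<and> (\<forall>q\<in>M \<inter> U. F q = v - normal_part M q v)"
        using U by (intro exI[of _ U] exI[of _ ?F]) simp
    qed
  qed
qed

text \<open>The projected constant field \<open>v\<close> is a witness, so the choice in
  \<open>extension\<close> is meaningful.\<close>

lemma extension:
  assumes "p \<in> M" "v \<in> tangent_space M p"
  shows "vector_field M (extension M p v)" "extension M p v p = v"
proof -
  have "vector_field M (\<lambda>q. v - normal_part M q v) \<and> v - normal_part M p v = v"
    using vector_field_projection normal_part_tangent[OF assms] by simp
  from someI[of "\<lambda>X. vector_field M X \<and> X p = v", OF this]
  show "vector_field M (extension M p v)" "extension M p v p = v" by (simp_all add: extension_def)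
qed

lemma flat_connection_has_derivative:
  assumes X: "vector_field M X" and p: "p \<in> M" and U: "open U" "p \<in> U" "smooth_on U F" "\<And>q. q \<in> M \<inter> U \<Longrightarrow> F q = Y q"
  shows "(flat_connection M X Y has_derivative (\<lambda>v.
      frechet_derivative (\<lambda>q. frechet_derivative F (at q) (X p)) (at p) v
      + frechet_derivative F (at p) (frechet_derivative X (at p within M) v))) (at p within M)"
proof -
  let ?D = "\<lambda>q. frechet_derivative F (at q)"
  let ?DX = "frechet_derivative X (at p within M)"
  have X_smooth: "smooth_fun M X" using X by (simp add: vector_field_def)
  have lin: "linear (?D q)" if "q \<in> U" for q
    by (rule has_derivative_linear[OF smooth_on_has_derivative[OF U(3) that]])
  \<comment> \<open>Smoothness is known for derivatives of \<open>F\<close> in a fixed direction.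
    The basis expansion reduces the varying direction \<open>X q\<close> to such
    derivatives.\<close>
  have expand: "?D q x = (\<Sum>b\<in>Basis. inner x b *\<^sub>R ?D q b)" if "q \<in> U" for q x
  proof -
    have "?D q x = ?D q (\<Sum>b\<in>Basis. inner x b *\<^sub>R b)" by (simp add: euclidean_representation)
    also have "\<dots> = (\<Sum>b\<in>Basis. inner x b *\<^sub>R ?D q b)"
      by (simp add: linear_sum[OF lin[OF that]] linear_scale[OF lin[OF that]])
    finally show ?thesis .
  qed
  obtain d where d: "0 < d" "ball p d \<subseteq> U" using U(1,2) by (auto simp: open_contains_ball)
  have DF: "((\<lambda>q. ?D q b) has_derivative frechet_derivative (\<lambda>q. ?D q b) (at p)) (at p)" for b
    by (rule smooth_on_has_derivative[OF smooth_on_frechet_derivative[OF U(3)] U(2)])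
  have DX: "(X has_derivative ?DX) (at p within M)"
    by (rule smooth_fun_has_derivative[OF X_smooth p])
  have D1: "((\<lambda>q. \<Sum>b\<in>Basis. inner (X q) b *\<^sub>R ?D q b) has_derivative
      (\<lambda>v. \<Sum>b\<in>Basis. inner (X p) b *\<^sub>R frechet_derivative (\<lambda>q. ?D q b) (at p) v + inner (?DX v) b *\<^sub>R ?D p b)) (at p within M)"
  proof (rule has_derivative_sum)
    fix b :: 'a
    show "((\<lambda>q. inner (X q) b *\<^sub>R ?D q b) has_derivative
      (\<lambda>v. inner (X p) b *\<^sub>R frechet_derivative (\<lambda>q. ?D q b) (at p) v + inner (?DX v) b *\<^sub>R ?D p b)) (at p within M)"
      by (rule has_derivative_scaleR[OF has_derivative_inner_left[OF DX] has_derivative_at_withinI[OF DF]])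
  qed
  have D2: "((\<lambda>q. \<Sum>b\<in>Basis. inner (X p) b *\<^sub>R ?D q b) has_derivative
      (\<lambda>v. \<Sum>b\<in>Basis. inner (X p) b *\<^sub>R frechet_derivative (\<lambda>q. ?D q b) (at p) v)) (at p)"
  proof (rule has_derivative_sum)
    fix b :: 'a
    show "((\<lambda>q. inner (X p) b *\<^sub>R ?D q b) has_derivative
      (\<lambda>v. inner (X p) b *\<^sub>R frechet_derivative (\<lambda>q. ?D q b) (at p) v)) (at p)"
      by (rule has_derivative_scaleR_right[OF DF])
  qed
  have D3: "((\<lambda>q. ?D q (X p)) has_derivative
      (\<lambda>v. \<Sum>b\<in>Basis. inner (X p) b *\<^sub>R frechet_derivative (\<lambda>q. ?D q b) (at p) v)) (at p)"
    by (rule has_derivative_transform_within_open[OF D2 U(1,2)]) (rule expand[symmetric])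
  have D4: "(\<Sum>b\<in>Basis. inner (X p) b *\<^sub>R frechet_derivative (\<lambda>q. ?D q b) (at p) v + inner (?DX v) b *\<^sub>R ?D p b)
      = frechet_derivative (\<lambda>q. ?D q (X p)) (at p) v + ?D p (?DX v)" for v
    unfolding frechet_derivative_at[OF D3, symmetric] sum.distrib by (simp only: expand[OF U(2), of "?DX v"])
  have "((\<lambda>q. \<Sum>b\<in>Basis. inner (X q) b *\<^sub>R ?D q b) has_derivative
      (\<lambda>v. frechet_derivative (\<lambda>q. ?D q (X p)) (at p) v + ?D p (?DX v))) (at p within M)"
    using D1 unfolding D4 .
  then show ?thesis
  proof (rule has_derivative_transform_within[OF _ d(1) p])
    fix q assume q: "q \<in> M" "dist q p < d"
    then have qU: "q \<in> U" using d(2) by (auto simp: dist_commute)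
    obtain e where e: "0 < e" "ball q e \<subseteq> U" using U(1) qU by (auto simp: open_contains_ball)
    have DY: "(Y has_derivative ?D q) (at q within M)"
    proof (rule has_derivative_transform_within[OF has_derivative_at_withinI[OF smooth_on_has_derivative[OF U(3) qU]] e(1) q(1)])
      fix x assume "x \<in> M" "dist x q < e"
      then show "F x = Y x" using e(2) by (intro U(4)) (auto simp: dist_commute)
    qed
    have "X q \<in> tangent_space M q" using X q(1) by (simp add: vector_field_def)
    then have "flat_connection M X Y q = ?D q (X q)"
      unfolding flat_connection_def by (rule dir_deriv_eq[OF _ DY])
    then show "(\<Sum>b\<in>Basis. inner (X q) b *\<^sub>R ?D q b) = flat_connection M X Y q"
      by (simp only: expand[OF qU, of "X q"])
  qed
qed

lemma flat_connection_differentiable: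
  assumes "vector_field M X" "vector_field M Y" "p \<in> M"
  shows "\<exists>G. (flat_connection M X Y has_derivative G) (at p within M)"
proof -
  obtain U F where U: "open U" "p \<in> U" "smooth_on U F" "\<And>q. q \<in> M \<inter> U \<Longrightarrow> F q = Y q"
    by (rule smooth_funE[OF conjunct1[OF assms(2)[unfolded vector_field_def]] assms(3)]) blast
  then show ?thesis by (intro exI) (rule flat_connection_has_derivative[OF assms(1,3) U])
qed

text \<open>The second derivatives of the extension of \<open>Z\<close> cancel by symmetry; what
  remains is its first derivative applied to the bracket. Tangency of the bracket is what makes
  \<open>dir_deriv\<close> in that direction well determined.\<close>

lemma flat_connection_flat:
  assumes X: "vector_field M X" and Y: "vector_field M Y" and Z: "vector_field M Z" and p: "p \<in> M"
    and L: "lie_bracket M X Y p \<in> tangent_space M p"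
  shows "dir_deriv M (X p) (flat_connection M Y Z) p - dir_deriv M (Y p) (flat_connection M X Z) p
    = dir_deriv M (lie_bracket M X Y p) Z p"
proof -
  obtain U F where U: "open U" "p \<in> U" "smooth_on U F" "\<And>q. q \<in> M \<inter> U \<Longrightarrow> F q = Z q"
    by (rule smooth_funE[OF conjunct1[OF Z[unfolded vector_field_def]] p]) blast
  let ?D = "\<lambda>q. frechet_derivative F (at q)"
  have Xp: "X p \<in> tangent_space M p" and Yp: "Y p \<in> tangent_space M p"
    using X Y p by (auto simp: vector_field_def)
  have lin: "linear (?D p)" by (rule has_derivative_linear[OF smooth_on_has_derivative[OF U(3,2)]])
  obtain d where d: "0 < d" "ball p d \<subseteq> U" using U(1,2) by (auto simp: open_contains_ball)
  have "(Z has_derivative ?D p) (at p within M)"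
  proof (rule has_derivative_transform_within[OF has_derivative_at_withinI[OF smooth_on_has_derivative[OF U(3,2)]] d(1) p])
    fix x assume "x \<in> M" "dist x p < d"
    then show "F x = Z x" using d(2) by (intro U(4)) (auto simp: dist_commute)
  qed
  from dir_deriv_eq[OF L this] have "dir_deriv M (lie_bracket M X Y p) Z p
      = ?D p (frechet_derivative Y (at p within M) (X p)) - ?D p (frechet_derivative X (at p within M) (Y p))"
    by (simp add: lie_bracket_def flat_connection_def dir_deriv_def linear_diff[OF lin])
  moreover have "dir_deriv M (X p) (flat_connection M Y Z) p
      = frechet_derivative (\<lambda>q. ?D q (Y p)) (at p) (X p) + ?D p (frechet_derivative Y (at p within M) (X p))"
    by (rule dir_deriv_eq[OF Xp flat_connection_has_derivative[OF Y p U]])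
  moreover have "dir_deriv M (Y p) (flat_connection M X Z) p
      = frechet_derivative (\<lambda>q. ?D q (X p)) (at p) (Y p) + ?D p (frechet_derivative X (at p within M) (Y p))"
    by (rule dir_deriv_eq[OF Yp flat_connection_has_derivative[OF X p U]])
  ultimately show ?thesis
    using second_derivative_symmetric[OF U(1,2,3), of "Y p" "X p"] by simp
qed

end

section \<open>Curvature\<close>

locale levi_civita_submanifold = submanifold_with_tangent_dim m M
    for m and M :: "'a::euclidean_space set" +
  fixes conn :: "('a \<Rightarrow> 'a) \<Rightarrow> ('a \<Rightarrow> 'a) \<Rightarrow> 'a \<Rightarrow> 'a"
  assumes levi_civita: "levi_civita_connection M conn"
begin

lemma vector_field_conn: "vector_field M X \<Longrightarrow> vector_field M Y \<Longrightarrow> vector_field M (conn X Y)"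
  using levi_civita unfolding levi_civita_connection_def affine_connection_def by meson

lemma conn_torsion_free:
  "vector_field M X \<Longrightarrow> vector_field M Y \<Longrightarrow> p \<in> M \<Longrightarrow> conn X Y p - conn Y X p = lie_bracket M X Y p"
  using levi_civita unfolding levi_civita_connection_def by meson

lemma conn_metric:
  "vector_field M X \<Longrightarrow> vector_field M Y \<Longrightarrow> vector_field M Z \<Longrightarrow> p \<in> M \<Longrightarrow>
    dir_deriv M (X p) (\<lambda>q. inner (Y q) (Z q)) p = inner (conn X Y p) (Z p) + inner (Y p) (conn X Z p)"
  using levi_civita unfolding levi_civita_connection_def by meson

lemma vector_field_tangent: "vector_field M X \<Longrightarrow> p \<in> M \<Longrightarrow> X p \<in> tangent_space M p"
  by (simp add: vector_field_def)

lemma vector_field_smooth: "vector_field M X \<Longrightarrow> smooth_fun M X"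
  by (simp add: vector_field_def)

text \<open>Torsion-freeness writes the bracket as a difference of two fields produced by
  \<open>conn\<close>, which are smooth and tangent by the axioms of a connection.\<close>

lemma vector_field_lie_bracket:
  assumes "vector_field M X" "vector_field M Y"
  shows "vector_field M (lie_bracket M X Y)"
proof -
  have "smooth_fun M (\<lambda>q. conn X Y q - conn Y X q)"
    by (rule smooth_fun_diff; rule vector_field_smooth; rule vector_field_conn) (rule assms)+
  then have "smooth_fun M (lie_bracket M X Y)"
    by (subst smooth_fun_cong[of M _ "\<lambda>q. conn X Y q - conn Y X q"]) (simp add: conn_torsion_free assms)
  moreover have "lie_bracket M X Y p \<in> tangent_space M p" if "p \<in> M" for p
    unfolding conn_torsion_free[OF assms that, symmetric]
    by (intro subspace_diff subspace_tangent vector_field_tangent vector_field_conn assms that)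
  ultimately show ?thesis by (simp add: vector_field_def)
qed

text \<open>Koszul's argument: the difference of the two sides is symmetric in the first two and
  antisymmetric in the last two of its three arguments.\<close>

lemma inner_conn:
  assumes X: "vector_field M X" and Y: "vector_field M Y" and p: "p \<in> M" and z: "z \<in> tangent_space M p"
  shows "inner (conn X Y p) z = inner (flat_connection M X Y p) z"
proof -
  define S where "S = (\<lambda>X Y Z. inner (flat_connection M X Y p - conn X Y p) (Z p))"
  have sym: "S X Y Z = S Y X Z" if "vector_field M X" "vector_field M Y" for X Y Z
  proof -
    have "flat_connection M X Y p - conn X Y p = flat_connection M Y X p - conn Y X p"
      using conn_torsion_free[OF that p] by (simp add: lie_bracket_def algebra_simps)
    then show ?thesis by (simp add: S_def)
  qed
  have anti: "S X Y Z = - S X Z Y" if "vector_field M X" "vector_field M Y" "vector_field M Z" for X Y Z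
  proof -
    have "dir_deriv M (X p) (\<lambda>q. inner (Y q) (Z q)) p
        = inner (flat_connection M X Y p) (Z p) + inner (Y p) (flat_connection M X Z p)"
      unfolding flat_connection_def
      by (rule dir_deriv_inner[OF vector_field_tangent[OF that(1) p]
            smooth_fun_has_derivative[OF vector_field_smooth[OF that(2)] p]
            smooth_fun_has_derivative[OF vector_field_smooth[OF that(3)] p]])
    then show ?thesis
      using conn_metric[OF that p] by (simp add: S_def inner_diff_left inner_commute[of "Y p"])
  qed
  define Z where "Z = extension M p z"
  have Z: "vector_field M Z" and Zp: "Z p = z" using extension[OF p z] by (simp_all add: Z_def)
  \<comment> \<open>Six exchanges, three of them with a sign, lead back to the start, so the
    quantity equals its own negative.\<close>
  have "S X Y Z = - S X Z Y" by (rule anti[OF X Y Z])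
  also have "S X Z Y = S Z X Y" by (rule sym[OF X Z])
  also have "S Z X Y = - S Z Y X" by (rule anti[OF Z X Y])
  also have "S Z Y X = S Y Z X" by (rule sym[OF Z Y])
  also have "S Y Z X = - S Y X Z" by (rule anti[OF Y Z X])
  also have "S Y X Z = S X Y Z" by (rule sym[OF Y X])
  finally have "S X Y Z = 0" by simp
  then show ?thesis by (simp add: S_def Zp inner_diff_left)
qed

section \<open>The second fundamental form and the Gauss equation\<close>

lemma normal_part_flat_connection:
  assumes X: "vector_field M X" and Y: "vector_field M Y" and p: "p \<in> M"
  shows "normal_part M p (flat_connection M X Y p) = flat_connection M X Y p - conn X Y p"
proof (rule normal_part_unique[OF p])
  have "inner t (flat_connection M X Y p - conn X Y p) = 0" if "t \<in> tangent_space M p" for t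
    using inner_conn[OF X Y p that] by (simp add: inner_diff_right inner_commute)
  then show "flat_connection M X Y p - conn X Y p \<in> normal_space M p"
    by (simp add: normal_space_def orthogonal_comp_def real_inner_class.orthogonal_def)
  show "flat_connection M X Y p - (flat_connection M X Y p - conn X Y p) \<in> tangent_space M p"
    using vector_field_tangent[OF vector_field_conn[OF X Y] p] by simp
qed

lemma second_fundamental_form_normal: "p \<in> M \<Longrightarrow> second_fundamental_form M p x y \<in> normal_space M p"
  unfolding second_fundamental_form_def by (rule normal_part_normal)

text \<open>The normal part is the difference of \<open>flat_connection\<close> and
  \<open>conn\<close>, and both have the same antisymmetrization, the Lie bracket.\<close>

lemma second_fundamental_form_commute:
  assumes p: "p \<in> M" and x: "x \<in> tangent_space M p" and y: "y \<in> tangent_space M p"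
  shows "second_fundamental_form M p x y = second_fundamental_form M p y x"
proof -
  let ?X = "extension M p x" and ?Y = "extension M p y"
  have "flat_connection M ?X ?Y p - conn ?X ?Y p = flat_connection M ?Y ?X p - conn ?Y ?X p"
    using conn_torsion_free[OF extension(1)[OF p x] extension(1)[OF p y] p]
    by (simp add: lie_bracket_def algebra_simps)
  then show ?thesis
    unfolding second_fundamental_form_def
    by (simp only: normal_part_flat_connection extension(1) p x y)
qed

lemma second_fundamental_form_eq:
  assumes p: "p \<in> M" and x: "x \<in> tangent_space M p"
  shows "second_fundamental_form M p x y = normal_part M p (dir_deriv M x (extension M p y) p)"
  by (simp only: second_fundamental_form_def flat_connection_def extension(2)[OF p x])

text \<open>In the first slot the extension enters only through its value at \<open>p\<close>, so
  linearity is inherited from \<open>dir_deriv\<close> and \<open>normal_part\<close>.\<close>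

lemma second_fundamental_form_sum_left:
  assumes p: "p \<in> M" and b: "\<And>i. i \<in> I \<Longrightarrow> b i \<in> tangent_space M p" and y: "y \<in> tangent_space M p"
  shows "second_fundamental_form M p (\<Sum>i\<in>I. a i *\<^sub>R b i) y = (\<Sum>i\<in>I. a i *\<^sub>R second_fundamental_form M p (b i) y)"
proof -
  let ?L = "\<lambda>x. normal_part M p (dir_deriv M x (extension M p y) p)"
  have L: "linear ?L"
    using linear_compose[OF linear_dir_deriv[OF vector_field_smooth[OF extension(1)[OF p y]] p] linear_normal_part[OF p]]
    by (simp only: comp_def)
  have "(\<Sum>i\<in>I. a i *\<^sub>R b i) \<in> tangent_space M p"
    by (intro subspace_sum subspace_scale subspace_tangent p b)
  then have "second_fundamental_form M p (\<Sum>i\<in>I. a i *\<^sub>R b i) y = ?L (\<Sum>i\<in>I. a i *\<^sub>R b i)"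
    by (rule second_fundamental_form_eq[OF p])
  also have "\<dots> = (\<Sum>i\<in>I. a i *\<^sub>R ?L (b i))" by (simp only: linear_sum[OF L] linear_scale[OF L])
  also have "\<dots> = (\<Sum>i\<in>I. a i *\<^sub>R second_fundamental_form M p (b i) y)"
    by (intro sum.cong refl) (simp only: second_fundamental_form_eq[OF p b])
  finally show ?thesis .
qed

text \<open>In the second slot the extension of a sum is a choice unrelated to those of the
  summands; linearity is carried over from the first slot by symmetry.\<close>

lemma second_fundamental_form_sum:
  assumes p: "p \<in> M" and b: "\<And>i. i \<in> I \<Longrightarrow> b i \<in> tangent_space M p"
    and c: "\<And>j. j \<in> J \<Longrightarrow> c j \<in> tangent_space M p"
  shows "second_fundamental_form M p (\<Sum>i\<in>I. a i *\<^sub>R b i) (\<Sum>j\<in>J. a' j *\<^sub>R c j)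
    = (\<Sum>i\<in>I. \<Sum>j\<in>J. (a i * a' j) *\<^sub>R second_fundamental_form M p (b i) (c j))"
proof -
  have y: "(\<Sum>j\<in>J. a' j *\<^sub>R c j) \<in> tangent_space M p"
    by (intro subspace_sum subspace_scale subspace_tangent p c)
  have "second_fundamental_form M p (\<Sum>i\<in>I. a i *\<^sub>R b i) (\<Sum>j\<in>J. a' j *\<^sub>R c j)
      = (\<Sum>i\<in>I. a i *\<^sub>R second_fundamental_form M p (b i) (\<Sum>j\<in>J. a' j *\<^sub>R c j))"
    by (rule second_fundamental_form_sum_left[OF p b y])
  also have "\<dots> = (\<Sum>i\<in>I. a i *\<^sub>R (\<Sum>j\<in>J. a' j *\<^sub>R second_fundamental_form M p (b i) (c j)))"
  proof (intro sum.cong refl arg_cong[of _ _ "\<lambda>x. _ *\<^sub>R x"])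
    fix i assume i: "i \<in> I"
    have "second_fundamental_form M p (b i) (\<Sum>j\<in>J. a' j *\<^sub>R c j)
        = (\<Sum>j\<in>J. a' j *\<^sub>R second_fundamental_form M p (c j) (b i))"
      by (subst second_fundamental_form_commute[OF p b[OF i] y])
        (rule second_fundamental_form_sum_left[OF p c b[OF i]])
    also have "\<dots> = (\<Sum>j\<in>J. a' j *\<^sub>R second_fundamental_form M p (b i) (c j))"
      by (intro sum.cong refl) (simp only: second_fundamental_form_commute[OF p c b[OF i]])
    finally show "second_fundamental_form M p (b i) (\<Sum>j\<in>J. a' j *\<^sub>R c j)
        = (\<Sum>j\<in>J. a' j *\<^sub>R second_fundamental_form M p (b i) (c j))" .
  qed
  finally show ?thesis by (simp add: scaleR_sum_right)
qed

text \<open>Metric compatibility moves the outer covariant derivative off \<open>conn B Z\<close>,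
  whose inner product with a tangent field may be computed with the flat connection. Thus no normal
  field is ever differentiated. Flatness then removes all second derivatives, leaving products of
  first derivatives.\<close>

lemma gauss_equation:
  assumes p: "p \<in> M" and x: "x \<in> tangent_space M p" and y: "y \<in> tangent_space M p"
    and z: "z \<in> tangent_space M p" and w: "w \<in> tangent_space M p"
  shows "riemann_tensor M conn p x y z w
    = inner (second_fundamental_form M p y z) (second_fundamental_form M p x w)
      - inner (second_fundamental_form M p x z) (second_fundamental_form M p y w)"
proof -
  define X Y Z W where "X = extension M p x" and "Y = extension M p y" and "Z = extension M p z" and "W = extension M p w"
  have X: "vector_field M X" "X p = x" and Y: "vector_field M Y" "Y p = y"
    and Z: "vector_field M Z" "Z p = z" and W: "vector_field M W" "W p = w"
    by (simp_all add: X_def Y_def Z_def W_def extension p x y z w)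
  let ?D = "flat_connection M"
  have L: "vector_field M (lie_bracket M X Y)" by (rule vector_field_lie_bracket[OF X(1) Y(1)])
  have second: "inner (conn A (conn B Z) p) w
      = inner (dir_deriv M (A p) (?D B Z) p) w + inner (?D B Z p) (?D A W p) - inner (conn B Z p) (conn A W p)"
    if A: "vector_field M A" and B: "vector_field M B" for A B
  proof -
    obtain G where G: "(?D B Z has_derivative G) (at p within M)"
      using flat_connection_differentiable[OF B Z(1) p] by (rule exE)
    have W': "(W has_derivative frechet_derivative W (at p within M)) (at p within M)"
      by (rule smooth_fun_has_derivative[OF vector_field_smooth[OF W(1)] p])
    have Ap: "A p \<in> tangent_space M p" by (rule vector_field_tangent[OF A p])
    have "inner (conn A (conn B Z) p) w + inner (conn B Z p) (conn A W p)
        = dir_deriv M (A p) (\<lambda>q. inner (conn B Z q) (W q)) p"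
      using conn_metric[OF A vector_field_conn[OF B Z(1)] W(1) p] by (simp only: W(2))
    \<comment> \<open>The replacement is legitimate under the derivative because \<open>W\<close> is
      tangent at every point of \<open>M\<close>.\<close>
    also have "\<dots> = dir_deriv M (A p) (\<lambda>q. inner (?D B Z q) (W q)) p"
      by (rule dir_deriv_cong[OF Ap p _ has_derivative_inner[OF G W']])
        (rule inner_conn[OF B Z(1) _ vector_field_tangent[OF W(1)]])
    also have "\<dots> = inner (dir_deriv M (A p) (?D B Z) p) (W p) + inner (?D B Z p) (dir_deriv M (A p) W p)"
      by (rule dir_deriv_inner[OF Ap G W'])
    finally show ?thesis by (simp add: W(2) flat_connection_def)
  qed
  have "inner (conn (lie_bracket M X Y) Z p) w = inner (dir_deriv M (lie_bracket M X Y p) Z p) w"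
    using inner_conn[OF L Z(1) p w] by (simp only: flat_connection_def)
  also have "dir_deriv M (lie_bracket M X Y p) Z p
      = dir_deriv M (X p) (?D Y Z) p - dir_deriv M (Y p) (?D X Z) p"
    by (rule flat_connection_flat[OF X(1) Y(1) Z(1) p vector_field_tangent[OF L p], symmetric])
  finally have third: "inner (conn (lie_bracket M X Y) Z p) w
      = inner (dir_deriv M (X p) (?D Y Z) p) w - inner (dir_deriv M (Y p) (?D X Z) p) w"
    by (simp only: inner_diff_left)
  \<comment> \<open>Pythagoras: the inner product of the normal parts is that of the full
    derivatives minus that of the tangential parts.\<close>
  have II: "inner (normal_part M p (?D B Z p)) (normal_part M p (?D A W p))
      = inner (?D B Z p) (?D A W p) - inner (conn B Z p) (conn A W p)"
    if A: "vector_field M A" and B: "vector_field M B" for A B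
  proof -
    have "inner (conn B Z p) (conn A W p) = inner (?D B Z p) (conn A W p)"
      by (rule inner_conn[OF B Z(1) p vector_field_tangent[OF vector_field_conn[OF A W(1)] p]])
    moreover have "inner (conn A W p) (conn B Z p) = inner (?D A W p) (conn B Z p)"
      by (rule inner_conn[OF A W(1) p vector_field_tangent[OF vector_field_conn[OF B Z(1)] p]])
    ultimately show ?thesis
      unfolding normal_part_flat_connection[OF B Z(1) p] normal_part_flat_connection[OF A W(1) p]
      by (simp add: inner_diff_left inner_diff_right inner_commute)
  qed
  have "riemann_tensor M conn p x y z w
      = inner (conn X (conn Y Z) p) w - inner (conn Y (conn X Z) p) w - inner (conn (lie_bracket M X Y) Z p) w"
    by (simp only: riemann_tensor_def Let_def X_def Y_def Z_def inner_diff_left)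
  also have "\<dots> = (inner (?D Y Z p) (?D X W p) - inner (conn Y Z p) (conn X W p))
      - (inner (?D X Z p) (?D Y W p) - inner (conn X Z p) (conn Y W p))"
    unfolding second[OF X(1) Y(1)] second[OF Y(1) X(1)] third by simp
  also have "\<dots> = inner (normal_part M p (?D Y Z p)) (normal_part M p (?D X W p))
      - inner (normal_part M p (?D X Z p)) (normal_part M p (?D Y W p))"
    by (simp only: II X(1) Y(1))
  finally show ?thesis
    by (simp only: second_fundamental_form_def X_def Y_def Z_def W_def)
qed

text \<open>Passing from \<open>e\<close> to the basis chosen in \<open>K_normal\<close> multiplies
  numerator and denominator by the same squared determinant.\<close>

lemma K_normal_eq:
  assumes p: "p \<in> M" and e: "orthonormal_basis_of m (tangent_space M p) e"
  shows "K_normal m M p \<nu> = det_of m (\<lambda>i j. inner (second_fundamental_form M p (e i) (e j)) \<nu>)"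
proof -
  let ?II = "second_fundamental_form M p"
  define b where "b = (SOME b. basis_of m (tangent_space M p) b)"
  have b: "basis_of m (tangent_space M p) b"
    unfolding b_def by (rule someI[of _ e]) (use e in \<open>simp add: orthonormal_basis_of_def\<close>)
  have eT: "e i \<in> tangent_space M p" and bT: "b i \<in> tangent_space M p" if "i < m" for i
    using e b that by (auto simp: orthonormal_basis_of_def basis_of_def intro: span_base)
  have on: "inner (e i) (e j) = (if i = j then 1 else 0)" if "i < m" "j < m" for i j
    using e that by (simp add: orthonormal_basis_of_def)
  define A where "A = (\<lambda>i j. inner (e i) (b j))"
  have bA: "b j = (\<Sum>i<m. A i j *\<^sub>R e i)" if "j < m" for j
    unfolding A_def by (rule orthonormal_basis_expansion[OF e bT[OF that]])
  have "det_of m (\<lambda>i j. inner (?II (b i) (b j)) \<nu>)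
      = det_of m (\<lambda>i j. \<Sum>k<m. \<Sum>l<m. A k i * (inner (?II (e k) (e l)) \<nu> * A l j))"
  proof (rule det_of_cong)
    fix i j assume "i < m" "j < m"
    then have "?II (b i) (b j) = (\<Sum>k<m. \<Sum>l<m. (A k i * A l j) *\<^sub>R ?II (e k) (e l))"
      by (simp only: bA) (rule second_fundamental_form_sum[OF p], simp_all add: eT)
    then show "inner (?II (b i) (b j)) \<nu> = (\<Sum>k<m. \<Sum>l<m. A k i * (inner (?II (e k) (e l)) \<nu> * A l j))"
      by (simp add: inner_sum_left mult_ac)
  qed
  also have "\<dots> = det_of m A * (det_of m (\<lambda>i j. inner (?II (e i) (e j)) \<nu>) * det_of m A)"
    by (rule det_of_congruence)
  finally have num: "det_of m (\<lambda>i j. inner (?II (b i) (b j)) \<nu>)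
      = det_of m A * (det_of m (\<lambda>i j. inner (?II (e i) (e j)) \<nu>) * det_of m A)" .
  have "det_of m (\<lambda>i j. inner (b i) (b j))
      = det_of m (\<lambda>i j. \<Sum>k<m. \<Sum>l<m. A k i * (inner (e k) (e l) * A l j))"
    by (rule det_of_cong) (simp only: bA inner_sum_scaleR)
  also have "\<dots> = det_of m A * (det_of m (\<lambda>i j. inner (e i) (e j)) * det_of m A)"
    by (rule det_of_congruence)
  also have "det_of m (\<lambda>i j. inner (e i) (e j)) = 1"
    using det_of_id[of m] det_of_cong[of m "\<lambda>i j. inner (e i) (e j)" "\<lambda>i j. if i = j then 1 else 0", OF on] by simp
  finally have den: "det_of m (\<lambda>i j. inner (b i) (b j)) = det_of m A * det_of m A" by simp
  \<comment> \<open>Cancelling that square requires it to be nonzero: expressing \<open>e\<close>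
    through \<open>b\<close> in turn shows that the Gram determinant of \<open>b\<close>, which is
    this square, does not vanish.\<close>
  have "\<exists>u. e j = (\<Sum>i<m. u i *\<^sub>R b i)" if "j < m" for j
  proof -
    have "e j \<in> span (b ` {..<m})" and inj: "inj_on b {..<m}"
      using eT[OF that] b by (simp_all add: basis_of_def)
    then obtain u where "e j = (\<Sum>y\<in>b ` {..<m}. u y *\<^sub>R y)"
      using span_finite[of "b ` {..<m}"] by auto
    then have "e j = (\<Sum>i<m. u (b i) *\<^sub>R b i)" by (simp add: sum.reindex[OF inj])
    then show ?thesis by (rule exI[of _ "\<lambda>i. u (b i)"])
  qed
  then obtain C where C: "\<And>j. j < m \<Longrightarrow> e j = (\<Sum>i<m. C j i *\<^sub>R b i)" by metis
  have "det_of m (\<lambda>i j. C j i) * det_of m (\<lambda>i j. C j i) * det_of m (\<lambda>i j. inner (b i) (b j)) = 1"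
    by (rule det_of_gram[OF on C])
  then have "det_of m A \<noteq> 0" using den by auto
  then show ?thesis
    unfolding K_normal_def b_def[symmetric] Let_def num den by simp
qed

end

lemma levi_civita_submanifold_of_orientation:
  fixes M :: "'a::euclidean_space set"
  assumes "submanifold m M" "orientation m M \<O>" "levi_civita_connection M conn"
  shows "levi_civita_submanifold m M conn"
proof
  fix p assume "p \<in> M"
  then obtain b where b: "basis_of m (tangent_space M p) b"
    using assms(2) unfolding orientation_def by blast
  then have T: "tangent_space M p = span (b ` {..<m})" by (simp add: basis_of_def)
  show "subspace (tangent_space M p)" unfolding T by (rule subspace_span)
  show "dim (tangent_space M p) = m"
    using b unfolding T by (simp add: basis_of_def dim_eq_card_independent card_image)
qed (rule assms)+

theorem mainTheorem3:
  fixes M :: "'a::euclidean_space set"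
    and \<O> :: "'a \<Rightarrow> (nat \<Rightarrow> 'a) set"
    and conn :: "('a \<Rightarrow> 'a) \<Rightarrow> ('a \<Rightarrow> 'a) \<Rightarrow> 'a \<Rightarrow> 'a"
    and k m n r :: nat
  assumes "k = DIM('a)" and "m = 2 * r" and "n = k - m" and "n \<ge> 1"
    and "submanifold m M" and "compact M" and "orientation m M \<O>"
    and "levi_civita_connection M conn"
  shows "\<forall>p\<in>M. \<forall>e. positive_onb m M \<O> p e \<longrightarrow>
    (\<forall>v. (\<forall>i<m. v i \<in> tangent_space M p) \<longrightarrow>
      sphere_vol (n - 1) / sphere_vol (k - 1) *
        (generalized_gauss_curvature m M p * volume_form m M \<O> p v) =
      pfaffian_form r M conn p e v)"
proof (intro ballI allI impI)
  fix p e v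
  assume p: "p \<in> M" and e: "positive_onb m M \<O> p e" and v: "\<forall>i<m. v i \<in> tangent_space M p"
  interpret levi_civita_submanifold m M conn
    by (rule levi_civita_submanifold_of_orientation) (rule assms)+
  let ?N = "normal_space M p"
  define h where "h = (\<lambda>i j. second_fundamental_form M p (e i) (e j))"
  \<comment> \<open>The common value: the integral of the curvature and the Pfaffian are both
    explicit multiples of this sum.\<close>
  define D where "D = (\<Sum>\<tau> | \<tau> permutes {..<2 * r}. \<Sum>\<rho> | \<rho> permutes {..<2 * r}. of_int (sign \<tau>) * of_int (sign \<rho>) *
      (\<Prod>s<r. inner (h (\<rho> (2 * s)) (\<tau> (2 * s))) (h (\<rho> (2 * s + 1)) (\<tau> (2 * s + 1)))))"
  define V where "V = det_of (2 * r) (\<lambda>i j. inner (e i) (v j))"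
  have e_on: "orthonormal_basis_of m (tangent_space M p) e" using e by (simp add: positive_onb_def)
  have eT: "e i \<in> tangent_space M p" if "i < 2 * r" for i
    using e_on that assms(2) by (auto simp: orthonormal_basis_of_def basis_of_def intro: span_base)
  have dim_N: "dim ?N = n" using dim_normal[OF p] assms(1,3) by simp
  have k: "dim ?N + 2 * r = k" using dim_N assms(2,3,4) by simp
  have "(\<integral>\<nu>. K_normal m M p \<nu> \<partial>sphere_measure ?N)
      = (\<integral>\<nu>. det_of (2 * r) (\<lambda>i j. inner (h i j) \<nu>) \<partial>sphere_measure ?N)"
    by (rule Bochner_Integration.integral_cong[OF refl]) (simp only: K_normal_eq[OF p e_on] h_def assms(2)[symmetric])
  also have "\<dots> = sphere_vol (k - 1) / (2 * pi) ^ r / (2 ^ r * fact r) * D"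
    unfolding D_def k[symmetric]
    by (rule integral_sphere_det[OF subspace_normal])
      (use dim_N assms(4) in \<open>simp_all add: h_def second_fundamental_form_normal[OF p]\<close>)
  finally have K: "generalized_gauss_curvature m M p
      = 1 / sphere_vol (n - 1) * (sphere_vol (k - 1) / (2 * pi) ^ r / (2 ^ r * fact r) * D)"
    using assms(1,3) by (simp only: generalized_gauss_curvature_def)
  have vol: "volume_form m M \<O> p v = V"
    unfolding V_def using volume_form_eq[OF assms(7) p e] v assms(2) by simp
  have pf: "pfaffian_form r M conn p e v = V * D / (4 ^ r * pi ^ r * fact r)"
    unfolding V_def D_def by (rule pfaffian_form_eq) (simp only: h_def gauss_equation[OF p] eT)
  \<comment> \<open>Both \<open>sphere_vol (n - 1)\<close> and \<open>sphere_vol (k - 1)\<close>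
    occur as denominators and are cancelled.\<close>
  have pos: "sphere_vol d \<noteq> 0" for d
  proof -
    have "0 < unit_ball_vol (real (Suc d))" by (rule unit_ball_vol_pos) simp
    then have "unit_ball_vol (real (Suc d)) \<noteq> 0" by (rule less_imp_neq[THEN not_sym])
    then show ?thesis by (simp add: sphere_vol_def del: of_nat_Suc)
  qed
  \<comment> \<open>The last match of constants: \<open>(2 * pi) ^ r * 2 ^ r\<close> from Wick's
    formula is \<open>4 ^ r * pi ^ r\<close> from the Pfaffian.\<close>
  have "4 ^ r = (2 ^ r * 2 ^ r :: real)" by (simp flip: power_mult_distrib)
  then show "sphere_vol (n - 1) / sphere_vol (k - 1) * (generalized_gauss_curvature m M p * volume_form m M \<O> p v)
      = pfaffian_form r M conn p e v"
    unfolding K vol pf using pos[of "n - 1"] pos[of "k - 1"] by (simp add: power_mult_distrib field_simps)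
qed

end
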